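(* Consider the two-team static game $\mathcal P_N$ (finite team sizes $N_1,N_2\in\mathbb N$) described in the context. Assume: (a) (Absolute continuity) Let $\tilde\mu^N(\cdot\mid\omega_0)$ be the conditional distribution of all observations $(y^1_{1:N_1},y^2_{1:N_2})$ given $\omega_0$. For all $i\in\{1,2\}$ and $k\in\{1,\dots,N_i\}$ there exist a probability measure $Q^i_k$ on $\mathbb Y^i$ and a bounded measurable function $f^i_k\ge 0$ such that for all Borel $B=\prod_{i=1}^2 B^i_1\times\cdots\times B^i_{N_i}$ with $B^i_k\subseteq\mathbb Y^i$, $$\tilde\mu^N(B\mid\omega_0)=\int_B\prod_{i=1}^2\prod_{k=1}^{N_i} f^i_k\big(y^i_k,\omega_0,y^i_{-k},\underline y^{-i}\big)\,Q^i_k(dy^i_k),$$ where $y^i_{-k}$ denotes the observations of team $i$ other than $y^i_k$ and $\underline y^{-i}$ all observations of the other team. (b) $\mathbb U^i$ is compact for $i=1,2$. (c) For $i=1,2$, $c^i(\omega_0,\cdot)$ is continuous on $\prod_{j=1}^2(\mathbb U^j)^{N_j}$ for every $\omega_0$, and $c^i$ is uniformly bounded. Then there exists a Nash equilibrium $(P_\pi^{1*},P_\pi^{2*})\in L^1_{\mathrm{CO},N}\times L^2_{\mathrm{CO},N}$ for $\mathcal P_N$ among all policies in $L^1_N\times L^2_N$, i.e. for $i=1,2$, $$J^i_{\pi,N}(P^{i*}_\pi,P^{-i*}_\pi)\le J^i_{\pi,N}(P^{i}_\pi,P^{-i*}_\pi)\qquad\text{for all }P^i_\pi\in L^i_N 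.$$
   Context: Game. There are two players (teams) $i\in\{1,2\}$; $-i$ denotes the other one. Team $i$ consists of $N_i$ decision makers (DMs) $k=1,\dots,N_i$. DM $k$ of team $i$ observes $y^i_k\in\mathbb Y^i$ and chooses an action $u^i_k\in\mathbb U^i$, where $\mathbb Y^i\subseteq\mathbb R^{m_i}$ and $\mathbb U^i\subseteq\mathbb R^{n_i}$ are Borel. The game is static: the observations are exogenous random variables on a probability space $(\Omega,\mathcal F,\mathbb P)$, unaffected by actions. $\omega_0$ is an exogenous random variable with values in a Borel space $\Omega_0$, and $c^i:\Omega_0\times\prod_{j=1}^2(\mathbb U^j)^{N_j}\to\mathbb R_+$ is the Borel cost function common to all DMs of team $i$. $\mu^N$ is the joint law of $(\omega_0,y^1_{1:N_1},y^2_{1:N_2})$. $\mathcal P(\cdot)$ denotes the Borel probability measures on a space. Policies. A (relaxed) policy of DM $k$ of team $i$ is a stochastic kernel $\gamma^i_k(du\mid y)$ from $\mathbb Y^i$ to $\mathbb U^i$, identified with the measure $\gamma^i_k(du\mid y)Q^i_k(dy)\in\mathcal P(\mathbb U^i\times\mathbb Y^i)$; $\Gamma^i_k$ is the set of these, with the weak convergence topology on the measures $\gamma^i_k(du\mid y)Q^i_k(dy)$ and its Borel $\sigma$-field. $\Gamma^i_N=\prod_{k=1}^{N_i}\Gamma^i_k$ (product topology), and the set of randomized policies of team $i$ is $L^i_N=\mathcal P(\Gamma^i_N)$. $L^i_{\mathrm{CO},N}$ (common and private randomness) is the set of $P_\pi\in L^i_N$ for which there are $\eta^i\in\mathcal P([0,1])$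 and stochastic kernels $P_{\pi,k}(\cdot\mid z)$ from $[0,1]$ to $\Gamma^i_k$ with $$P_\pi(\gamma^i_1\in A_1,\dots,\gamma^i_{N_i}\in A_{N_i})=\int_{[0,1]}\prod_{k=1}^{N_i}P_{\pi,k}(\gamma^i_k\in A_k\mid z)\,\eta^i(dz)\quad\forall A_k\in\mathcal B(\Gamma^i_k).$$ Expected cost of team $i$ under $(P^1_\pi,P^2_\pi)\in L^1_N\times L^2_N$: $$J^i_{\pi,N}(P^1_\pi,P^2_\pi)=\int c^i(\omega_0,u^1_{1:N_1},u^2_{1:N_2})\prod_{j=1}^2\prod_{k=1}^{N_j}\gamma^j_k(du^j_k\mid y^j_k)\,\prod_{j=1}^2P^j_\pi(d\gamma^j_{1:N_j})\,\mu^N(d\omega_0,dy^1_{1:N_1},dy^2_{1:N_2}).$$ *)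

theory Defs
  imports "HOL-Probability.Probability"
begin

abbreviation borel_on :: "'a::topological_space set \<Rightarrow> 'a measure" where
  "borel_on X \<equiv> restrict_space borel X"

abbreviation borel_vec :: "nat \<Rightarrow> 'a::topological_space set \<Rightarrow> (nat \<Rightarrow> 'a) measure" where
  "borel_vec N X \<equiv> (\<Pi>\<^sub>M k\<in>{..<N}. borel_on X)"

definition borel_of :: "'a topology \<Rightarrow> 'a measure" where
  "borel_of T = sigma (topspace T) {S. openin T S}"

text \<open>The weak topology on the Borel probability measures on \<open>X\<close>: the coarsest one making
  \<open>m \<mapsto> \<integral>f dm\<close> continuous for every bounded continuous \<open>f\<close> on \<open>X\<close>.\<close>

definition weak_topology :: "'a::topological_space set \<Rightarrow> 'a measure topology" where
  "weak_topology X = topology_generated_by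
     {{m \<in> space (prob_algebra (borel_on X)). (\<integral>x. f x \<partial>m) \<in> V} | f V.
        continuous_on X (f :: 'a \<Rightarrow> real) \<and> bounded (f ` X) \<and> open V}"

text \<open>A stochastic kernel from \<open>Y\<close> to \<open>U\<close> is an element of
  \<open>borel_on Y \<rightarrow>\<^sub>M prob_algebra (borel_on U)\<close>. The following is the measure
  \<open>\<gamma>(du | y) Q(dy)\<close> on \<open>U \<times> Y\<close>.\<close>

definition kernel_joint ::
  "'u::topological_space set \<Rightarrow> 'y::topological_space set \<Rightarrow> 'y measure \<Rightarrow> ('y \<Rightarrow> 'u measure)
    \<Rightarrow> ('u \<times> 'y) measure" where
  "kernel_joint U Y Q \<gamma> = Q \<bind> (\<lambda>y. distr (\<gamma> y) (borel_on (U \<times> Y)) (\<lambda>u. (u, y)))"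

definition policies ::
  "'u::topological_space set \<Rightarrow> 'y::topological_space set \<Rightarrow> 'y measure \<Rightarrow> ('u \<times> 'y) measure set" where
  "policies U Y Q = kernel_joint U Y Q ` (borel_on Y \<rightarrow>\<^sub>M prob_algebra (borel_on U))"

definition policy_top ::
  "'u::topological_space set \<Rightarrow> 'y::topological_space set \<Rightarrow> 'y measure \<Rightarrow> ('u \<times> 'y) measure topology" where
  "policy_top U Y Q = subtopology (weak_topology (U \<times> Y)) (policies U Y Q)"

text \<open>Throughout, the decision makers of a team of size \<open>N\<close> are indexed by \<open>{..<N}\<close>, and
  \<open>Q k\<close> is the reference measure of decision maker \<open>k\<close>.\<close>

definition team_top ::
  "'u::topological_space set \<Rightarrow> 'y::topological_space set \<Rightarrow> nat \<Rightarrow> (nat \<Rightarrow> 'y measure)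
    \<Rightarrow> (nat \<Rightarrow> ('u \<times> 'y) measure) topology" where
  "team_top U Y N Q = product_topology (\<lambda>k. policy_top U Y (Q k)) {..<N}"

definition L_team ::
  "'u::topological_space set \<Rightarrow> 'y::topological_space set \<Rightarrow> nat \<Rightarrow> (nat \<Rightarrow> 'y measure)
    \<Rightarrow> (nat \<Rightarrow> ('u \<times> 'y) measure) measure set" where
  "L_team U Y N Q = space (prob_algebra (borel_of (team_top U Y N Q)))"

definition L_CO ::
  "'u::topological_space set \<Rightarrow> 'y::topological_space set \<Rightarrow> nat \<Rightarrow> (nat \<Rightarrow> 'y measure)
    \<Rightarrow> (nat \<Rightarrow> ('u \<times> 'y) measure) measure set" where
  "L_CO U Y N Q = {P \<in> L_team U Y N Q.
     \<exists>\<eta> K. \<eta> \<in> space (prob_algebra (borel_on {0..1::real})) \<and>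
       (\<forall>k<N. K k \<in> borel_on {0..1} \<rightarrow>\<^sub>M prob_algebra (borel_of (policy_top U Y (Q k)))) \<and>
       (\<forall>A. (\<forall>k<N. A k \<in> sets (borel_of (policy_top U Y (Q k)))) \<longrightarrow>
          emeasure P (\<Pi>\<^sub>E k\<in>{..<N}. A k) = (\<integral>\<^sup>+z. (\<Prod>k<N. emeasure (K k z) (A k)) \<partial>\<eta>))}"

text \<open>A kernel representing a policy. It is determined only up to a \<open>Q\<close>-null set. When the
  observation of the decision maker has a law that is absolutely continuous with respect to \<open>Q\<close>,
  the expected cost below does not depend on the representative.\<close>

definition policy_kernel ::
  "'u::topological_space set \<Rightarrow> 'y::topological_space set \<Rightarrow> 'y measure \<Rightarrow> ('u \<times> 'y) measure
    \<Rightarrow> 'y \<Rightarrow> 'u measure" where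
  "policy_kernel U Y Q g =
     (SOME \<gamma>. \<gamma> \<in> borel_on Y \<rightarrow>\<^sub>M prob_algebra (borel_on U) \<and> kernel_joint U Y Q \<gamma> = g)"

text \<open>The law of the actions of a team that uses the policies \<open>g\<close> and observes \<open>y\<close>.\<close>

definition team_actions ::
  "'u::topological_space set \<Rightarrow> 'y::topological_space set \<Rightarrow> nat \<Rightarrow> (nat \<Rightarrow> 'y measure)
    \<Rightarrow> (nat \<Rightarrow> ('u \<times> 'y) measure) \<Rightarrow> (nat \<Rightarrow> 'y) \<Rightarrow> (nat \<Rightarrow> 'u) measure" where
  "team_actions U Y N Q g y = (\<Pi>\<^sub>M k\<in>{..<N}. policy_kernel U Y (Q k) (g k) (y k))"

text \<open>Policies are integrated outermost: the representing kernels are measurable in the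
  observation for each fixed policy, but they are not chosen measurably in the policy. The cost
  is nonnegative, so the integrals are taken in the extended nonnegative reals.\<close>

definition expected_cost ::
  "'u1::topological_space set \<Rightarrow> 'y1::topological_space set \<Rightarrow> nat \<Rightarrow> (nat \<Rightarrow> 'y1 measure) \<Rightarrow>
   'u2::topological_space set \<Rightarrow> 'y2::topological_space set \<Rightarrow> nat \<Rightarrow> (nat \<Rightarrow> 'y2 measure) \<Rightarrow>
   ('w \<times> (nat \<Rightarrow> 'y1) \<times> (nat \<Rightarrow> 'y2)) measure \<Rightarrow>
   ('w \<times> (nat \<Rightarrow> 'u1) \<times> (nat \<Rightarrow> 'u2) \<Rightarrow> real) \<Rightarrow>
   (nat \<Rightarrow> ('u1 \<times> 'y1) measure) measure \<Rightarrow> (nat \<Rightarrow> ('u2 \<times> 'y2) measure) measure \<Rightarrow> ennreal" where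
  "expected_cost U1 Y1 N1 Q1 U2 Y2 N2 Q2 \<mu> c P1 P2 =
     (\<integral>\<^sup>+(g1, g2).
        (\<integral>\<^sup>+(w, y1, y2).
           (\<integral>\<^sup>+(u1, u2). ennreal (c (w, u1, u2))
              \<partial>(team_actions U1 Y1 N1 Q1 g1 y1 \<Otimes>\<^sub>M team_actions U2 Y2 N2 Q2 g2 y2))
         \<partial>\<mu>)
      \<partial>(P1 \<Otimes>\<^sub>M P2))"

definition obs_vec :: "nat \<Rightarrow> (nat \<Rightarrow> 'o \<Rightarrow> 'y) \<Rightarrow> 'o \<Rightarrow> nat \<Rightarrow> 'y" where
  "obs_vec N y \<omega> = (\<lambda>k\<in>{..<N}. y k \<omega>)"

text \<open>\<open>\<kappa>\<close> is a regular conditional distribution of \<open>Z\<close> given \<open>X\<close> under \<open>P\<close>.\<close>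

definition is_cond_distr ::
  "'o measure \<Rightarrow> 'a measure \<Rightarrow> ('o \<Rightarrow> 'a) \<Rightarrow> 'b measure \<Rightarrow> ('o \<Rightarrow> 'b) \<Rightarrow> ('a \<Rightarrow> 'b measure) \<Rightarrow> bool" where
  "is_cond_distr P MX X MZ Z \<kappa> \<longleftrightarrow>
     \<kappa> \<in> MX \<rightarrow>\<^sub>M prob_algebra MZ \<and>
     (\<forall>A\<in>sets MX. \<forall>B\<in>sets MZ.
        emeasure P {\<omega> \<in> space P. X \<omega> \<in> A \<and> Z \<omega> \<in> B} =
        (\<integral>\<^sup>+x\<in>A. emeasure (\<kappa> x) B \<partial>distr P MX X))"

end

(* A policy of one decision maker is a measure on actions and observations with the fixed
   observation marginal Q. The set of these measures is compact and metrizable: after lifting the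
   actions along a space-filling curve, weak limits of kernels are built from weak-star limits of
   their distribution functions. By absolute continuity the law of (omega_0, y) has a density with
   respect to the product of the law of omega_0 and the Q's, so the cost is a continuous function of
   the two team policies, even though the cost and the density are merely measurable in omega_0
   and y. Hence the game over L_1 x L_2 is the mixed extension of a game with continuous costs on
   compact metrizable strategy spaces (Glicksberg); its equilibrium is a limit of equilibria of
   finite games, which come from Brouwer's theorem.

   Both strategy spaces are continuous images of closed subsets of [0,1], via a space-filling curve
   onto the Hilbert cube. So the equilibrium is the image of two measures on [0,1]. The image of a
   measure under z |-> (gamma_k(z))_k lies in L_CO, with point masses as the kernels, so
   restricting to L_CO costs nothing. *)

theory Submission
  imports Defs
begin

section \<open>Brouwer's theorem and finite two-player games\<close>

text \<open>Two obstacles shape the proof. The policy space is an abstract topological space of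
  measures, and the cost is written through kernels that are picked by choice, not measurably in the
  policy. Both are met by countably many numbers per policy: the integrals of 1_A(y) p(u), with A
  from a countable pi-system generating the observations and p from partitions of unity of the
  actions. They depend on the measure alone, map the team policies onto a closed subset of the
  Hilbert cube, and the cost turns out to be a function of them. All limits are then taken along
  sequences of coordinates. Indicators of A can replace continuous functions because the observation
  marginal Q is fixed. Products of several kernels converge because, under a product measure,
  weak-star limits in separate variables multiply; under a law with dependent observations this can
  fail, so the density is moved into the L^1 test function. A randomized deviation averages pure
  ones, so it suffices to compare with pure deviations.\<close>

lemma tendsto_fun_iff:
  fixes f :: "'a \<Rightarrow> 'i \<Rightarrow> 'b::topological_space"
  shows "(f \<longlongrightarrow> l) F \<longleftrightarrow> (\<forall>i. ((\<lambda>n. f n i) \<longlongrightarrow> l i) F)"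
proof -
  have "(f \<longlongrightarrow> l) F \<longleftrightarrow> limitin (product_topology (\<lambda>_::'i. euclidean :: 'b topology) UNIV) f l F"
    by (simp add: euclidean_product_topology limitin_canonical_iff)
  also have "\<dots> \<longleftrightarrow> (\<forall>i. ((\<lambda>n. f n i) \<longlongrightarrow> l i) F)"
    by (simp add: limitin_componentwise)
  finally show ?thesis .
qed

lemma compact_PiE_euclidean:
  fixes S :: "'i \<Rightarrow> 'b::topological_space set"
  assumes "\<And>i. compact (S i)"
  shows "compact (PiE UNIV S)"
  using compactin_PiE[of "\<lambda>_. euclidean" UNIV S] assms
  by (auto simp: euclidean_product_topology)

text \<open>Tychonoff's theorem replaces the diagonal argument: the product of the intervals is
  compact, and since the index type is countable the function space is metric, so compactness yields
  convergent subsequences.\<close>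

lemma bounded_real_fun_convergent_subseq:
  fixes f :: "nat \<Rightarrow> 'i::countable \<Rightarrow> real"
  assumes "\<And>n i. f n i \<in> {a i..b i}"
  obtains r l where "strict_mono (r :: nat \<Rightarrow> nat)" "\<And>i. l i \<in> {a i..b i}"
    "\<And>i. (\<lambda>n. f (r n) i) \<longlonglongrightarrow> l i"
proof -
  have "seq_compact (PiE UNIV (\<lambda>i. {a i..b i}))"
    using compact_PiE_euclidean[of "\<lambda>i. {a i..b i}"] compact_eq_seq_compact_metric by auto
  moreover have "\<forall>n. f n \<in> PiE UNIV (\<lambda>i. {a i..b i})"
    using assms by auto
  ultimately obtain l r where "l \<in> PiE UNIV (\<lambda>i. {a i..b i})" "strict_mono r" "(f \<circ> r) \<longlonglongrightarrow> l"
    by (metis seq_compactE)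
  then show thesis
    using that[of r l] by (auto simp: tendsto_fun_iff PiE_iff)
qed

text \<open>Along the grids of mesh \<open>1 / p\<close>, Kuhn's lemma gives for each coordinate a point that is not moved up
  and a nearby point that is not moved down; at a limit point of these cells, no coordinate moves.\<close>

lemma brouwer_cube_nat:
  fixes f :: "(nat \<Rightarrow> real) \<Rightarrow> nat \<Rightarrow> real"
  assumes cont: "\<And>X x. (\<And>n i. X n i \<in> {0..1}) \<Longrightarrow> (\<And>i. x i \<in> {0..1}) \<Longrightarrow> (\<And>i. (\<lambda>n. X n i) \<longlonglongrightarrow> x i) \<Longrightarrow>
      (\<And>i. i < d \<Longrightarrow> (\<lambda>n. f (X n) i) \<longlonglongrightarrow> f x i)"
    and range: "\<And>x i. (\<And>i. x i \<in> {0..1}) \<Longrightarrow> i < d \<Longrightarrow> f x i \<in> {0..1}"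
  obtains x where "\<And>i. x i \<in> {0..1}" "\<And>i. i < d \<Longrightarrow> f x i = x i" "\<And>i. d \<le> i \<Longrightarrow> x i = 0"
proof -
  \<comment> \<open>Grid point with integer coordinates \<open>z\<close>, embedded in the cube.
    Coordinates from \<open>d\<close> on are 0, and \<open>min 1\<close> keeps the point in the cube
    for every \<open>z\<close>.\<close>
  define g where "g p z i = (if i < d then min 1 (real (z i) / real (Suc p)) else 0)"
    for p :: nat and z :: "nat \<Rightarrow> nat" and i
  have g01: "g p z i \<in> {0..1}" for p z i
    by (auto simp: g_def)
  \<comment> \<open>Kuhn's lemma prescribes label 0 on the face \<open>z i = 0\<close> and label 1
    on the face \<open>z i = Suc p\<close>; elsewhere label 1 means that \<open>f\<close> moves
    coordinate \<open>i\<close> down.\<close>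
  define lab where "lab p z i = (if (z i = 0 \<or> f (g p z) i \<ge> g p z i) \<and> z i \<noteq> Suc p then 0 else 1::nat)" for p z i
  have "\<exists>q r s. \<forall>i<d. q i < Suc p \<and> (\<forall>j<d. q j \<le> r i j \<and> r i j \<le> q j + 1) \<and>
     (\<forall>j<d. q j \<le> s i j \<and> s i j \<le> q j + 1) \<and> lab p (r i) i = 0 \<and> lab p (s i) i = 1" for p
  proof -
    obtain q where q: "\<forall>i<d. q i < Suc p"
      "\<forall>i<d. \<exists>r s. (\<forall>j<d. q j \<le> r j \<and> r j \<le> q j + 1) \<and> (\<forall>j<d. q j \<le> s j \<and> s j \<le> q j + 1) \<and> lab p r i \<noteq> lab p s i"
      by (rule kuhn_lemma[of "Suc p" d "lab p"]) (auto simp: lab_def)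
    have "\<exists>r s. (\<forall>j<d. q j \<le> r j \<and> r j \<le> q j + 1) \<and> (\<forall>j<d. q j \<le> s j \<and> s j \<le> q j + 1)
       \<and> lab p r i = 0 \<and> lab p s i = 1" if "i < d" for i
    proof -
      obtain r s where rs: "\<forall>j<d. q j \<le> r j \<and> r j \<le> q j + 1" "\<forall>j<d. q j \<le> s j \<and> s j \<le> q j + 1" "lab p r i \<noteq> lab p s i"
        using q(2) \<open>i < d\<close> by blast
      have "lab p z i = 0 \<or> lab p z i = 1" for z by (auto simp: lab_def)
      then show ?thesis using rs by metis
    qed
    then obtain r s where "\<forall>i<d. (\<forall>j<d. q j \<le> r i j \<and> r i j \<le> q j + 1) \<and> (\<forall>j<d. q j \<le> s i j \<and> s i j \<le> q j + 1)
       \<and> lab p (r i) i = 0 \<and> lab p (s i) i = 1"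
      by metis
    then show ?thesis using q(1) by (intro exI[of _ q] exI[of _ r] exI[of _ s]) auto
  qed
  then have "\<forall>p. \<exists>q r s. \<forall>i<d. q i < Suc p \<and> (\<forall>j<d. q j \<le> r i j \<and> r i j \<le> q j + 1) \<and>
     (\<forall>j<d. q j \<le> s i j \<and> s i j \<le> q j + 1) \<and> lab p (r i) i = 0 \<and> lab p (s i) i = 1"
    by (rule allI)
  then obtain q r s where qrs: "\<And>p. \<forall>i<d. q p i < Suc p \<and> (\<forall>j<d. q p j \<le> r p i j \<and> r p i j \<le> q p j + 1) \<and>
     (\<forall>j<d. q p j \<le> s p i j \<and> s p i j \<le> q p j + 1) \<and> lab p (r p i) i = 0 \<and> lab p (s p i) i = 1"
    unfolding choice_iff by blast
  have q: "\<And>p i. i < d \<Longrightarrow> q p i < Suc p"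
    and r: "\<And>p i j. i < d \<Longrightarrow> j < d \<Longrightarrow> q p j \<le> r p i j \<and> r p i j \<le> q p j + 1"
    and s: "\<And>p i j. i < d \<Longrightarrow> j < d \<Longrightarrow> q p j \<le> s p i j \<and> s p i j \<le> q p j + 1"
    and labr: "\<And>p i. i < d \<Longrightarrow> lab p (r p i) i = 0" and labs: "\<And>p i. i < d \<Longrightarrow> lab p (s p i) i = 1"
    using qrs by blast+
  obtain k x where k: "strict_mono (k :: nat \<Rightarrow> nat)" and x01: "\<And>i. x i \<in> {0..1}"
    and lim: "\<And>i. (\<lambda>n. g (k n) (q (k n)) i) \<longlonglongrightarrow> x i"
    using bounded_real_fun_convergent_subseq[of "\<lambda>p. g p (q p)" "\<lambda>_. 0" "\<lambda>_. 1"] g01 by metis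
  have inv: "(\<lambda>n. 1 / real (Suc (k n))) \<longlonglongrightarrow> 0"
    using LIMSEQ_subseq_LIMSEQ[OF LIMSEQ_Suc[OF lim_1_over_n[where 'a=real]] k] by (simp add: o_def)
  \<comment> \<open>All vertices of a cell differ from its base point \<open>q\<close> by at most
    one grid step, so along the subsequence they share its limit.\<close>
  have near: "(\<lambda>n. g (k n) (z n) j) \<longlonglongrightarrow> x j"
    if "\<And>n j. j < d \<Longrightarrow> q (k n) j \<le> z n j \<and> z n j \<le> q (k n) j + 1" for z j
  proof (rule Lim_transform2[OF lim[of j]])
    show "(\<lambda>n. g (k n) (q (k n)) j - g (k n) (z n) j) \<longlonglongrightarrow> 0"
    proof (rule Lim_null_comparison[OF _ inv], rule always_eventually, rule allI)
      fix n
      show "norm (g (k n) (q (k n)) j - g (k n) (z n) j) \<le> 1 / real (Suc (k n))"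
      proof (cases "j < d")
        case True
        have "real (q (k n) j) \<le> real (z n j)" "real (z n j) \<le> real (q (k n) j) + 1"
          using that[OF True, of n] by linarith+
        then have *: "real (q (k n) j) / real (Suc (k n)) \<le> real (z n j) / real (Suc (k n))"
          "real (z n j) / real (Suc (k n)) \<le> real (q (k n) j) / real (Suc (k n)) + 1 / real (Suc (k n))"
          by (simp_all add: divide_right_mono add_divide_distrib[symmetric])
        have "\<bar>min 1 a - min 1 b\<bar> \<le> c" if "a \<le> b" "b \<le> a + c" for a b c :: real
          using that by auto
        from this[OF *] show ?thesis using True unfolding g_def real_norm_def by simp
      qed (auto simp: g_def)
    qed
  qed
  have "f x i = x i" if "i < d" for i
  proof (rule antisym)
    have l1: "(\<lambda>n. g (k n) (r (k n) i) j) \<longlonglongrightarrow> x j" for j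
      by (rule near) (use r that in auto)
    have l2: "(\<lambda>n. g (k n) (s (k n) i) j) \<longlonglongrightarrow> x j" for j
      by (rule near) (use s that in auto)
    \<comment> \<open>On the face \<open>r p i i = 0\<close> the label carries no information about
      \<open>f\<close>, but there the inequality holds because \<open>f\<close> maps into the cube;
      dually for \<open>b\<close> on the opposite face.\<close>
    have a: "g p (r p i) i \<le> f (g p (r p i)) i" for p
    proof -
      have "r p i i = 0 \<or> f (g p (r p i)) i \<ge> g p (r p i) i"
        using labr[OF that, of p] by (auto simp: lab_def split: if_splits)
      moreover have "0 \<le> f (g p (r p i)) i" using range[OF g01 that] by auto
      moreover have "r p i i = 0 \<Longrightarrow> g p (r p i) i = 0" by (auto simp: g_def)
      ultimately show ?thesis by auto
    qed
    have b: "f (g p (s p i)) i \<le> g p (s p i) i" for p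
    proof -
      have "s p i i = Suc p \<or> f (g p (s p i)) i \<le> g p (s p i) i"
        using labs[OF that, of p] by (auto simp: lab_def split: if_splits)
      moreover have "f (g p (s p i)) i \<le> 1" using range[OF g01 that] by auto
      moreover have "s p i i = Suc p \<Longrightarrow> g p (s p i) i = 1" using that by (auto simp: g_def)
      ultimately show ?thesis by auto
    qed
    show "x i \<le> f x i"
      by (rule LIMSEQ_le[OF l1[of i] cont[OF g01 x01 l1 that]]) (use a in auto)
    show "f x i \<le> x i"
      by (rule LIMSEQ_le[OF cont[OF g01 x01 l2 that] l2[of i]]) (use b in auto)
  qed
  moreover have "x i = 0" if "d \<le> i" for i
  proof -
    have "(\<lambda>n. g (k n) (q (k n)) i) = (\<lambda>n. 0)" using that by (auto simp: g_def)
    then show ?thesis using lim[of i] by (simp add: LIMSEQ_const_iff)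
  qed
  ultimately show thesis using that x01 by blast
qed

section \<open>Nash equilibria of finite bimatrix games\<close>

text \<open>Missing mass is spread evenly when the sum is below 1, and the vector is rescaled when
  the sum exceeds 1. The map is continuous and fixes the simplex, so a fixed point theorem for the
  cube serves for simplices.\<close>

definition simplex_retract :: "nat \<Rightarrow> (nat \<Rightarrow> real) \<Rightarrow> nat \<Rightarrow> real" where
  "simplex_retract m x i = (x i + max 0 (1 - (\<Sum>i<m. x i)) / m) / max 1 (\<Sum>i<m. x i)"

lemma simplex_retract_simplex:
  assumes "m > 0" "\<And>i. i < m \<Longrightarrow> 0 \<le> x i"
  shows "(\<Sum>i<m. simplex_retract m x i) = 1" "\<And>i. i < m \<Longrightarrow> 0 \<le> simplex_retract m x i"
proof -
  have "(\<Sum>i<m. simplex_retract m x i) = ((\<Sum>i<m. x i) + max 0 (1 - (\<Sum>i<m. x i))) / max 1 (\<Sum>i<m. x i)"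
    using assms(1) by (simp add: simplex_retract_def sum_divide_distrib[symmetric] sum.distrib)
  then show "(\<Sum>i<m. simplex_retract m x i) = 1"
    by (auto simp: max_def)
  show "\<And>i. i < m \<Longrightarrow> 0 \<le> simplex_retract m x i"
    using assms by (auto simp: simplex_retract_def intro!: divide_nonneg_nonneg add_nonneg_nonneg)
qed

lemma simplex_retract_id: "(\<Sum>i<m. x i) = 1 \<Longrightarrow> simplex_retract m x i = x i"
  by (simp add: simplex_retract_def)

text \<open>Nash's map moves weight towards the pure strategies that are better than the mixed one. Here it
  is described by the gains \<open>g\<close>; if it fixes \<open>p\<close>, all gains vanish, because some \<open>i\<close> with \<open>p i > 0\<close>
  is no better than average.\<close>

lemma nash_map_fixed_point:
  fixes p a :: "nat \<Rightarrow> real"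
  assumes p: "\<And>i. i < m \<Longrightarrow> 0 \<le> p i" "(\<Sum>i<m. p i) = 1"
    and fixed: "\<And>i. i < m \<Longrightarrow> (p i + max 0 ((\<Sum>i<m. p i * a i) - a i)) / (1 + (\<Sum>i<m. max 0 ((\<Sum>i<m. p i * a i) - a i))) = p i"
    and i: "i < m"
  shows "(\<Sum>i<m. p i * a i) \<le> a i"
proof -
  define v where "v = (\<Sum>i<m. p i * a i)"
  define g where "g i = max 0 (v - a i)" for i
  define S where "S = (\<Sum>i<m. g i)"
  have S0: "S \<ge> 0" by (auto simp: S_def g_def intro!: sum_nonneg)
  have gS: "g i = p i * S" if "i < m" for i
  proof -
    have "(p i + g i) / (1 + S) = p i" using fixed[OF that] by (simp add: v_def g_def S_def)
    then show ?thesis using S0 by (simp add: field_simps)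
  qed
  have "\<exists>i<m. p i > 0 \<and> a i \<ge> v"
  proof (rule ccontr)
    assume "\<not> ?thesis"
    then have neg: "\<And>i. i < m \<Longrightarrow> p i > 0 \<Longrightarrow> a i < v" by force
    obtain i0 where i0: "i0 < m" "p i0 > 0"
      using p by (metis lessThan_iff less_eq_real_def sum.neutral zero_neq_one)
    have "(\<Sum>i<m. p i * a i) < (\<Sum>i<m. p i * v)"
    proof (rule sum_strict_mono_ex1)
      show "\<forall>i\<in>{..<m}. p i * a i \<le> p i * v"
      proof
        fix i assume "i \<in> {..<m}"
        then show "p i * a i \<le> p i * v"
          using p(1)[of i] neg[of i] by (cases "p i = 0") (auto intro!: mult_left_mono)
      qed
      show "\<exists>i\<in>{..<m}. p i * a i < p i * v"
        using i0 neg[of i0] by (intro bexI[of _ i0]) (auto intro: mult_strict_left_mono)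
    qed auto
    also have "\<dots> = v" using p(2) by (simp add: sum_distrib_right[symmetric])
    finally show False by (simp add: v_def)
  qed
  then obtain i1 where i1: "i1 < m" "p i1 > 0" "a i1 \<ge> v" by auto
  then have "p i1 * S = 0" using gS[OF i1(1)] by (auto simp: g_def)
  then have "S = 0" using i1 by auto
  then have "g i = 0" using gS[OF i] by simp
  then show ?thesis by (simp add: g_def v_def max_def split: if_splits)
qed

text \<open>The matrices hold costs, so the gain of a pure strategy is what it saves against the
  current mixture. Both mixtures are stored in one vector, the first \<open>m\<close> entries for
  player 1 and the next \<open>n\<close> for player 2, and Nash's map is applied after retracting
  each block to its simplex.\<close>

lemma finite_bimatrix_nash:
  fixes A B :: "nat \<Rightarrow> nat \<Rightarrow> real"
  assumes mn: "m > 0" "n > 0"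
  obtains p q where "\<And>i. i < m \<Longrightarrow> 0 \<le> p i" "(\<Sum>i<m. p i) = 1" "\<And>j. j < n \<Longrightarrow> 0 \<le> q j" "(\<Sum>j<n. q j) = 1"
    "\<And>i. i < m \<Longrightarrow> (\<Sum>i<m. \<Sum>j<n. p i * q j * A i j) \<le> (\<Sum>j<n. q j * A i j)"
    "\<And>j. j < n \<Longrightarrow> (\<Sum>i<m. \<Sum>j<n. p i * q j * B i j) \<le> (\<Sum>i<m. p i * B i j)"
proof -
  define P where "P x = simplex_retract m x" for x
  define Q where "Q x = simplex_retract n (\<lambda>j. x (m + j))" for x
  define a where "a x i = (\<Sum>j<n. Q x j * A i j)" for x i
  define b where "b x j = (\<Sum>i<m. P x i * B i j)" for x j
  define ga where "ga x i = max 0 ((\<Sum>i<m. P x i * a x i) - a x i)" for x i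
  define gb where "gb x j = max 0 ((\<Sum>j<n. Q x j * b x j) - b x j)" for x j
  define f where "f x i = (if i < m then (P x i + ga x i) / (1 + (\<Sum>i<m. ga x i))
     else (Q x (i - m) + gb x (i - m)) / (1 + (\<Sum>j<n. gb x j)))" for x i
  have ga0: "ga x i \<ge> 0" and gb0: "gb x j \<ge> 0" for x i j by (auto simp: ga_def gb_def)
  have Sa: "1 + (\<Sum>i<m. ga x i) > 0" and Sb: "1 + (\<Sum>j<n. gb x j) > 0" for x
    using ga0 gb0 by (auto intro!: add_pos_nonneg sum_nonneg)
  have frac: "0 \<le> (p i + g i) / (1 + (\<Sum>i<l. g i)) \<and> (p i + g i) / (1 + (\<Sum>i<l. g i)) \<le> 1"
    if "i < l" "(\<Sum>i<l. p i) = 1" "\<And>i. i < l \<Longrightarrow> 0 \<le> p i" "\<And>i. 0 \<le> g i" for i l and p g :: "nat \<Rightarrow> real"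
  proof -
    have "p i \<le> (\<Sum>i<l. p i)" "g i \<le> (\<Sum>i<l. g i)"
      using that(1,3,4) by (auto intro!: member_le_sum)
    moreover have "0 \<le> p i" "0 \<le> g i" "0 \<le> (\<Sum>i<l. g i)" using that by (auto intro!: sum_nonneg)
    ultimately show ?thesis unfolding that(2) by (auto simp: divide_le_eq)
  qed
  have PQ: "(\<Sum>i<m. P x i) = 1" "\<And>i. i < m \<Longrightarrow> 0 \<le> P x i" "(\<Sum>j<n. Q x j) = 1" "\<And>j. j < n \<Longrightarrow> 0 \<le> Q x j"
    if "\<And>i. x i \<in> {0..1}" for x
    using that by (auto simp: P_def Q_def intro!: simplex_retract_simplex mn)
  have frange: "f x i \<in> {0..1}" if "\<And>i. x i \<in> {0..1}" "i < m + n" for x i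
    using frac[of i m "P x" "ga x"] frac[of "i - m" n "Q x" "gb x"] PQ[OF that(1)] ga0 gb0 that(2)
    by (auto simp: f_def)
  obtain x where x01: "\<And>i. x i \<in> {0..1}" and fx: "\<And>i. i < m + n \<Longrightarrow> f x i = x i"
  proof (rule brouwer_cube_nat[of "m + n" f])
    fix X :: "nat \<Rightarrow> nat \<Rightarrow> real" and x i
    assume "\<And>n i. X n i \<in> {0..1}" "\<And>i. x i \<in> {0..1}" and X: "\<And>i. (\<lambda>n. X n i) \<longlonglongrightarrow> x i" and "i < m + n"
    have P: "(\<lambda>l. P (X l) i) \<longlonglongrightarrow> P x i" for i
      unfolding P_def simplex_retract_def by (intro tendsto_intros X) (use mn in auto)
    have Q: "(\<lambda>l. Q (X l) i) \<longlonglongrightarrow> Q x i" for i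
      unfolding Q_def simplex_retract_def by (intro tendsto_intros X) (use mn in auto)
    have a: "(\<lambda>l. a (X l) i) \<longlonglongrightarrow> a x i" for i
      unfolding a_def by (intro tendsto_intros Q)
    have b: "(\<lambda>l. b (X l) i) \<longlonglongrightarrow> b x i" for i
      unfolding b_def by (intro tendsto_intros P)
    have ga: "(\<lambda>l. ga (X l) i) \<longlonglongrightarrow> ga x i" for i
      unfolding ga_def by (intro tendsto_intros P a)
    have gb: "(\<lambda>l. gb (X l) i) \<longlonglongrightarrow> gb x i" for i
      unfolding gb_def by (intro tendsto_intros Q b)
    show "(\<lambda>n. f (X n) i) \<longlonglongrightarrow> f x i"
      unfolding f_def using Sa[of x] Sb[of x] by (auto intro!: tendsto_intros P Q ga gb)
  qed (use frange in auto)
  \<comment> \<open>Each block of a value of \<open>f\<close> sums to 1, hence so does each block of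
    the fixed point. There the retraction is the identity, so \<open>p\<close> and \<open>q\<close>
    are the two blocks of \<open>x\<close> itself and are fixed by Nash's map.\<close>
  have fsum: "(\<Sum>i<m. x i) = 1" "(\<Sum>j<n. x (m + j)) = 1"
  proof -
    have "(\<Sum>i<m. x i) = (\<Sum>i<m. (P x i + ga x i) / (1 + (\<Sum>i<m. ga x i)))"
      by (intro sum.cong refl) (use fx in \<open>metis f_def lessThan_iff trans_less_add1\<close>)
    also have "\<dots> = 1" using Sa[of x] PQ[OF x01] by (simp add: sum_divide_distrib[symmetric] sum.distrib)
    finally show "(\<Sum>i<m. x i) = 1" .
    have "(\<Sum>j<n. x (m + j)) = (\<Sum>j<n. (Q x j + gb x j) / (1 + (\<Sum>j<n. gb x j)))"
      by (intro sum.cong refl) (use fx in \<open>metis add_diff_cancel_left' f_def lessThan_iff nat_add_left_cancel_less not_add_less1\<close>)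
    also have "\<dots> = 1" using Sb[of x] PQ[OF x01] by (simp add: sum_divide_distrib[symmetric] sum.distrib)
    finally show "(\<Sum>j<n. x (m + j)) = 1" .
  qed
  define p where "p = P x"
  define q where "q = Q x"
  have px: "p i = x i" for i using fsum by (simp add: p_def P_def simplex_retract_id)
  have qx: "q j = x (m + j)" for j using fsum by (simp add: q_def Q_def simplex_retract_id)
  have a': "a x i = (\<Sum>j<n. q j * A i j)" for i by (simp add: a_def q_def)
  have b': "b x j = (\<Sum>i<m. p i * B i j)" for j by (simp add: b_def p_def)
  have "(\<Sum>i<m. p i * a x i) \<le> a x i" if "i < m" for i
  proof (rule nash_map_fixed_point[OF _ _ _ that])
    show "\<And>i. i < m \<Longrightarrow> 0 \<le> p i" "(\<Sum>i<m. p i) = 1" using PQ[OF x01] by (auto simp: p_def)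
    fix i assume "i < m"
    then show "(p i + max 0 ((\<Sum>i<m. p i * a x i) - a x i)) / (1 + (\<Sum>i<m. max 0 ((\<Sum>i<m. p i * a x i) - a x i))) = p i"
      using fx[of i] px[of i] by (simp add: f_def ga_def p_def)
  qed
  moreover have "(\<Sum>j<n. q j * b x j) \<le> b x j" if "j < n" for j
  proof (rule nash_map_fixed_point[OF _ _ _ that])
    show "\<And>i. i < n \<Longrightarrow> 0 \<le> q i" "(\<Sum>i<n. q i) = 1" using PQ[OF x01] by (auto simp: q_def)
    fix i assume "i < n"
    then show "(q i + max 0 ((\<Sum>i<n. q i * b x i) - b x i)) / (1 + (\<Sum>i<n. max 0 ((\<Sum>i<n. q i * b x i) - b x i))) = q i"
      using fx[of "m + i"] qx[of i] by (simp add: f_def gb_def q_def)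
  qed
  moreover have "(\<Sum>i<m. p i * a x i) = (\<Sum>i<m. \<Sum>j<n. p i * q j * A i j)"
    by (simp add: a' sum_distrib_left mult.assoc)
  moreover have "(\<Sum>j<n. q j * b x j) = (\<Sum>i<m. \<Sum>j<n. p i * q j * B i j)"
    by (subst sum.swap) (simp add: b' sum_distrib_left mult.assoc mult.left_commute)
  ultimately show thesis
    using that[of p q] PQ[OF x01] by (simp add: p_def q_def a_def b_def)
qed

section \<open>Continuous games on compact subsets of the line\<close>

lemma tight_compact:
  fixes \<mu> :: "nat \<Rightarrow> real measure"
  assumes "compact K" "\<And>n. real_distribution (\<mu> n)" "\<And>n. measure (\<mu> n) K = 1"
  shows "tight \<mu>"
  unfolding tight_def
proof (intro conjI allI impI)
  fix e :: real assume "e > 0"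
  obtain R where R: "\<And>x. x \<in> K \<Longrightarrow> \<bar>x\<bar> \<le> R"
    using compact_imp_bounded[OF assms(1)] unfolding bounded_iff by auto
  have "measure (\<mu> n) {- (\<bar>R\<bar> + 1)<..\<bar>R\<bar> + 1} > 1 - e" for n
  proof -
    interpret real_distribution "\<mu> n" by (rule assms)
    have "K \<subseteq> {- (\<bar>R\<bar> + 1)<..\<bar>R\<bar> + 1}" using R by force
    then have "measure (\<mu> n) K \<le> measure (\<mu> n) {- (\<bar>R\<bar> + 1)<..\<bar>R\<bar> + 1}"
      by (intro finite_measure_mono) auto
    then show ?thesis using assms(3)[of n] \<open>e > 0\<close> by auto
  qed
  then show "\<exists>a b. a < b \<and> (\<forall>n. 1 - e < measure (\<mu> n) {a<..b})"
    by (intro exI[of _ "- (\<bar>R\<bar> + 1)"] exI[of _ "\<bar>R\<bar> + 1"]) auto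
qed (use assms in auto)

lemma weak_conv_m_subseq:
  assumes "weak_conv_m \<mu> M" "strict_mono (r :: nat \<Rightarrow> nat)"
  shows "weak_conv_m (\<mu> \<circ> r) M"
  unfolding weak_conv_m_def weak_conv_def
proof (intro allI impI)
  fix x assume "isCont (cdf M) x"
  then have "(\<lambda>n. cdf (\<mu> n) x) \<longlonglongrightarrow> cdf M x"
    using assms(1) by (auto simp: weak_conv_m_def weak_conv_def)
  from LIMSEQ_subseq_LIMSEQ[OF this assms(2)]
  show "(\<lambda>n. cdf ((\<mu> \<circ> r) n) x) \<longlonglongrightarrow> cdf M x" by (simp add: o_def)
qed

definition finite_distr :: "nat \<Rightarrow> (nat \<Rightarrow> real) \<Rightarrow> (nat \<Rightarrow> real) \<Rightarrow> real measure" where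
  "finite_distr n p d = distr (point_measure {..<n} (\<lambda>i. ennreal (p i))) borel d"

lemma finite_distr:
  assumes p: "\<And>i. i < n \<Longrightarrow> 0 \<le> p i" "(\<Sum>i<n. p i) = 1"
  shows "real_distribution (finite_distr n p d)"
    and "f \<in> borel_measurable borel \<Longrightarrow> (\<integral>x. f x \<partial>finite_distr n p d) = (\<Sum>i<n. p i * (f (d i) :: real))"
    and "K \<in> sets borel \<Longrightarrow> (\<And>i. i < n \<Longrightarrow> d i \<in> K) \<Longrightarrow> measure (finite_distr n p d) K = 1"
proof -
  let ?M = "point_measure {..<n} (\<lambda>i. ennreal (p i))"
  have m: "d \<in> ?M \<rightarrow>\<^sub>M borel" by (simp add: measurable_point_measure_eq1)
  have "emeasure ?M (space ?M) = 1"
    using p by (subst space_point_measure, subst emeasure_point_measure_finite) (simp_all add: sum_ennreal[of "{..<n}" p, simplified])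
  then have "prob_space ?M" by (rule prob_spaceI)
  then interpret M: prob_space ?M .
  interpret D: prob_space "finite_distr n p d"
    unfolding finite_distr_def by (rule M.prob_space_distr[OF m])
  show "real_distribution (finite_distr n p d)"
    by standard (auto simp: finite_distr_def)
  show "(\<integral>x. f x \<partial>finite_distr n p d) = (\<Sum>i<n. p i * (f (d i) :: real))" if "f \<in> borel_measurable borel"
    unfolding finite_distr_def using p
    by (subst integral_distr[OF m that], subst lebesgue_integral_point_measure_finite) auto
  show "measure (finite_distr n p d) K = 1" if "K \<in> sets borel" "\<And>i. i < n \<Longrightarrow> d i \<in> K"
  proof -
    have "AE x in finite_distr n p d. x \<in> K"
      unfolding finite_distr_def
      by (subst AE_distr_iff[OF m]) (use that in \<open>auto simp: AE_point_measure\<close>)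
    then show ?thesis using that(1)
      by (subst D.prob_eq_1) (auto simp: finite_distr_def)
  qed
qed

text \<open>Equilibria of the finite games on the first \<open>n + 1\<close> points of two dense
  sequences are tight, so a subsequence converges weakly. Skorohod's representation turns this into
  pointwise convergence, and the iterated integrals pass to the limit by dominated convergence.
  Since the costs are continuous on the whole plane, these limits involve no condition on
  supports.\<close>

lemma nash_equilibrium_compact_real:
  fixes K1 K2 :: "real set" and G1 G2 :: "real \<times> real \<Rightarrow> real"
  assumes K: "compact K1" "compact K2" "K1 \<noteq> {}" "K2 \<noteq> {}"
    and G: "continuous_on UNIV G1" "continuous_on UNIV G2" "\<And>x. \<bar>G1 x\<bar> \<le> C" "\<And>x. \<bar>G2 x\<bar> \<le> C"
  obtains a b where "real_distribution a" "real_distribution b" "AE s in a. s \<in> K1" "AE t in b. t \<in> K2"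
    "\<And>s. s \<in> K1 \<Longrightarrow> (\<integral>s. \<integral>t. G1 (s, t) \<partial>b \<partial>a) \<le> (\<integral>t. G1 (s, t) \<partial>b)"
    "\<And>t. t \<in> K2 \<Longrightarrow> (\<integral>s. \<integral>t. G2 (s, t) \<partial>b \<partial>a) \<le> (\<integral>s. G2 (s, t) \<partial>a)"
proof -
  have Gm [measurable]: "G1 \<in> borel_measurable borel" "G2 \<in> borel_measurable borel"
    using G by (auto intro: borel_measurable_continuous_onI)
  have "\<exists>d. (\<forall>i::nat. d i \<in> K) \<and> K \<subseteq> closure (range d)" if "K \<noteq> {}" for K :: "real set"
  proof -
    obtain T where T: "countable T" "T \<subseteq> K" "K \<subseteq> closure T" by (rule separable)
    then have "T \<noteq> {}" using that by auto
    then show ?thesis using T by (intro exI[of _ "from_nat_into T"]) (use from_nat_into[of T] in \<open>auto simp: range_from_nat_into\<close>)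
  qed
  then obtain d1 d2 where d1: "\<And>i::nat. d1 i \<in> K1" "K1 \<subseteq> closure (range d1)"
    and d2: "\<And>i::nat. d2 i \<in> K2" "K2 \<subseteq> closure (range d2)"
    using K by metis
  define nash where "nash n p q \<longleftrightarrow> (\<forall>i<Suc n. 0 \<le> p i) \<and> (\<Sum>i<Suc n. p i) = 1 \<and> (\<forall>i<Suc n. 0 \<le> q i) \<and> (\<Sum>i<Suc n. q i) = 1 \<and>
    (\<forall>i<Suc n. (\<Sum>i<Suc n. \<Sum>j<Suc n. p i * q j * G1 (d1 i, d2 j)) \<le> (\<Sum>j<Suc n. q j * G1 (d1 i, d2 j))) \<and>
    (\<forall>j<Suc n. (\<Sum>i<Suc n. \<Sum>j<Suc n. p i * q j * G2 (d1 i, d2 j)) \<le> (\<Sum>i<Suc n. p i * G2 (d1 i, d2 j)))" for n p q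
  have "\<exists>p q. nash n p q" for n
  proof -
    obtain p q where "nash n p q"
      by (rule finite_bimatrix_nash[of "Suc n" "Suc n" "\<lambda>i j. G1 (d1 i, d2 j)" "\<lambda>i j. G2 (d1 i, d2 j)"])
         (auto simp only: nash_def)
    then show ?thesis by blast
  qed
  then obtain p q where nash: "\<And>n. nash n (p n) (q n)" by metis
  define a0 where "a0 n = finite_distr (Suc n) (p n) d1" for n
  define b0 where "b0 n = finite_distr (Suc n) (q n) d2" for n
  have p: "\<And>i. i < Suc n \<Longrightarrow> 0 \<le> p n i" "(\<Sum>i<Suc n. p n i) = 1"
    and q: "\<And>i. i < Suc n \<Longrightarrow> 0 \<le> q n i" "(\<Sum>i<Suc n. q n i) = 1" for n
    using nash[of n] by (auto simp: nash_def)
  have Kb: "K1 \<in> sets borel" "K2 \<in> sets borel" using K by (auto intro: borel_compact)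
  have a0: "real_distribution (a0 n)" and a0K: "measure (a0 n) K1 = 1" for n
    unfolding a0_def by (intro finite_distr p d1 Kb; assumption)+
  have b0: "real_distribution (b0 n)" and b0K: "measure (b0 n) K2 = 1" for n
    unfolding b0_def by (intro finite_distr q d2 Kb; assumption)+
  have inta: "(\<integral>x. f x \<partial>a0 n) = (\<Sum>i<Suc n. p n i * f (d1 i))" if "f \<in> borel_measurable borel" for n f
    unfolding a0_def by (rule finite_distr(2)[OF p that])
  have intb: "(\<integral>x. f x \<partial>b0 n) = (\<Sum>i<Suc n. q n i * f (d2 i))" if "f \<in> borel_measurable borel" for n f
    unfolding b0_def by (rule finite_distr(2)[OF q that])
  have ta: "tight a0" by (rule tight_compact[OF K(1) a0 a0K])
  obtain r1 a where r1: "strict_mono r1" "real_distribution a" "weak_conv_m (a0 \<circ> r1) a"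
    using tight_imp_convergent_subsubsequence[OF ta, of id] by (auto simp: strict_mono_def)
  have tb: "tight b0" by (rule tight_compact[OF K(2) b0 b0K])
  \<comment> \<open>The second extraction is made inside the first subsequence, so that both limits
    hold along the same \<open>r\<close>.\<close>
  obtain r2 b where r2: "strict_mono r2" "real_distribution b" "weak_conv_m (b0 \<circ> r1 \<circ> r2) b"
    using tight_imp_convergent_subsubsequence[OF tb r1(1)] by auto
  define r where "r = r1 \<circ> r2"
  have rmono: "strict_mono r" unfolding r_def by (rule strict_mono_o[OF r1(1) r2(1)])
  have wa: "weak_conv_m (\<lambda>n. a0 (r n)) a" using weak_conv_m_subseq[OF r1(3) r2(1)] by (simp add: r_def o_def)
  have wb: "weak_conv_m (\<lambda>n. b0 (r n)) b" using r2(3) by (simp add: r_def o_def)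
  obtain O1 X X0 where O1: "prob_space (O1 :: real measure)" and X': "\<forall>n. X n \<in> O1 \<rightarrow>\<^sub>M borel" "\<forall>n. distr O1 borel (X n) = a0 (r n)"
      "X0 \<in> O1 \<rightarrow>\<^sub>M lborel" and X0: "distr O1 borel X0 = a" and Xlim: "\<forall>x\<in>space O1. (\<lambda>n. X n x) \<longlonglongrightarrow> X0 x"
    using Skorohod[OF a0 r1(2) wa] by blast
  have X: "\<And>n. X n \<in> O1 \<rightarrow>\<^sub>M borel" "\<And>n. distr O1 borel (X n) = a0 (r n)"
    and X0: "X0 \<in> O1 \<rightarrow>\<^sub>M borel" "distr O1 borel X0 = a" and Xlim: "\<And>x. x \<in> space O1 \<Longrightarrow> (\<lambda>n. X n x) \<longlonglongrightarrow> X0 x"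
    using X' X0 Xlim by auto
  obtain O2 Z Z0 where O2: "prob_space (O2 :: real measure)" and Z': "\<forall>n. Z n \<in> O2 \<rightarrow>\<^sub>M borel" "\<forall>n. distr O2 borel (Z n) = b0 (r n)"
      "Z0 \<in> O2 \<rightarrow>\<^sub>M lborel" and Z0: "distr O2 borel Z0 = b" and Zlim: "\<forall>x\<in>space O2. (\<lambda>n. Z n x) \<longlonglongrightarrow> Z0 x"
    using Skorohod[OF b0 r2(2) wb] by blast
  have Z: "\<And>n. Z n \<in> O2 \<rightarrow>\<^sub>M borel" "\<And>n. distr O2 borel (Z n) = b0 (r n)"
    and Z0: "Z0 \<in> O2 \<rightarrow>\<^sub>M borel" "distr O2 borel Z0 = b" and Zlim: "\<And>x. x \<in> space O2 \<Longrightarrow> (\<lambda>n. Z n x) \<longlonglongrightarrow> Z0 x"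
    using Z' Z0 Zlim by auto
  interpret O1: prob_space O1 by (rule O1)
  interpret O2: prob_space O2 by (rule O2)
  note [measurable] = X(1) X0(1) Z(1) Z0(1)
  \<comment> \<open>The approximating measures live on the closed set \<open>K\<close>. In the
    representation this is an almost sure statement about each term of a pointwise convergent
    sequence, so it survives the limit.\<close>
  have supp: "AE s in distr M borel Y0. s \<in> K"
    if "prob_space M" "\<And>n. Y n \<in> M \<rightarrow>\<^sub>M borel" "Y0 \<in> M \<rightarrow>\<^sub>M borel" "\<And>x. x \<in> space M \<Longrightarrow> (\<lambda>n. Y n x) \<longlonglongrightarrow> Y0 x"
      "\<And>n. measure (distr M borel (Y n)) K = 1" "compact K" for M :: "real measure" and Y Y0 and K :: "real set"
  proof -
    interpret prob_space M by fact
    note [measurable] = that(2,3)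
    have K [measurable]: "K \<in> sets borel" using that by (auto intro: borel_compact)
    have "AE x in M. Y n x \<in> K" for n
    proof -
      interpret D: prob_space "distr M borel (Y n)" by (rule prob_space_distr) fact
      have "AE s in distr M borel (Y n). s \<in> K"
        using that(5)[of n] by (subst (asm) D.prob_eq_1) auto
      then show ?thesis by (subst (asm) AE_distr_iff) auto
    qed
    then have "AE x in M. \<forall>n. Y n x \<in> K" by (simp add: AE_all_countable)
    with AE_space have "AE x in M. Y0 x \<in> K"
      by eventually_elim (metis closed_sequentially compact_imp_closed that(4,6))
    then show ?thesis by (subst AE_distr_iff) auto
  qed
  have aK: "AE s in a. s \<in> K1" unfolding X0(2)[symmetric]
    by (rule supp[OF O1 X(1) X0(1) Xlim _ K(1)]) (simp_all add: X(2) a0K)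
  have bK: "AE s in b. s \<in> K2" unfolding Z0(2)[symmetric]
    by (rule supp[OF O2 Z(1) Z0(1) Zlim _ K(2)]) (simp_all add: Z(2) b0K)
  interpret a: real_distribution a by (rule r1(2))
  interpret b: real_distribution b by (rule r2(2))
  have lim1: "(\<lambda>n. \<integral>t. G (s, t) \<partial>b0 (r n)) \<longlonglongrightarrow> (\<integral>t. G (s, t) \<partial>b)"
    if [measurable]: "G \<in> borel_measurable borel" and G: "continuous_on UNIV G" "\<And>x. \<bar>G x\<bar> \<le> C" for G :: "real \<times> real \<Rightarrow> real" and s
    unfolding Z(2)[symmetric] Z0(2)[symmetric]
    apply (simp add: integral_distr)
    apply (rule integral_dominated_convergence[where w="\<lambda>_. C"])
    using G by (auto intro!: continuous_on_tendsto_compose[OF G(1)] tendsto_intros Zlim)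
  have lim2: "(\<lambda>n. \<integral>s. G (s, t) \<partial>a0 (r n)) \<longlonglongrightarrow> (\<integral>s. G (s, t) \<partial>a)"
    if [measurable]: "G \<in> borel_measurable borel" and G: "continuous_on UNIV G" "\<And>x. \<bar>G x\<bar> \<le> C" for G :: "real \<times> real \<Rightarrow> real" and t
    unfolding X(2)[symmetric] X0(2)[symmetric]
    apply (simp add: integral_distr)
    apply (rule integral_dominated_convergence[where w="\<lambda>_. C"])
    using G by (auto intro!: continuous_on_tendsto_compose[OF G(1)] tendsto_intros Xlim)
  \<comment> \<open>The two representations live on separate spaces. On their product the iterated
    integral becomes a single integral of a pointwise convergent integrand.\<close>
  interpret OO: pair_prob_space O1 O2 ..
  have lim12: "(\<lambda>n. \<integral>s. \<integral>t. G (s, t) \<partial>b0 (r n) \<partial>a0 (r n)) \<longlonglongrightarrow> (\<integral>s. \<integral>t. G (s, t) \<partial>b \<partial>a)"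
    if [measurable]: "G \<in> borel_measurable borel" and G: "continuous_on UNIV G" "\<And>x. \<bar>G x\<bar> \<le> C" for G :: "real \<times> real \<Rightarrow> real"
  proof -
    have [measurable]: "case_prod (curry G) \<in> borel_measurable (borel \<Otimes>\<^sub>M borel)" by (simp add: borel_prod)
    have eq: "(\<integral>s. \<integral>t. G (s, t) \<partial>distr O2 borel V \<partial>distr O1 borel U) = (\<integral>x. G (U (fst x), V (snd x)) \<partial>(O1 \<Otimes>\<^sub>M O2))"
      if [measurable]: "U \<in> O1 \<rightarrow>\<^sub>M borel" "V \<in> O2 \<rightarrow>\<^sub>M borel" for U V
    proof -
      have "(\<integral>s. \<integral>t. G (s, t) \<partial>distr O2 borel V \<partial>distr O1 borel U) = (\<integral>s. \<integral>y. G (s, V y) \<partial>O2 \<partial>distr O1 borel U)"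
        by (simp add: integral_distr)
      also have "\<dots> = (\<integral>x. \<integral>y. G (U x, V y) \<partial>O2 \<partial>O1)"
        by (simp add: integral_distr)
      also have "\<dots> = (\<integral>x. G (U (fst x), V (snd x)) \<partial>(O1 \<Otimes>\<^sub>M O2))"
        using OO.integral_fst'[of "\<lambda>x. G (U (fst x), V (snd x))"] G(2)
        by (simp add: OO.P.integrable_const_bound[where B=C])
      finally show ?thesis .
    qed
    show ?thesis
      unfolding Z(2)[symmetric] Z0(2)[symmetric] X(2)[symmetric] X0(2)[symmetric] eq[OF X(1) Z(1)] eq[OF X0(1) Z0(1)]
      apply (rule integral_dominated_convergence[where w="\<lambda>_. C"])
      using G by (auto simp: space_pair_measure intro!: continuous_on_tendsto_compose[OF G(1)] tendsto_intros Xlim Zlim)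
  qed
  have ne1: "(\<integral>s. \<integral>t. G1 (s, t) \<partial>b0 n \<partial>a0 n) \<le> (\<integral>t. G1 (d1 i, t) \<partial>b0 n)" if "i < Suc n" for i n
    using nash[of n] that by (simp add: nash_def inta intb sum_distrib_left mult.assoc del: sum.lessThan_Suc)
  have ne2: "(\<integral>s. \<integral>t. G2 (s, t) \<partial>b0 n \<partial>a0 n) \<le> (\<integral>s. G2 (s, d2 i) \<partial>a0 n)" if "i < Suc n" for i n
    using nash[of n] that by (simp add: nash_def inta intb sum_distrib_left mult.assoc del: sum.lessThan_Suc)
  \<comment> \<open>The dense point with index \<open>i\<close> is a pure strategy of the
    \<open>r n\<close>-th game as soon as \<open>i \<le> r n\<close>.\<close>
  have ev: "\<exists>N. \<forall>n\<ge>N. i < Suc (r n)" for i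
    using seq_suble[OF rmono] by (meson le_imp_less_Suc order_trans)
  have 1: "(\<integral>s. \<integral>t. G1 (s, t) \<partial>b \<partial>a) \<le> (\<integral>t. G1 (d1 i, t) \<partial>b)" for i
    by (rule LIMSEQ_le[OF lim12[OF Gm(1) G(1,3)] lim1[OF Gm(1) G(1,3)]]) (use ev ne1 in blast)
  have 2: "(\<integral>s. \<integral>t. G2 (s, t) \<partial>b \<partial>a) \<le> (\<integral>s. G2 (s, d2 i) \<partial>a)" for i
    by (rule LIMSEQ_le[OF lim12[OF Gm(2) G(2,4)] lim2[OF Gm(2) G(2,4)]]) (use ev ne2 in blast)
  \<comment> \<open>So far only deviations to points of the dense sequence have been compared;
    continuity of the cost in the deviation covers the rest of \<open>K1\<close>.\<close>
  have "(\<integral>s. \<integral>t. G1 (s, t) \<partial>b \<partial>a) \<le> (\<integral>t. G1 (s, t) \<partial>b)" if "s \<in> K1" for s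
  proof -
    obtain x where x: "\<And>n::nat. x n \<in> range d1" "x \<longlonglongrightarrow> s"
      using d1(2) \<open>s \<in> K1\<close> closure_sequential by blast
    have "(\<lambda>n. \<integral>t. G1 (x n, t) \<partial>b) \<longlonglongrightarrow> (\<integral>t. G1 (s, t) \<partial>b)"
      apply (rule integral_dominated_convergence[where w="\<lambda>_. C"])
      using G x by (auto intro!: continuous_on_tendsto_compose[OF G(1)] tendsto_intros)
    then show ?thesis using 1 x(1) by (intro LIMSEQ_le_const) (auto simp: image_iff, metis)
  qed
  moreover have "(\<integral>s. \<integral>t. G2 (s, t) \<partial>b \<partial>a) \<le> (\<integral>s. G2 (s, t) \<partial>a)" if "t \<in> K2" for t
  proof -
    obtain x where x: "\<And>n::nat. x n \<in> range d2" "x \<longlonglongrightarrow> t"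
      using d2(2) \<open>t \<in> K2\<close> closure_sequential by blast
    have "(\<lambda>n. \<integral>s. G2 (s, x n) \<partial>a) \<longlonglongrightarrow> (\<integral>s. G2 (s, t) \<partial>a)"
      apply (rule integral_dominated_convergence[where w="\<lambda>_. C"])
      using G x by (auto intro!: continuous_on_tendsto_compose[OF G(2)] tendsto_intros)
    then show ?thesis using 2 x(1) by (intro LIMSEQ_le_const) (auto simp: image_iff, metis)
  qed
  ultimately show thesis using that r1(2) r2(2) aK bK by blast
qed

section \<open>A space-filling curve onto the Hilbert cube\<close>

text \<open>Schoenberg's space-filling curve: if \<open>t = (\<Sum>k. 2 * z k / 3 ^ Suc k)\<close> with digits \<open>z k \<in> {0, 1}\<close>, then
  \<open>3 ^ k * t\<close> is, up to an even integer, in \<open>{0..1/3}\<close> if \<open>z k = 0\<close> and in \<open>{2/3..1}\<close> if \<open>z k = 1\<close>.\<close>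

definition tooth :: "real \<Rightarrow> real" where
  "tooth t = max 0 (min 1 (3 * \<bar>t - 2 * of_int (round (t / 2))\<bar> - 1))"

text \<open>The pairing function hands out the ternary digits: for the parameters described above,
  the \<open>n\<close>-th binary digit of coordinate \<open>i\<close> sits at ternary position
  \<open>prod_encode (to_nat i, n)\<close>. One real parameter thus codes countably many
  coordinates.\<close>

definition space_filling :: "real \<Rightarrow> 'i::countable \<Rightarrow> real" where
  "space_filling t i = (\<Sum>n. (1 / 2) ^ Suc n * tooth (3 ^ prod_encode (to_nat i, n) * t))"

lemma tooth_01: "tooth t \<in> {0..1}"
  by (auto simp: tooth_def)

text \<open>Although \<open>round\<close> jumps, the distance to the nearest even integer is
  1-Lipschitz, because rounding minimizes the distance over all integers.\<close>

lemma continuous_on_tooth: "continuous_on A tooth"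
proof -
  let ?d = "\<lambda>t :: real. \<bar>t - 2 * of_int (round (t / 2))\<bar>"
  have "?d s \<le> ?d t + \<bar>s - t\<bar>" for s t
  proof -
    have "\<bar>s / 2 - of_int (round (s / 2))\<bar> \<le> \<bar>s / 2 - of_int (round (t / 2))\<bar>"
      using round_diff_minimal[of "s / 2"] by simp
    then show ?thesis by linarith
  qed
  then have "\<bar>?d s - ?d t\<bar> \<le> \<bar>s - t\<bar>" for s t
    by (smt (verit))
  then have "continuous_on A ?d"
    unfolding continuous_on_iff dist_real_def by (meson le_less_trans)
  then show ?thesis
    unfolding tooth_def by (intro continuous_on_max continuous_on_min continuous_on_diff continuous_on_mult_left continuous_on_const)
qed

lemma tooth_even: "tooth (t + 2 * of_int m) = tooth t"
proof -
  have "round ((t + 2 * of_int m) / 2) = round (t / 2) + m"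
    unfolding round_def by (simp add: add_divide_distrib add.commute add.left_commute)
  then show ?thesis by (simp add: tooth_def)
qed

lemma tooth_low: "0 \<le> t \<Longrightarrow> t \<le> 1 / 3 \<Longrightarrow> tooth t = 0"
proof -
  assume t: "0 \<le> t" "t \<le> 1 / 3"
  have "round (t / 2) = 0" by (rule round_unique') (use t in auto)
  then show ?thesis using t by (simp add: tooth_def)
qed

lemma tooth_high: "2 / 3 \<le> t \<Longrightarrow> t \<le> 1 \<Longrightarrow> tooth t = 1"
proof -
  assume t: "2 / 3 \<le> t" "t \<le> 1"
  have "\<bar>t - 2 * of_int (round (t / 2))\<bar> \<ge> 2 / 3"
  proof (cases "round (t / 2) \<le> 0")
    case True
    then have "real_of_int (round (t / 2)) \<le> 0" by simp
    then show ?thesis using t by linarith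
  next
    case False
    then have "real_of_int (round (t / 2)) \<ge> 1" by simp
    then show ?thesis using t by linarith
  qed
  then show ?thesis using t by (simp add: tooth_def)
qed

lemma continuous_on_space_filling: "continuous_on A (\<lambda>t. space_filling t i)"
  unfolding space_filling_def
proof (rule uniform_limit_theorem)
  let ?f = "\<lambda>n t. (1 / 2) ^ Suc n * tooth (3 ^ prod_encode (to_nat i, n) * t)"
  show "uniform_limit A (\<lambda>n t. \<Sum>i<n. ?f i t) (\<lambda>t. suminf (\<lambda>i. ?f i t)) sequentially"
    by (rule Weierstrass_m_test[of _ _ "\<lambda>n. (1 / 2) ^ Suc n"])
       (use tooth_01 in \<open>auto simp: abs_mult mult_left_le intro!: summable_mult\<close>)
  show "\<forall>\<^sub>F n in sequentially. continuous_on A (\<lambda>t. \<Sum>i<n. ?f i t)"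
    by (intro always_eventually allI continuous_intros continuous_on_compose2[OF continuous_on_tooth[of UNIV]]) auto
qed auto

text \<open>The digits come from the doubling map: \<open>e n\<close> is the remainder after
  \<open>n\<close> digits, scaled by \<open>2 ^ n\<close>, and it stays in [0,1]. The value 1 is
  covered as well, with all digits equal to 1.\<close>

lemma binary_expansion:
  assumes "0 \<le> y" "y \<le> (1::real)"
  obtains z :: "nat \<Rightarrow> nat" where "\<And>n. z n \<le> 1" "(\<lambda>n. (1 / 2) ^ Suc n * real (z n)) sums y"
proof -
  define e where "e = rec_nat y (\<lambda>_ e. if e \<ge> 1 / 2 then 2 * e - 1 else 2 * e)"
  define z where "z n = (if e n \<ge> 1 / 2 then 1 else 0 :: nat)" for n
  have e0: "e 0 = y" and eS: "e (Suc n) = 2 * e n - real (z n)" for n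
    by (auto simp: e_def z_def)
  have e01: "0 \<le> e n \<and> e n \<le> 1" for n
    using assms by (induction n) (auto simp: e0 eS z_def)
  have part: "(\<Sum>n<m. (1 / 2) ^ Suc n * real (z n)) = y - (1 / 2) ^ m * e m" for m
    by (induction m) (auto simp: e0 eS field_simps)
  have "(\<lambda>m. (1 / 2) ^ m * e m) \<longlonglongrightarrow> 0"
  proof (rule Lim_null_comparison[OF always_eventually])
    show "(\<lambda>m. (1 / 2 :: real) ^ m) \<longlonglongrightarrow> 0" by (rule LIMSEQ_power_zero) simp
    show "\<forall>m. norm ((1 / 2) ^ m * e m) \<le> (1 / 2) ^ m" using e01 by (simp add: abs_mult mult_left_le)
  qed
  then have "(\<lambda>n. (1 / 2) ^ Suc n * real (z n)) sums y"
    unfolding sums_def part using tendsto_diff[OF tendsto_const, of _ 0 sequentially y] by simp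
  then show thesis by (intro that[of z]) (auto simp: z_def)
qed

lemma space_filling_onto:
  assumes "\<And>i. x i \<in> {0..1}"
  obtains t where "t \<in> {0..1}" "space_filling t = x"
proof -
  have "\<exists>z :: nat \<Rightarrow> nat. (\<forall>n. z n \<le> 1) \<and> (\<lambda>n. (1 / 2) ^ Suc n * real (z n)) sums x i" for i
    using binary_expansion[of "x i"] assms[of i] by (metis atLeastAtMost_iff)
  then obtain z :: "'a \<Rightarrow> nat \<Rightarrow> nat" where z: "\<And>i n. z i n \<le> 1" "\<And>i. (\<lambda>n. (1 / 2) ^ Suc n * real (z i n)) sums x i"
    by metis
  define d where "d k = z (from_nat (fst (prod_decode k))) (snd (prod_decode k))" for k
  have d1: "d k \<le> 1" for k using z by (simp add: d_def)
  have d: "d (prod_encode (to_nat i, n)) = z i n" for i n by (simp add: d_def)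
  have geo: "(\<lambda>j. 2 / 3 * (1 / 3) ^ j) sums (1 :: real)"
    using sums_mult[OF geometric_sums[of "1 / 3 :: real"], of "2 / 3"] by simp
  have sm: "summable (\<lambda>j. 2 / 3 * (1 / 3) ^ j * real (d (j + k)))" for k
    by (rule summable_comparison_test[OF _ sums_summable[OF geo]]) (use d1 in \<open>auto intro!: exI[of _ 0] simp: mult_left_le\<close>)
  \<comment> \<open>Tail of the ternary number from digit \<open>k\<close> on, rescaled to [0,1];
    \<open>u 0\<close> is the parameter sought. Since \<open>3 * u k = 2 * d k + u (Suc k)\<close>,
    the digit \<open>d k\<close> decides whether \<open>u k\<close> lies in the lower or the upper
    third.\<close>
  define u where "u k = (\<Sum>j. 2 / 3 * (1 / 3) ^ j * real (d (j + k)))" for k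
  have u01: "0 \<le> u k" "u k \<le> 1" for k
  proof -
    show "0 \<le> u k" unfolding u_def by (intro suminf_nonneg sm) auto
    have "u k \<le> (\<Sum>j. 2 / 3 * (1 / 3) ^ j)" unfolding u_def
      by (intro suminf_le sm sums_summable[OF geo]) (use d1 in \<open>auto simp: mult_left_le\<close>)
    then show "u k \<le> 1" using sums_unique[OF geo] by simp
  qed
  have u: "u k = 2 / 3 * real (d k) + u (Suc k) / 3" for k
    unfolding u_def
    using suminf_split_head[OF sm[of k]] suminf_mult[OF sm[of "Suc k"], of "1/3"] by (simp add: algebra_simps)
  have tu: "tooth (u k) = real (d k)" for k
  proof (cases "d k = 0")
    case True
    then show ?thesis using u[of k] u01[of "Suc k"] by (auto intro: tooth_low)
  next
    case False
    then have "d k = 1" using d1[of k] by simp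
    then show ?thesis using u[of k] u01[of "Suc k"] by (auto intro!: tooth_high)
  qed
  \<comment> \<open>The ternary digits are 0 and 2, so each multiplication by 3 splits off an even
    integer, which the period of \<open>tooth\<close> absorbs.\<close>
  have shift: "\<exists>m::int. 3 ^ k * u 0 = u k + 2 * of_int m" for k
  proof (induction k)
    case (Suc k)
    then obtain m :: int where "3 ^ k * u 0 = u k + 2 * of_int m" by auto
    then have "3 ^ Suc k * u 0 = u (Suc k) + 2 * of_int (int (d k) + 3 * m)"
      using u[of k] by simp
    then show ?case by blast
  qed (auto intro: exI[of _ 0])
  have "tooth (3 ^ k * u 0) = real (d k)" for k
    using shift[of k] tooth_even tu by metis
  then have "space_filling (u 0) i = x i" for i
    using sums_unique[OF z(2)[of i]] by (simp add: space_filling_def d)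
  then show thesis using that[of "u 0"] u01[of 0] by auto
qed

section \<open>Weak-star convergence of bounded functions\<close>

lemma (in finite_measure) integrable_indicator_finite:
  "A \<in> sets M \<Longrightarrow> integrable M (indicator A :: 'a \<Rightarrow> real)"
  by (intro integrable_real_indicator) (auto simp: emeasure_eq_measure)

text \<open>The uniform bound on \<open>r\<close> makes the functionals equicontinuous in L^1, so
  convergence passes from the generator to complements and countable disjoint unions, that is to all
  measurable sets, and from there to all integrable \<open>f\<close>. The filter is arbitrary so
  that the statement also serves for pairs of indices, where it expresses a Cauchy property.\<close>

lemma weak_null_integrable:
  fixes r :: "'k \<Rightarrow> 'a \<Rightarrow> real" and f :: "'a \<Rightarrow> real"
  assumes "finite_measure M"
    and r: "\<And>k. r k \<in> borel_measurable M" "\<And>k x. x \<in> space M \<Longrightarrow> \<bar>r k x\<bar> \<le> B"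
    and G: "Int_stable G" "G \<subseteq> Pow (space M)" "sets M = sigma_sets (space M) G" "space M \<in> G"
    and conv: "\<And>A. A \<in> G \<Longrightarrow> ((\<lambda>k. \<integral>x. indicator A x * r k x \<partial>M) \<longlongrightarrow> 0) F"
    and f: "integrable M f"
  shows "((\<lambda>k. \<integral>x. f x * r k x \<partial>M) \<longlongrightarrow> 0) F"
proof -
  interpret finite_measure M by fact
  note [measurable] = r(1)
  define B' where "B' = \<bar>B\<bar> + 1"
  have B': "B' > 0" by (simp add: B'_def)
  have rB: "\<bar>r k x\<bar> \<le> B'" if "x \<in> space M" for k x using r(2)[OF that, of k] by (simp add: B'_def)
  have int: "integrable M (\<lambda>x. f x * r k x)" if "integrable M f" for f k
  proof (rule Bochner_Integration.integrable_bound[OF integrable_mult_left[OF that, of B']])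
    show "AE x in M. norm (f x * r k x) \<le> norm (f x * B')"
      using rB B' by (intro AE_I2) (auto simp: abs_mult intro!: mult_left_mono)
  qed (use that in measurable)
  \<comment> \<open>L^1-closedness of the set of good test functions, used both for countable unions
    of sets and for limits of integrable functions.\<close>
  have L1: "((\<lambda>k. \<integral>x. f x * r k x \<partial>M) \<longlongrightarrow> 0) F"
    if f: "integrable M f" and fm: "\<And>m. integrable M (fm m)" and c: "\<And>m. ((\<lambda>k. \<integral>x. fm m x * r k x \<partial>M) \<longlongrightarrow> 0) F"
      and l: "(\<lambda>m. \<integral>x. \<bar>f x - fm m x\<bar> \<partial>M) \<longlonglongrightarrow> 0" for f and fm :: "nat \<Rightarrow> 'a \<Rightarrow> real"
  proof (rule tendstoI)
    fix e :: real assume "e > 0"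
    then have "eventually (\<lambda>m. (\<integral>x. \<bar>f x - fm m x\<bar> \<partial>M) < e / (2 * B')) sequentially"
      using B' by (intro order_tendstoD[OF l]) auto
    then obtain m where m: "(\<integral>x. \<bar>f x - fm m x\<bar> \<partial>M) < e / (2 * B')"
      by (auto simp: eventually_sequentially)
    have "eventually (\<lambda>k. \<bar>\<integral>x. fm m x * r k x \<partial>M\<bar> < e / 2) F"
      using tendstoD[OF c[of m], of "e / 2"] \<open>e > 0\<close> by simp
    then show "eventually (\<lambda>k. dist (\<integral>x. f x * r k x \<partial>M) 0 < e) F"
    proof eventually_elim
      case (elim k)
      have "\<bar>(\<integral>x. f x * r k x \<partial>M) - (\<integral>x. fm m x * r k x \<partial>M)\<bar> = \<bar>\<integral>x. (f x - fm m x) * r k x \<partial>M\<bar>"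
        using int[OF f, of k] int[OF fm, of m k] by (simp add: left_diff_distrib)
      also have "\<dots> \<le> (\<integral>x. \<bar>f x - fm m x\<bar> * B' \<partial>M)"
        using rB f fm integrable_abs[OF int[of "\<lambda>x. f x - fm m x" k]]
        by (intro integral_abs_bound[THEN order_trans] integral_mono) (auto simp: abs_mult intro!: mult_left_mono)
      also have "\<dots> < e / 2" using m B' by (simp add: field_simps)
      finally show ?case using elim unfolding dist_real_def by linarith
    qed
  qed
  have set: "((\<lambda>k. \<integral>x. indicator A x * r k x \<partial>M) \<longlongrightarrow> 0) F" if "A \<in> sets M" for A
    using G(1,2) that[unfolded G(3)]
  proof (induction rule: sigma_sets_induct_disjoint[consumes 3])
    case (compl A)
    then have [measurable]: "A \<in> sets M" by (simp add: G(3))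
    have "(\<integral>x. indicator (space M - A) x * r k x \<partial>M) = (\<integral>x. indicator (space M) x * r k x \<partial>M) - (\<integral>x. indicator A x * r k x \<partial>M)" for k
      by (subst Bochner_Integration.integral_diff[symmetric])
         (auto intro!: int integrable_indicator_finite Bochner_Integration.integral_cong split: split_indicator)
    then show ?case using tendsto_diff[OF conv[OF G(4)] compl(2)] by simp
  next
    case (union A)
    then have [measurable]: "A i \<in> sets M" for i by (auto simp: G(3))
    let ?f = "\<lambda>m x. indicator (\<Union>i<m. A i) x :: real"
    show ?case
    proof (rule L1[of _ ?f])
      have "?f m x = (\<Sum>i<m. indicator (A i) x)" for m x
        using union(1) by (intro indicator_UN_disjoint) (auto simp: disjoint_family_on_def)
      then have "(\<lambda>k. \<integral>x. ?f m x * r k x \<partial>M) = (\<lambda>k. \<Sum>i<m. \<integral>x. indicator (A i) x * r k x \<partial>M)" for m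
        by (intro ext) (simp only: sum_distrib_right, intro Bochner_Integration.integral_sum int integrable_indicator_finite, simp)
      then show "((\<lambda>k. \<integral>x. ?f m x * r k x \<partial>M) \<longlongrightarrow> 0) F" for m
        using union(3) by (auto intro: tendsto_null_sum)
      have "(\<lambda>m. \<integral>x. \<bar>indicator (\<Union>i. A i) x - ?f m x\<bar> \<partial>M) \<longlonglongrightarrow> (\<integral>x. 0 \<partial>M)"
      proof (rule integral_dominated_convergence[where w="\<lambda>_. 1"])
        show "AE x in M. (\<lambda>m. \<bar>indicator (\<Union>i. A i) x - ?f m x\<bar>) \<longlonglongrightarrow> 0"
        proof (rule AE_I2)
          fix x
          have "(\<lambda>m. ?f m x) \<longlonglongrightarrow> indicator (\<Union>i. A i) x"
            by (rule LIMSEQ_indicator_UN)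
          from tendsto_rabs_zero[OF LIM_zero[OF this]]
          show "(\<lambda>m. \<bar>indicator (\<Union>i. A i) x - ?f m x\<bar>) \<longlonglongrightarrow> 0"
            by (simp add: abs_minus_commute)
        qed
      qed (auto split: split_indicator)
      then show "(\<lambda>m. \<integral>x. \<bar>indicator (\<Union>i. A i) x - ?f m x\<bar> \<partial>M) \<longlonglongrightarrow> 0" by simp
    qed (auto intro!: integrable_indicator_finite)
  qed (auto intro: conv)
  show ?thesis using f
  proof (induction rule: integrable_induct)
    case (base A c)
    then show ?case
      using tendsto_mult_left[OF set[OF base(1)], of c] by (simp add: mult.assoc mult.left_commute[of _ c])
  next
    case (add f g)
    have "(\<integral>x. (f x + g x) * r k x \<partial>M) = (\<integral>x. f x * r k x \<partial>M) + (\<integral>x. g x * r k x \<partial>M)" for k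
      using int[OF add(1), of k] int[OF add(2), of k] by (simp add: distrib_right)
    then show ?case using tendsto_add[OF add.IH] by simp
  next
    case (lim f s)
    show ?case
    proof (rule L1[OF lim.hyps(4,1) lim.IH])
      have "(\<lambda>m. \<integral>x. \<bar>f x - s m x\<bar> \<partial>M) \<longlonglongrightarrow> (\<integral>x. 0 \<partial>M)"
      proof (rule integral_dominated_convergence[where w="\<lambda>x. 3 * \<bar>f x\<bar>"])
        show "AE x in M. (\<lambda>m. \<bar>f x - s m x\<bar>) \<longlonglongrightarrow> 0"
          using lim.hyps(2) by (intro AE_I2) (auto intro!: tendsto_eq_intros)
        show "AE x in M. norm \<bar>f x - s m x\<bar> \<le> 3 * \<bar>f x\<bar>" for m
        proof (rule AE_I2)
          fix x assume "x \<in> space M"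
          from lim.hyps(3)[OF this, of m] show "norm \<bar>f x - s m x\<bar> \<le> 3 * \<bar>f x\<bar>" by auto
        qed
      qed (use lim.hyps(1,4) in auto)
      then show "(\<lambda>m. \<integral>x. \<bar>f x - s m x\<bar> \<partial>M) \<longlonglongrightarrow> 0" by simp
    qed
  qed
qed

text \<open>Weak-star convergence in the unit ball of \<open>L\<^sup>\<infinity>(M)\<close>.\<close>

definition weak_lim :: "'a measure \<Rightarrow> (nat \<Rightarrow> 'a \<Rightarrow> real) \<Rightarrow> ('a \<Rightarrow> real) \<Rightarrow> bool" where
  "weak_lim M r r0 \<longleftrightarrow>
     (\<forall>n. r n \<in> borel_measurable M) \<and> r0 \<in> borel_measurable M \<and>
     (\<forall>x\<in>space M. (\<forall>n. \<bar>r n x\<bar> \<le> 1) \<and> \<bar>r0 x\<bar> \<le> 1) \<and>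
     (\<forall>f. integrable M f \<longrightarrow> (\<lambda>n. \<integral>x. f x * r n x \<partial>M) \<longlonglongrightarrow> (\<integral>x. f x * r0 x \<partial>M))"

lemma integrable_times_bounded:
  fixes f r :: "'a \<Rightarrow> real"
  assumes f: "integrable M f" and r: "r \<in> borel_measurable M" "\<And>x. x \<in> space M \<Longrightarrow> \<bar>r x\<bar> \<le> B"
  shows "integrable M (\<lambda>x. f x * r x)"
proof (rule Bochner_Integration.integrable_bound[OF integrable_mult_left[OF f, of "\<bar>B\<bar>"]])
  show "AE x in M. norm (f x * r x) \<le> norm (f x * \<bar>B\<bar>)"
    using r(2) by (intro AE_I2) (force simp: abs_mult intro!: mult_left_mono)
qed (use f r in measurable)

lemma weak_limI:
  assumes "finite_measure M"
    and r: "\<And>n. r n \<in> borel_measurable M" "\<And>n x. x \<in> space M \<Longrightarrow> \<bar>r n x\<bar> \<le> 1"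
    and r0: "r0 \<in> borel_measurable M" "\<And>x. x \<in> space M \<Longrightarrow> \<bar>r0 x\<bar> \<le> 1"
    and G: "Int_stable G" "G \<subseteq> Pow (space M)" "sets M = sigma_sets (space M) G" "space M \<in> G"
    and conv: "\<And>A. A \<in> G \<Longrightarrow> (\<lambda>n. \<integral>x. indicator A x * r n x \<partial>M) \<longlonglongrightarrow> (\<integral>x. indicator A x * r0 x \<partial>M)"
  shows "weak_lim M r r0"
  unfolding weak_lim_def
proof (intro conjI ballI allI impI r r0)
  interpret finite_measure M by fact
  fix f :: "'a \<Rightarrow> real" assume f: "integrable M f"
  have diff: "(\<integral>x. f x * (r n x - r0 x) \<partial>M) = (\<integral>x. f x * r n x \<partial>M) - (\<integral>x. f x * r0 x \<partial>M)"
    if "integrable M f" for n f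
    using integrable_times_bounded[OF that r] integrable_times_bounded[OF that r0] by (simp add: right_diff_distrib)
  have "(\<lambda>n. \<integral>x. f x * (r n x - r0 x) \<partial>M) \<longlonglongrightarrow> 0"
  proof (rule weak_null_integrable[OF \<open>finite_measure M\<close> _ _ G _ f])
    show "(\<lambda>x. r n x - r0 x) \<in> borel_measurable M" for n using r r0 by measurable
    show "\<bar>r n x - r0 x\<bar> \<le> 2" if "x \<in> space M" for n x using r(2)[OF that, of n] r0(2)[OF that] by linarith
    fix A assume "A \<in> G"
    then have "A \<in> sets M" using G(3) by auto
    then have "integrable M (indicator A :: _ \<Rightarrow> real)" by (rule integrable_indicator_finite)
    from diff[OF this] show "(\<lambda>n. \<integral>x. indicator A x * (r n x - r0 x) \<partial>M) \<longlonglongrightarrow> 0"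
      using LIM_zero[OF conv[OF \<open>A \<in> G\<close>]] by simp
  qed
  then show "(\<lambda>n. \<integral>x. f x * r n x \<partial>M) \<longlonglongrightarrow> (\<integral>x. f x * r0 x \<partial>M)"
    unfolding diff[OF f] by (rule LIM_zero_cancel)
qed auto

lemma weak_limD:
  assumes "weak_lim M r r0"
  shows "r n \<in> borel_measurable M" "r0 \<in> borel_measurable M" "x \<in> space M \<Longrightarrow> \<bar>r n x\<bar> \<le> 1" "x \<in> space M \<Longrightarrow> \<bar>r0 x\<bar> \<le> 1"
    "integrable M f \<Longrightarrow> (\<lambda>n. \<integral>x. f x * r n x \<partial>M) \<longlonglongrightarrow> (\<integral>x. f x * r0 x \<partial>M)"
  using assms unfolding weak_lim_def by auto

text \<open>Tested on a rectangle, the integral of the product factors by Fubini's theorem, and each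
  factor converges. Weak-star convergence is not multiplicative in general; here it is, because the
  factors depend on different variables of a product measure.\<close>

lemma weak_lim_pair:
  assumes "finite_measure M1" "finite_measure M2" and r: "weak_lim M1 r r0" and s: "weak_lim M2 s s0"
  shows "weak_lim (M1 \<Otimes>\<^sub>M M2) (\<lambda>n x. r n (fst x) * s n (snd x)) (\<lambda>x. r0 (fst x) * s0 (snd x))"
proof (rule weak_limI[where G = "{a \<times> b | a b. a \<in> sets M1 \<and> b \<in> sets M2}"])
  interpret M1: finite_measure M1 by fact
  interpret M2: finite_measure M2 by fact
  interpret P: pair_sigma_finite M1 M2 ..
  show "finite_measure (M1 \<Otimes>\<^sub>M M2)" by (rule finite_measure_pair_measure) fact+
  note [measurable] = weak_limD(1,2)[OF r] weak_limD(1,2)[OF s]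
  show "(\<lambda>x. r n (fst x) * s n (snd x)) \<in> borel_measurable (M1 \<Otimes>\<^sub>M M2)" "(\<lambda>x. r0 (fst x) * s0 (snd x)) \<in> borel_measurable (M1 \<Otimes>\<^sub>M M2)" for n
    by measurable
  show "\<bar>r n (fst x) * s n (snd x)\<bar> \<le> 1" "\<bar>r0 (fst x) * s0 (snd x)\<bar> \<le> 1" if "x \<in> space (M1 \<Otimes>\<^sub>M M2)" for n x
    using that weak_limD(3,4)[OF r] weak_limD(3,4)[OF s]
    by (auto simp: space_pair_measure abs_mult intro!: mult_le_one)
  show "Int_stable {a \<times> b |a b. a \<in> sets M1 \<and> b \<in> sets M2}" by (rule Int_stable_pair_measure_generator)
  show "{a \<times> b |a b. a \<in> sets M1 \<and> b \<in> sets M2} \<subseteq> Pow (space (M1 \<Otimes>\<^sub>M M2))"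
    by (auto simp: space_pair_measure dest: sets.sets_into_space)
  show "sets (M1 \<Otimes>\<^sub>M M2) = sigma_sets (space (M1 \<Otimes>\<^sub>M M2)) {a \<times> b |a b. a \<in> sets M1 \<and> b \<in> sets M2}"
    by (simp add: sets_pair_measure space_pair_measure)
  show "space (M1 \<Otimes>\<^sub>M M2) \<in> {a \<times> b |a b. a \<in> sets M1 \<and> b \<in> sets M2}"
    by (auto simp: space_pair_measure)
  fix A assume "A \<in> {a \<times> b |a b. a \<in> sets M1 \<and> b \<in> sets M2}"
  then obtain a b where A: "A = a \<times> b" and [measurable]: "a \<in> sets M1" "b \<in> sets M2" by auto
  have ind: "integrable M1 (indicator a :: _ \<Rightarrow> real)" "integrable M2 (indicator b :: _ \<Rightarrow> real)"
    by (simp_all add: M1.integrable_indicator_finite M2.integrable_indicator_finite)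
  have prod: "(\<integral>x. indicator A x * (f (fst x) * g (snd x)) \<partial>(M1 \<Otimes>\<^sub>M M2)) = (\<integral>x. indicator a x * f x \<partial>M1) * (\<integral>y. indicator b y * g y \<partial>M2)"
    if [measurable]: "f \<in> borel_measurable M1" "g \<in> borel_measurable M2"
      and b: "\<And>x. x \<in> space M1 \<Longrightarrow> \<bar>f x\<bar> \<le> 1" "\<And>x. x \<in> space M2 \<Longrightarrow> \<bar>g x\<bar> \<le> 1" for f g :: "_ \<Rightarrow> real"
  proof -
    have "integrable (M1 \<Otimes>\<^sub>M M2) (\<lambda>x. indicator A x * (f (fst x) * g (snd x)))"
    proof (rule finite_measure.integrable_const_bound[where B=1])
      show "finite_measure (M1 \<Otimes>\<^sub>M M2)" by (rule finite_measure_pair_measure) fact+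
      show "AE x in M1 \<Otimes>\<^sub>M M2. norm (indicator A x * (f (fst x) * g (snd x))) \<le> 1"
        using b by (intro AE_I2) (auto simp: space_pair_measure abs_mult intro!: mult_le_one split: split_indicator)
      show "(\<lambda>x. indicator A x * (f (fst x) * g (snd x))) \<in> borel_measurable (M1 \<Otimes>\<^sub>M M2)"
        unfolding A by measurable
    qed
    from P.integral_fst'[OF this]
    have "(\<integral>x. indicator A x * (f (fst x) * g (snd x)) \<partial>(M1 \<Otimes>\<^sub>M M2))
      = (\<integral>x. \<integral>y. (indicator a x * f x) * (indicator b y * g y) \<partial>M2 \<partial>M1)"
      by (simp add: A indicator_times mult.assoc mult.left_commute)
    then show ?thesis by simp
  qed
  show "(\<lambda>n. \<integral>x. indicator A x * (r n (fst x) * s n (snd x)) \<partial>(M1 \<Otimes>\<^sub>M M2)) \<longlonglongrightarrow>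
      (\<integral>x. indicator A x * (r0 (fst x) * s0 (snd x)) \<partial>(M1 \<Otimes>\<^sub>M M2))"
    using weak_limD(3,4)[OF r] weak_limD(3,4)[OF s]
    by (simp add: prod) (intro tendsto_mult weak_limD(5)[OF r ind(1)] weak_limD(5)[OF s ind(2)])
qed

lemma weak_lim_PiM:
  assumes I: "finite I" and M: "\<And>i. prob_space (M i)" and r: "\<And>i. i \<in> I \<Longrightarrow> weak_lim (M i) (r i) (r0 i)"
  shows "weak_lim (PiM I M) (\<lambda>n x. \<Prod>i\<in>I. r i n (x i)) (\<lambda>x. \<Prod>i\<in>I. r0 i (x i))"
proof (rule weak_limI[where G = "prod_algebra I M"])
  interpret product_prob_space M I using M by (auto simp: product_prob_space_def product_sigma_finite_def product_prob_space_axioms_def prob_space_imp_sigma_finite)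
  show "finite_measure (PiM I M)" by unfold_locales
  have [measurable]: "r i n \<in> borel_measurable (M i)" "r0 i \<in> borel_measurable (M i)" if "i \<in> I" for i n
    using weak_limD(1,2)[OF r[OF that]] by auto
  show "(\<lambda>x. \<Prod>i\<in>I. r i n (x i)) \<in> borel_measurable (PiM I M)" "(\<lambda>x. \<Prod>i\<in>I. r0 i (x i)) \<in> borel_measurable (PiM I M)" for n
    by measurable
  show "\<bar>\<Prod>i\<in>I. r i n (x i)\<bar> \<le> 1" "\<bar>\<Prod>i\<in>I. r0 i (x i)\<bar> \<le> 1" if "x \<in> space (PiM I M)" for n x
    using that weak_limD(3,4)[OF r] by (auto simp: abs_prod space_PiM dest: PiE_mem intro!: prod_le_1)
  show "Int_stable (prod_algebra I M)" by (rule Int_stable_prod_algebra)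
  show "prod_algebra I M \<subseteq> Pow (space (PiM I M))" using prod_algebra_sets_into_space by (simp add: space_PiM)
  show "sets (PiM I M) = sigma_sets (space (PiM I M)) (prod_algebra I M)" by (simp add: sets_PiM space_PiM)
  show "space (PiM I M) \<in> prod_algebra I M" unfolding space_PiM prod_algebra_eq_finite[OF I] by auto
  fix A assume "A \<in> prod_algebra I M"
  then obtain E where A: "A = PiE I E" and E: "\<And>i. i \<in> I \<Longrightarrow> E i \<in> sets (M i)"
    unfolding prod_algebra_eq_finite[OF I] by auto
  have prod: "(\<integral>x. indicator A x * (\<Prod>i\<in>I. f i (x i)) \<partial>PiM I M) = (\<Prod>i\<in>I. \<integral>x. indicator (E i) x * f i x \<partial>M i)"
    if "\<And>i. i \<in> I \<Longrightarrow> f i \<in> borel_measurable (M i)" "\<And>i x. i \<in> I \<Longrightarrow> x \<in> space (M i) \<Longrightarrow> \<bar>f i x\<bar> \<le> 1" for f :: "_ \<Rightarrow> _ \<Rightarrow> real"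
  proof -
    have "(\<integral>x. indicator A x * (\<Prod>i\<in>I. f i (x i)) \<partial>PiM I M) = (\<integral>x. (\<Prod>i\<in>I. indicator (E i) (x i) * f i (x i)) \<partial>PiM I M)"
    proof (intro Bochner_Integration.integral_cong refl)
      fix x assume "x \<in> space (PiM I M)"
      then have "indicator A x = (\<Prod>i\<in>I. indicator (E i) (x i) :: real)"
        using I by (auto simp: A indicator_def space_PiM PiE_iff)
      then show "indicator A x * (\<Prod>i\<in>I. f i (x i)) = (\<Prod>i\<in>I. indicator (E i) (x i) * f i (x i))"
        by (simp add: prod.distrib)
    qed
    also have "\<dots> = (\<Prod>i\<in>I. \<integral>x. indicator (E i) x * f i x \<partial>M i)"
    proof (rule product_integral_prod[OF I])
      fix i assume "i \<in> I"
      then show "integrable (M i) (\<lambda>x. indicator (E i) x * f i x)"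
        using that E by (intro integrable_times_bounded[where B=1]) (auto intro!: M.integrable_indicator_finite)
    qed
    finally show ?thesis .
  qed
  have "(\<lambda>n. \<integral>x. indicator (E i) x * r i n x \<partial>M i) \<longlonglongrightarrow> (\<integral>x. indicator (E i) x * r0 i x \<partial>M i)" if "i \<in> I" for i
    using E[OF that] by (intro weak_limD(5)[OF r[OF that]]) (auto intro!: M.integrable_indicator_finite)
  then show "(\<lambda>n. \<integral>x. indicator A x * (\<Prod>i\<in>I. r i n (x i)) \<partial>PiM I M) \<longlonglongrightarrow> (\<integral>x. indicator A x * (\<Prod>i\<in>I. r0 i (x i)) \<partial>PiM I M)"
    using weak_limD(1-4)[OF r] by (subst prod, (auto)[2], subst prod, (auto)[2]) (intro tendsto_prod)
qed

text \<open>Weak-star compactness by hand: once the integrals over a generator converge, so do those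
  over all measurable sets, and their limit \<open>l\<close> is a set function dominated by
  \<open>M\<close>. Domination gives countable additivity and absolute continuity, and the
  Radon-Nikodym density of \<open>l\<close> is the limit function.\<close>

lemma weak_lim_exists:
  fixes r :: "nat \<Rightarrow> 'a \<Rightarrow> real"
  assumes "finite_measure M"
    and r: "\<And>n. r n \<in> borel_measurable M" "\<And>n x. x \<in> space M \<Longrightarrow> r n x \<in> {0..1}"
    and G: "Int_stable G" "G \<subseteq> Pow (space M)" "sets M = sigma_sets (space M) G" "space M \<in> G"
    and conv: "\<And>A. A \<in> G \<Longrightarrow> convergent (\<lambda>n. \<integral>x. indicator A x * r n x \<partial>M)"
  obtains r0 where "weak_lim M r r0" "\<And>x. r0 x \<in> {0..1}"
proof -
  interpret finite_measure M by fact
  note [measurable] = r(1)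
  have ind: "integrable M (indicator A :: _ \<Rightarrow> real)" if "A \<in> sets M" for A
    using that by (rule integrable_indicator_finite)
  have r1: "\<bar>r n x\<bar> \<le> 1" if "x \<in> space M" for n x using r(2)[OF that, of n] by auto
  have intr: "integrable M (\<lambda>x. f x * r n x)" if "integrable M f" for f n
    by (rule integrable_times_bounded[OF that r(1) r1])
  have conv': "convergent (\<lambda>n. \<integral>x. indicator A x * r n x \<partial>M)" if "A \<in> sets M" for A
  proof -
    have diff: "(\<integral>x. f x * (r (fst p) x - r (snd p) x) \<partial>M) = (\<integral>x. f x * r (fst p) x \<partial>M) - (\<integral>x. f x * r (snd p) x \<partial>M)"
      if "integrable M f" for f p
      using intr[OF that] by (simp add: right_diff_distrib)
    \<comment> \<open>A real sequence converges iff its differences tend to 0 along pairs of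
      indices. In this form \<open>weak_null_integrable\<close> propagates convergence from the
      generator without naming a limit.\<close>
    have iff: "convergent a \<longleftrightarrow> ((\<lambda>p. a (fst p) - a (snd p)) \<longlongrightarrow> 0) (sequentially \<times>\<^sub>F sequentially)" for a :: "nat \<Rightarrow> real"
      unfolding Cauchy_convergent_iff[symmetric] Cauchy_def tendsto_iff eventually_prod_sequentially dist_real_def
      by simp (metis abs_minus_commute)
    have "((\<lambda>p. \<integral>x. indicator A x * (r (fst p) x - r (snd p) x) \<partial>M) \<longlongrightarrow> 0) (sequentially \<times>\<^sub>F sequentially)"
    proof (rule weak_null_integrable[OF \<open>finite_measure M\<close> _ _ G _ ind[OF that]])
      show "\<bar>r (fst p) x - r (snd p) x\<bar> \<le> 1" if "x \<in> space M" for p x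
        using r(2)[OF that, of "fst p"] r(2)[OF that, of "snd p"] by auto
      fix A assume "A \<in> G"
      then have "A \<in> sets M" using G(3) by auto
      from diff[OF ind[OF this]] iff[THEN iffD1, OF conv[OF \<open>A \<in> G\<close>]]
      show "((\<lambda>p. \<integral>x. indicator A x * (r (fst p) x - r (snd p) x) \<partial>M) \<longlongrightarrow> 0) (sequentially \<times>\<^sub>F sequentially)"
        by simp
    qed simp
    then show ?thesis unfolding iff diff[OF ind[OF that]] .
  qed
  define l where "l A = lim (\<lambda>n. \<integral>x. indicator A x * r n x \<partial>M)" for A
  have lim: "(\<lambda>n. \<integral>x. indicator A x * r n x \<partial>M) \<longlonglongrightarrow> l A" if "A \<in> sets M" for A
    using conv'[OF that] by (simp add: l_def convergent_LIMSEQ_iff)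
  have l0: "0 \<le> l A" if "A \<in> sets M" for A
    by (rule LIMSEQ_le_const[OF lim[OF that]]) (use r in \<open>auto intro!: exI[of _ 0] integral_nonneg_AE AE_I2\<close>)
  have l1: "l A \<le> measure M A" if "A \<in> sets M" for A
  proof (rule LIMSEQ_le_const2[OF lim[OF that]], intro exI[of _ 0] allI impI)
    fix n
    have "(\<integral>x. indicator A x * r n x \<partial>M) \<le> (\<integral>x. indicator A x \<partial>M)"
      using r that by (intro integral_mono intr ind) (auto split: split_indicator)
    then show "(\<integral>x. indicator A x * r n x \<partial>M) \<le> measure M A" using that by simp
  qed
  have ladd: "l (A \<union> B) = l A + l B" if "A \<in> sets M" "B \<in> sets M" "A \<inter> B = {}" for A B
  proof (rule LIMSEQ_unique[OF lim])
    have "(\<integral>x. indicator (A \<union> B) x * r n x \<partial>M) = (\<integral>x. indicator A x * r n x \<partial>M) + (\<integral>x. indicator B x * r n x \<partial>M)" for n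
    proof -
      have "indicator (A \<union> B) x = (indicator A x + indicator B x :: real)" for x
        using that(3) by (auto split: split_indicator)
      then show ?thesis
        using intr[OF ind[OF that(1)], of n] intr[OF ind[OF that(2)], of n] by (simp add: distrib_right)
    qed
    then show "(\<lambda>n. \<integral>x. indicator (A \<union> B) x * r n x \<partial>M) \<longlonglongrightarrow> l A + l B"
      using tendsto_add[OF lim[OF that(1)] lim[OF that(2)]] by simp
  qed (use that in auto)
  define N where "N = measure_of (space M) (sets M) (\<lambda>A. ennreal (l A))"
  have [simp]: "sets N = sets M" "space N = space M" by (auto simp: N_def)
  have "l {} = 0" using l0[of "{}"] l1[of "{}"] by simp
  then have pos: "positive (sets M) (\<lambda>A. ennreal (l A))" by (simp add: positive_def)
  have add: "additive (sets M) (\<lambda>A. ennreal (l A))"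
    using l0 by (auto simp: additive_def ladd)
  \<comment> \<open>Continuity at the empty set is inherited from \<open>M\<close>, because
    \<open>l A \<le> measure M A\<close>.\<close>
  have ca: "countably_additive (sets M) (\<lambda>A. ennreal (l A))"
  proof (rule sets.empty_continuous_imp_countably_additive[OF pos add])
    fix A :: "nat \<Rightarrow> _" assume A: "range A \<subseteq> sets M" "decseq A" "(\<Inter>i. A i) = {}"
    have "(\<lambda>i. measure M (A i)) \<longlonglongrightarrow> measure M (\<Inter>i. A i)"
      by (rule finite_Lim_measure_decseq) (use A in auto)
    then have "(\<lambda>i. measure M (A i)) \<longlonglongrightarrow> 0" by (simp add: A(3))
    then have "(\<lambda>i. l (A i)) \<longlonglongrightarrow> 0"
      by (rule Lim_null_comparison[rotated]) (use l0 l1 A in \<open>auto intro!: always_eventually\<close>)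
    then show "(\<lambda>i. ennreal (l (A i))) \<longlonglongrightarrow> 0"
      using tendsto_ennrealI by fastforce
  qed auto
  have emN: "emeasure N A = ennreal (l A)" if "A \<in> sets M" for A
    unfolding N_def by (rule emeasure_measure_of_sigma) (use pos ca that in \<open>auto intro: sets.sigma_algebra_axioms\<close>)
  have "absolutely_continuous M N"
    unfolding absolutely_continuous_def
  proof
    fix A assume "A \<in> null_sets M"
    then have "A \<in> sets M" "measure M A = 0" by (auto simp: measure_def)
    then show "A \<in> null_sets N" using l0[of A] l1[of A] by (auto simp: null_sets_def emN)
  qed
  then obtain f where f [measurable]: "f \<in> borel_measurable M" and fN: "density M f = N"
    using Radon_Nikodym[of N] by auto
  have fA: "(\<integral>\<^sup>+x. f x * indicator A x \<partial>M) = ennreal (l A)" if "A \<in> sets M" for A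
    using emN[OF that] that by (simp add: fN[symmetric] emeasure_density)
  have "(\<integral>\<^sup>+x. f x \<partial>M) = (\<integral>\<^sup>+x. f x * indicator (space M) x \<partial>M)"
    by (intro nn_integral_cong) auto
  then have "(\<integral>\<^sup>+x. f x \<partial>M) \<noteq> \<infinity>" using fA[of "space M"] by simp
  then have ffin: "AE x in M. f x \<noteq> \<infinity>" by (rule nn_integral_PInf_AE[OF f])
  define g where "g x = enn2real (f x)" for x
  have [measurable]: "g \<in> borel_measurable M" unfolding g_def by measurable
  have gA: "(\<integral>\<^sup>+x. ennreal (indicator A x * g x) \<partial>M) = ennreal (l A)" if "A \<in> sets M" for A
    unfolding fA[OF that, symmetric] g_def
    using ffin by (intro nn_integral_cong_AE) (auto elim!: eventually_mono simp: less_top split: split_indicator)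
  have gint: "integrable M g"
    using gA[of "space M"] by (intro integrableI_nonneg) (auto simp: g_def cong: nn_integral_cong_simp)
  have gl: "(\<integral>x. indicator A x * g x \<partial>M) = l A" if "A \<in> sets M" for A
    using gA[OF that] l0[OF that] that by (subst integral_eq_nn_integral) (auto simp: g_def)
  \<comment> \<open>Since \<open>l\<close> is dominated by \<open>M\<close>, its density is at most
    1 almost everywhere; clipping at 1 then gives the bound at every point.\<close>
  have "AE x in M. 0 \<le> 1 - g x"
  proof (rule density_nonneg)
    show "integrable M (\<lambda>x. 1 - g x)" using gint by auto
    fix A assume A: "A \<in> sets M"
    have "(\<integral>x. indicator A x * (1 - g x) \<partial>M) = measure M A - l A"
      using gl[OF A] ind[OF A] integrable_real_mult_indicator[OF A gint] A
      by (simp add: right_diff_distrib mult.commute)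
    then show "0 \<le> (LINT x:A|M. 1 - g x)" using l1[OF A] by (simp add: set_lebesgue_integral_def)
  qed
  then have g1: "AE x in M. min 1 (g x) = g x" by (auto elim!: eventually_mono)
  have "weak_lim M r (\<lambda>x. min 1 (g x))"
  proof (rule weak_limI[OF \<open>finite_measure M\<close> r(1) r1 _ _ G])
    fix A assume "A \<in> G"
    then have A: "A \<in> sets M" using G(3) by auto
    have "(\<integral>x. indicator A x * min 1 (g x) \<partial>M) = (\<integral>x. indicator A x * g x \<partial>M)"
      using g1 A by (intro integral_cong_AE) auto
    then show "(\<lambda>n. \<integral>x. indicator A x * r n x \<partial>M) \<longlonglongrightarrow> (\<integral>x. indicator A x * min 1 (g x) \<partial>M)"
      using lim[OF A] gl[OF A] by simp
  qed (auto simp: g_def)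
  then show thesis by (rule that) (auto simp: g_def)
qed

section \<open>Compactness and convergence of kernels\<close>

text \<open>Limits of distribution functions at rational points need not be right-continuous. The
  infimum over rationals strictly to the right of \<open>x\<close> repairs this, at the price that
  \<open>F\<close> only sandwiches \<open>g\<close> instead of extending it.\<close>

lemma cdf_from_rat:
  fixes g :: "rat \<Rightarrow> real"
  assumes mono: "\<And>p q. p \<le> q \<Longrightarrow> g p \<le> g q" and g0: "\<And>q. q < 0 \<Longrightarrow> g q = 0" and g1: "\<And>q. 1 \<le> q \<Longrightarrow> g q = 1"
  defines "F x \<equiv> INF q\<in>{q. x < of_rat q}. g q"
  shows "x < of_rat q \<Longrightarrow> F x \<le> g q" and "of_rat q \<le> x \<Longrightarrow> g q \<le> F x"
    and "real_distribution (interval_measure F)" and "cdf (interval_measure F) = F"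
proof -
  have pos: "0 \<le> g q" for q
    by (cases "q < 0") (use g0[of q] mono[of "-1" q] g0[of "-1"] in auto)
  have bdd: "bdd_below (g ` {q. x < of_rat q})" for x using pos by (auto intro!: bdd_belowI[of _ 0])
  have ex: "\<exists>q. x < of_rat q \<and> of_rat q < y" if "x < y" for x y :: real
    using of_rat_dense[OF that] by auto
  have ne: "{q. x < of_rat q} \<noteq> {}" for x :: real using ex[of x "x + 1"] by auto
  show low: "F x \<le> g q" if "x < of_rat q" for x q
    unfolding F_def by (rule cINF_lower[OF bdd]) (use that in auto)
  show up: "g q \<le> F x" if "of_rat q \<le> x" for x q
    unfolding F_def
  proof (rule cINF_greatest[OF ne])
    fix p assume "p \<in> {q. x < of_rat q}"
    then have "(of_rat q :: real) \<le> of_rat p" using that by simp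
    then have "q \<le> p" by (simp add: of_rat_less_eq)
    then show "g q \<le> g p" by (rule mono)
  qed
  have Fmono: "F x \<le> F y" if "x \<le> y" for x y
    unfolding F_def by (rule cINF_superset_mono[OF ne bdd]) (use that in auto)
  have rc: "continuous (at_right a) F" for a
  proof (subst continuous_at_right_real_increasing[OF Fmono])
    show "\<forall>e>0. \<exists>d>0. F (a + d) - F a < e"
    proof (intro allI impI)
      fix e :: real assume "e > 0"
      then have "F a < F a + e" by simp
      then have "\<exists>q\<in>{q. a < of_rat q}. g q < F a + e"
        by (subst (asm) F_def, subst (asm) cINF_less_iff[OF ne bdd])
      then obtain q where q: "a < of_rat q" "g q < F a + e" by auto
      then have "F (a + (of_rat q - a) / 2) \<le> g q" by (intro low) (auto simp: field_simps)
      then show "\<exists>d>0. F (a + d) - F a < e"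
        using q by (intro exI[of _ "(of_rat q - a) / 2"]) auto
    qed
  qed auto
  have F0: "F x = 0" if "x < 0" for x
  proof -
    obtain q where "x < of_rat q" "of_rat q < (0::real)" using ex[OF \<open>x < 0\<close>] by auto
    then have "F x \<le> 0" using low[of x q] g0[of q] by simp
    moreover have "0 \<le> F x" unfolding F_def by (rule cINF_greatest[OF ne]) (rule pos)
    ultimately show ?thesis by simp
  qed
  have F1: "F x = 1" if "x \<ge> 1" for x
  proof -
    have "g q = 1" if "x < of_rat q" for q
    proof (rule g1)
      have "1 < (of_rat q :: real)" using \<open>x \<ge> 1\<close> that by linarith
      then show "1 \<le> q" by simp
    qed
    then have "F x = (INF q\<in>{q. x < of_rat q}. 1)" unfolding F_def by (intro INF_cong) auto
    then show ?thesis using ne[of x] by simp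
  qed
  have bot: "(F \<longlongrightarrow> 0) at_bot"
    by (rule tendsto_eventually) (auto simp: eventually_at_bot_linorder F0 intro!: exI[of _ "-1"])
  have top: "(F \<longlongrightarrow> 1) at_top"
    by (rule tendsto_eventually) (auto simp: eventually_at_top_linorder F1 intro!: exI[of _ 1])
  show "real_distribution (interval_measure F)" by (rule real_distribution_interval_measure[OF Fmono rc bot top])
  show "cdf (interval_measure F) = F" by (rule cdf_interval_measure[OF Fmono rc bot])
qed

text \<open>At a jump of the limiting distribution function, \<open>c q\<close> may differ from its
  value, so only two sandwich inequalities are asked for. At a continuity point \<open>x\<close>,
  rationals slightly to the left and to the right of \<open>x\<close> squeeze the values.\<close>

lemma weak_conv_m_rat:
  assumes m: "\<And>n. real_distribution (m n)" "real_distribution m0"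
    and lim: "\<And>q. (\<lambda>n. cdf (m n) (of_rat q)) \<longlonglongrightarrow> c q"
    and up: "\<And>x q. x < of_rat q \<Longrightarrow> cdf m0 x \<le> c q" and low: "\<And>x q. of_rat q \<le> x \<Longrightarrow> c q \<le> cdf m0 x"
  shows "weak_conv_m m m0"
  unfolding weak_conv_m_def weak_conv_def
proof (intro allI impI)
  fix x assume cont: "isCont (cdf m0) x"
  interpret m: real_distribution "m n" for n by (rule m)
  interpret m0: real_distribution m0 by (rule m)
  show "(\<lambda>n. cdf (m n) x) \<longlonglongrightarrow> cdf m0 x"
  proof (rule order_tendstoI)
    fix a assume "a < cdf m0 x"
    then have "eventually (\<lambda>y. a < cdf m0 y) (at x)"
      using cont unfolding isCont_def by (intro order_tendstoD(1))
    then have "eventually (\<lambda>y. a < cdf m0 y) (at_left x)" by (simp add: eventually_at_split)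
    then obtain b where b: "b < x" "\<And>y. b < y \<Longrightarrow> y < x \<Longrightarrow> a < cdf m0 y" by (auto simp: eventually_at_left_field)
    obtain q where q: "(b + x) / 2 < of_rat q" "of_rat q < x" using of_rat_dense[of "(b + x) / 2" x] b(1) by auto
    have "a < cdf m0 ((b + x) / 2)" using b by auto
    also have "\<dots> \<le> c q" using q by (intro up)
    finally have "eventually (\<lambda>n. a < cdf (m n) (of_rat q)) sequentially" using lim by (intro order_tendstoD(1))
    then show "eventually (\<lambda>n. a < cdf (m n) x) sequentially"
    proof eventually_elim
      case (elim n)
      then show ?case using m.cdf_nondecreasing[of "of_rat q" x n] q by simp
    qed
  next
    fix a assume "cdf m0 x < a"
    then have "eventually (\<lambda>y. cdf m0 y < a) (at x)"
      using cont unfolding isCont_def by (intro order_tendstoD(2))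
    then have "eventually (\<lambda>y. cdf m0 y < a) (at_right x)" by (simp add: eventually_at_split)
    then obtain b where b: "x < b" "\<And>y. x < y \<Longrightarrow> y < b \<Longrightarrow> cdf m0 y < a" by (auto simp: eventually_at_right_field)
    obtain q where q: "x < of_rat q" "of_rat q < b" using of_rat_dense[of x b] b(1) by auto
    have "c q \<le> cdf m0 (of_rat q)" by (intro low) auto
    also have "\<dots> < a" using b q by auto
    finally have "eventually (\<lambda>n. cdf (m n) (of_rat q) < a) sequentially" using lim by (intro order_tendstoD(2))
    then show "eventually (\<lambda>n. cdf (m n) x < a) sequentially"
    proof eventually_elim
      case (elim n)
      then show ?case using m.cdf_nondecreasing[of x "of_rat q" n] q by simp
    qed
  qed
qed

lemma integral_uniform_measure:
  fixes f :: "'a \<Rightarrow> real"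
  assumes "finite_measure M" "A \<in> sets M" and nz: "measure M A \<noteq> 0" and f: "f \<in> borel_measurable M"
  shows "(\<integral>x. f x \<partial>uniform_measure M A) = (\<integral>x. indicator A x * f x \<partial>M) / measure M A"
proof -
  interpret finite_measure M by fact
    have "(\<integral>x. f x \<partial>uniform_measure M A) = (\<integral>x. f x \<partial>density M (\<lambda>x. ennreal (indicator A x / measure M A)))"
      unfolding uniform_measure_def using nz
      by (intro arg_cong[where f="\<lambda>g. integral\<^sup>L (density M g) f"])
         (auto simp: fun_eq_iff emeasure_eq_measure divide_ennreal[symmetric] less_le split: split_indicator)
    also have "\<dots> = (\<integral>x. indicator A x / measure M A * f x \<partial>M)"
      using assms by (subst integral_real_density) auto
    finally show ?thesis by simp
qed

text \<open>Convergence of relaxed controls: the test functions are products of an integrable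
  function of the observation and a bounded continuous function of the action. The bound 1 on
  \<open>b\<close> puts the averages into the unit ball that \<open>weak_lim\<close> speaks
  of.\<close>

definition kernel_lim :: "'a measure \<Rightarrow> (nat \<Rightarrow> 'a \<Rightarrow> 'u::topological_space measure) \<Rightarrow> ('a \<Rightarrow> 'u measure) \<Rightarrow> bool" where
  "kernel_lim Q g g0 \<longleftrightarrow> (\<forall>b. continuous_on UNIV b \<longrightarrow> (\<forall>x. \<bar>b x\<bar> \<le> 1) \<longrightarrow>
     weak_lim Q (\<lambda>n y. \<integral>x. b x \<partial>g n y) (\<lambda>y. \<integral>x. b x \<partial>g0 y))"

text \<open>Helly's selection theorem for kernels: along one subsequence the distribution functions
  at rational points have weak-star limits, which outside a null set are consistent and define the
  limit kernel. For the convergence, averaging the kernels over a fixed observation event reduces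
  everything to weak convergence of measures on the line.\<close>

lemma real_kernel_compact:
  fixes g :: "nat \<Rightarrow> 'a \<Rightarrow> real measure"
  assumes "prob_space Q"
    and G: "countable G" "Int_stable G" "G \<subseteq> Pow (space Q)" "sets Q = sigma_sets (space Q) G" "space Q \<in> G"
    and g: "\<And>n. g n \<in> Q \<rightarrow>\<^sub>M prob_algebra borel" "\<And>n y. y \<in> space Q \<Longrightarrow> measure (g n y) {0..1} = 1"
  obtains r g0 where "strict_mono (r :: nat \<Rightarrow> nat)" "g0 \<in> Q \<rightarrow>\<^sub>M prob_algebra borel"
    "kernel_lim Q (\<lambda>n. g (r n)) g0"
proof -
  interpret Q: prob_space Q by fact
  have gd: "real_distribution (g n y)" if "y \<in> space Q" for n y
    using measurable_space[OF g(1) that, of n]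
    by (auto simp: space_prob_algebra real_distribution_def real_distribution_axioms_def)
  have cdfm [measurable]: "(\<lambda>y. cdf (k y) x) \<in> borel_measurable Q" if [measurable]: "k \<in> Q \<rightarrow>\<^sub>M prob_algebra borel" for k :: "'a \<Rightarrow> real measure" and x
    unfolding cdf_def by measurable
  have cdf01: "cdf (g n y) x \<in> {0..1}" if "y \<in> space Q" for n y x
    using real_distribution.cdf_bounded_prob[OF gd[OF that, of n], of x] by (auto simp: cdf_def)
  \<comment> \<open>Countably many numbers, one for each generating event and rational threshold, so
    that one subsequence serves them all.\<close>
  define H where "H n = (\<lambda>(i, q :: rat). \<integral>y. indicator (from_nat_into G i) y * cdf (g n y) (of_rat q) \<partial>Q)" for n
  have GQ: "A \<in> G \<Longrightarrow> A \<in> sets Q" for A using G(4) by auto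
  have "G \<noteq> {}" using G(5) by auto
  have int1: "integrable Q (\<lambda>y. indicator A y * cdf (g n y) x)" if "A \<in> sets Q" for A n x
    using cdf01 that by (intro integrable_times_bounded[where B=1] Q.integrable_indicator_finite cdfm g) auto
  have H01: "H n i \<in> {0..1}" for n i
  proof (cases i)
    case (Pair j q)
    have A: "from_nat_into G j \<in> sets Q" using from_nat_into[OF \<open>G \<noteq> {}\<close>] GQ by auto
    have "H n i \<le> (\<integral>y. 1 \<partial>Q)"
      unfolding H_def Pair prod.case using cdf01
      by (intro integral_mono int1 A) (auto split: split_indicator)
    moreover have "0 \<le> H n i"
      unfolding H_def Pair prod.case using cdf01 by (intro integral_nonneg_AE AE_I2) (auto split: split_indicator)
    ultimately show ?thesis by (simp add: Q.prob_space)
  qed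
  obtain r l where r: "strict_mono r" and l: "\<And>i. (\<lambda>n. H (r n) i) \<longlonglongrightarrow> l i"
    using bounded_real_fun_convergent_subseq[of H "\<lambda>_. 0" "\<lambda>_. 1"] H01 by metis
  have "\<exists>h. weak_lim Q (\<lambda>n y. cdf (g (r n) y) (of_rat q)) h" for q
  proof -
    obtain h where "weak_lim Q (\<lambda>n y. cdf (g (r n) y) (of_rat q)) h"
    proof (rule weak_lim_exists[OF Q.finite_measure_axioms _ _ G(2-5)])
      fix A assume "A \<in> G"
      then obtain i where i: "A = from_nat_into G i" using from_nat_into_surj[OF G(1)] by metis
      show "convergent (\<lambda>n. \<integral>y. indicator A y * cdf (g (r n) y) (of_rat q) \<partial>Q)"
        using l[of "(i, q)"] by (auto simp: H_def i convergent_def)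
    qed (use cdf01 g(1) in auto)
    then show ?thesis by blast
  qed
  then obtain h where h: "\<And>q. weak_lim Q (\<lambda>n y. cdf (g (r n) y) (of_rat q)) (h q)" by metis
  have hm [measurable]: "h q \<in> borel_measurable Q" for q by (rule weak_limD(2)[OF h])
  have hint: "integrable Q (h q)" for q
    using weak_limD(4)[OF h] by (intro Q.integrable_const_bound[where B=1]) auto
  have hlim: "(\<lambda>n. \<integral>y. indicator A y * cdf (g (r n) y) (of_rat q) \<partial>Q) \<longlonglongrightarrow> (\<integral>y. indicator A y * h q y \<partial>Q)"
    if "A \<in> sets Q" for A q
    by (rule weak_limD(5)[OF h Q.integrable_indicator_finite[OF that]])
  \<comment> \<open>Monotonicity in the threshold, like the values 0 below 0 and 1 from 1 on,
    survives the weak-star limit only almost everywhere; since the thresholds are countable, one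
    null set collects all exceptions.\<close>
  have h_le: "AE y in Q. h p y \<le> h q y" if "p \<le> q" for p q
  proof -
    have "AE y in Q. 0 \<le> h q y - h p y"
    proof (rule Q.density_nonneg)
      fix A assume A: "A \<in> sets Q"
      have "(\<integral>y. indicator A y * h p y \<partial>Q) \<le> (\<integral>y. indicator A y * h q y \<partial>Q)"
      proof (rule LIMSEQ_le[OF hlim[OF A] hlim[OF A]], intro exI[of _ 0] allI impI integral_mono int1 A)
        fix n y assume "y \<in> space Q"
        then interpret real_distribution "g (r n) y" by (rule gd)
        show "indicator A y * cdf (g (r n) y) (real_of_rat p) \<le> indicator A y * cdf (g (r n) y) (real_of_rat q)"
          using cdf_nondecreasing[of "of_rat p" "of_rat q"] that by (auto simp: of_rat_less_eq split: split_indicator)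
      qed
      then show "0 \<le> (LINT y:A|Q. h q y - h p y)"
        using integrable_real_mult_indicator[OF A hint] A
        by (simp add: set_lebesgue_integral_def right_diff_distrib mult.commute)
    qed (intro Bochner_Integration.integrable_diff hint)
    then show ?thesis by simp
  qed
  have h_eq: "AE y in Q. h q y = k" if "\<And>n y. y \<in> space Q \<Longrightarrow> cdf (g n y) (of_rat q) = k" for q k
  proof (rule density_unique_real)
    fix A assume A: "A \<in> sets Q"
    have "(\<lambda>n. \<integral>y. indicator A y * cdf (g (r n) y) (of_rat q) \<partial>Q) = (\<lambda>n. \<integral>y. indicator A y * k \<partial>Q)"
      by (intro ext Bochner_Integration.integral_cong refl) (simp add: that)
    then have "(\<integral>y. indicator A y * h q y \<partial>Q) = (\<integral>y. indicator A y * k \<partial>Q)"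
      using LIMSEQ_unique[OF hlim[OF A, of q]] by auto
    then show "(LINT y:A|Q. h q y) = (LINT y:A|Q. k)" by (simp add: set_lebesgue_integral_def)
  qed (use hint in auto)
  define good where "good y \<longleftrightarrow> (\<forall>p q. p \<le> q \<longrightarrow> h p y \<le> h q y) \<and> (\<forall>q<0. h q y = 0) \<and> (\<forall>q\<ge>1. h q y = 1)" for y
  have "AE y in Q. h q y = 0" if "q < 0" for q
  proof (rule h_eq)
    fix n y assume y: "y \<in> space Q"
    interpret real_distribution "g n y" by (rule gd[OF y])
    have "of_rat q < (0 :: real)" using that by simp
    then have "x \<notin> {0..1}" if "x \<le> of_rat q" for x :: real
      using that by (meson atLeastAtMost_iff leD order_trans)
    then have "{..real_of_rat q} \<subseteq> space (g n y) - {0..1}" by auto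
    then have "measure (g n y) {..real_of_rat q} \<le> measure (g n y) (space (g n y) - {0..1})"
      by (intro finite_measure_mono) auto
    also have "\<dots> = 0" using g(2)[OF y] by (subst prob_compl) auto
    finally show "cdf (g n y) (of_rat q) = 0" by (simp add: cdf_def measure_le_0_iff)
  qed
  moreover have "AE y in Q. h q y = 1" if "q \<ge> 1" for q
  proof (rule h_eq)
    fix n y assume y: "y \<in> space Q"
    interpret real_distribution "g n y" by (rule gd[OF y])
    have "1 \<le> (of_rat q :: real)" using that by simp
    then have "{0..1} \<subseteq> {..real_of_rat q}" by auto
    then have "measure (g n y) {0..1} \<le> measure (g n y) {..real_of_rat q}"
      by (intro finite_measure_mono) auto
    then show "cdf (g n y) (of_rat q) = 1" using g(2)[OF y] prob_le_1[of "{..real_of_rat q}"] by (simp add: cdf_def)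
  qed
  ultimately have good: "AE y in Q. good y"
    using h_le unfolding good_def by (auto simp: AE_all_countable)
  have goodm [measurable]: "Measurable.pred Q good" unfolding good_def by measurable
  \<comment> \<open>For exceptional observations the kernel is the point mass at 0, whose
    distribution function jumps from 0 to 1 at the origin.\<close>
  define h' where "h' q y = (if good y then h q y else if q < 0 then 0 else 1)" for q y
  have h'm [measurable]: "h' q \<in> borel_measurable Q" for q unfolding h'_def by measurable
  have h'0: "h' q y = 0" if "q < 0" for q y using that by (auto simp: h'_def good_def)
  have h'1: "h' q y = 1" if "q \<ge> 1" for q y using that by (auto simp: h'_def good_def)
  have h'mono: "h' p y \<le> h' q y" if "p \<le> q" for p q y using that by (auto simp: h'_def good_def)
  have h'01: "h' q y \<in> {0..1}" for q y
    using h'mono[of "min q (-1)" q y] h'0[of "min q (-1)" y] h'mono[of q "max q 1" y] h'1[of "max q 1" y] by auto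
  define F where "F y x = (INF q\<in>{q. x < of_rat q}. h' q y)" for y and x :: real
  have Fm [measurable]: "(\<lambda>y. F y x) \<in> borel_measurable Q" for x unfolding F_def by measurable
  note F = cdf_from_rat[of "\<lambda>q. h' q y" for y, OF h'mono h'0 h'1, folded F_def]
  define g0 where "g0 y = interval_measure (F y)" for y
  have g0d: "real_distribution (g0 y)" for y unfolding g0_def by (rule F(3))
  have g0cdf: "cdf (g0 y) = F y" for y unfolding g0_def by (rule F(4))
  have g0m: "g0 \<in> Q \<rightarrow>\<^sub>M prob_algebra borel"
  proof (rule measurable_prob_algebra_generated[where \<Omega>=UNIV and G="range atMost"])
    show "sets borel = sigma_sets UNIV (range atMost :: real set set)" by (subst borel_eq_atMost) simp
    show "Int_stable (range atMost :: real set set)" by (auto simp: Int_stable_def)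
    show "prob_space (g0 y)" "sets (g0 y) = sets borel" for y
      using g0d[of y] by (auto simp: real_distribution_def real_distribution_axioms_def)
    fix A :: "real set" assume "A \<in> range atMost"
    then obtain x where x: "A = {..x}" by auto
    have "emeasure (g0 y) A = ennreal (F y x)" for y
    proof -
      interpret real_distribution "g0 y" by (rule g0d)
      show ?thesis using g0cdf[of y] by (simp add: x emeasure_eq_measure cdf_def fun_eq_iff)
    qed
    then show "(\<lambda>y. emeasure (g0 y) A) \<in> borel_measurable Q" by simp
  qed auto
  have "weak_lim Q (\<lambda>n y. \<integral>x. b x \<partial>g (r n) y) (\<lambda>y. \<integral>x. b x \<partial>g0 y)"
    if b: "continuous_on UNIV b" "\<And>x. \<bar>b x\<bar> \<le> 1" for b
  proof (rule weak_limI[where G="sets Q"])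
    have bm [measurable]: "b \<in> borel_measurable borel" using b(1) by (rule borel_measurable_continuous_onI)
    have im [measurable]: "(\<lambda>y. \<integral>x. b x \<partial>k y) \<in> borel_measurable Q" if "k \<in> Q \<rightarrow>\<^sub>M prob_algebra borel" for k :: "'a \<Rightarrow> real measure"
      using measurable_prob_algebraD[OF that] by measurable
    show "(\<lambda>y. \<integral>x. b x \<partial>g (r n) y) \<in> borel_measurable Q" "(\<lambda>y. \<integral>x. b x \<partial>g0 y) \<in> borel_measurable Q" for n
      by (intro im g g0m)+
    have bd: "\<bar>\<integral>x. b x \<partial>m\<bar> \<le> 1" if "real_distribution m" for m
    proof -
      interpret real_distribution m by fact
      have "\<bar>\<integral>x. b x \<partial>m\<bar> \<le> (\<integral>x. 1 \<partial>m)"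
        using b(2) by (intro integral_abs_bound[THEN order_trans] integral_mono integrable_abs integrable_const_bound[where B=1]) auto
      also have "\<dots> \<le> 1" by simp
      finally show ?thesis .
    qed
    show "\<bar>\<integral>x. b x \<partial>g (r n) y\<bar> \<le> 1" if "y \<in> space Q" for n y by (rule bd[OF gd[OF that]])
    show "\<bar>\<integral>x. b x \<partial>g0 y\<bar> \<le> 1" for y by (rule bd[OF g0d])
    show "Int_stable (sets Q)" "sets Q \<subseteq> Pow (space Q)" "sets Q = sigma_sets (space Q) (sets Q)" "space Q \<in> sets Q"
      by (auto simp: Int_stable_def sets.sigma_sets_eq dest: sets.sets_into_space)
    fix A assume A: "A \<in> sets Q"
    show "(\<lambda>n. \<integral>y. indicator A y * (\<integral>x. b x \<partial>g (r n) y) \<partial>Q) \<longlonglongrightarrow> (\<integral>y. indicator A y * (\<integral>x. b x \<partial>g0 y) \<partial>Q)"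
    proof (cases "measure Q A = 0")
      case True
      then have "AE y in Q. y \<notin> A" using A by (intro AE_not_in) (simp add: null_sets_def Q.emeasure_eq_measure)
      then have "(\<integral>y. indicator A y * f y \<partial>Q) = 0" for f :: "'a \<Rightarrow> real"
        by (intro integral_eq_zero_AE) (auto elim: eventually_mono)
      then show ?thesis by simp
    next
      case False
      \<comment> \<open>With \<open>Q\<close> conditioned on the event \<open>A\<close>, the measure
        \<open>QA \<bind> k\<close> is the law of the action given \<open>A\<close>. Its
        distribution function at a rational is the average of \<open>cdf (k y)\<close> over
        \<open>A\<close>, and these averages converge by the choice of the subsequence.\<close>
      define QA where "QA = uniform_measure Q A"
      interpret QA: prob_space QA unfolding QA_def
        by (rule prob_space_uniform_measure) (use False in \<open>auto simp: Q.emeasure_eq_measure\<close>)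
      have sQA [measurable_cong]: "sets QA = sets Q" by (simp add: QA_def)
      have QAi: "(\<integral>y. f y \<partial>QA) = (\<integral>y. indicator A y * f y \<partial>Q) / measure Q A" if "f \<in> borel_measurable Q" for f :: "'a \<Rightarrow> real"
        unfolding QA_def by (rule integral_uniform_measure[OF Q.finite_measure_axioms A False that])
      have kQA: "k \<in> QA \<rightarrow>\<^sub>M prob_algebra borel" if "k \<in> Q \<rightarrow>\<^sub>M prob_algebra borel" for k :: "'a \<Rightarrow> real measure"
        using that by (simp add: measurable_cong_sets[OF sQA refl])
      have rd: "real_distribution (QA \<bind> k)" if "k \<in> Q \<rightarrow>\<^sub>M prob_algebra borel" for k :: "'a \<Rightarrow> real measure"
        unfolding real_distribution_def real_distribution_axioms_def
        using prob_space_bind'[of QA QA k borel] sets_bind'[of QA QA k borel] kQA[OF that] QA.prob_space_axioms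
        by (auto simp: space_prob_algebra)
      have cdfb: "cdf (QA \<bind> k) x = (\<integral>y. cdf (k y) x \<partial>QA)" if "k \<in> Q \<rightarrow>\<^sub>M prob_algebra borel" for k :: "'a \<Rightarrow> real measure" and x
        unfolding cdf_def using measurable_prob_algebraD[OF kQA[OF that]]
        by (intro QA.measure_bind) auto
      have ib: "(\<integral>x. b x \<partial>(QA \<bind> k)) = (\<integral>y. \<integral>x. b x \<partial>k y \<partial>QA)" if "k \<in> Q \<rightarrow>\<^sub>M prob_algebra borel" for k :: "'a \<Rightarrow> real measure"
      proof (rule integral_bind[where K=borel and B=1 and B'=1])
        show "AE y in QA. emeasure (k y) (space (k y)) \<le> ennreal 1"
          using measurable_space[OF kQA[OF that]]
          by (intro AE_I2) (auto simp: space_prob_algebra prob_space.emeasure_space_1)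
      qed (use b(2) measurable_prob_algebraD[OF kQA[OF that]] in \<open>auto intro: QA.finite_measure_axioms\<close>)
      have wc: "weak_conv_m (\<lambda>n. QA \<bind> g (r n)) (QA \<bind> g0)"
      proof (rule weak_conv_m_rat[where c = "\<lambda>q. \<integral>y. h' q y \<partial>QA"])
        show "(\<lambda>n. cdf (QA \<bind> g (r n)) (of_rat q)) \<longlonglongrightarrow> (\<integral>y. h' q y \<partial>QA)" for q
        proof -
          have "(\<integral>y. indicator A y * h' q y \<partial>Q) = (\<integral>y. indicator A y * h q y \<partial>Q)"
            using good A by (intro integral_cong_AE) (auto simp: h'_def elim!: eventually_mono)
          then show ?thesis
            using hlim[OF A, of q] False by (simp add: cdfb[OF g(1)] QAi cdfm[OF g(1)] tendsto_divide)
        qed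
        have ih: "integrable QA (h' q)" for q using h'01 by (intro QA.integrable_const_bound[where B=1]) auto
        have iF: "integrable QA (\<lambda>y. F y x)" for x
        proof (intro QA.integrable_const_bound[where B=1] AE_I2)
          fix y
          interpret real_distribution "g0 y" by (rule g0d)
          have "F y x = measure (g0 y) {..x}" using g0cdf[of y] by (metis cdf_def)
          then show "norm (F y x) \<le> 1" by simp
        qed measurable
        show "cdf (QA \<bind> g0) x \<le> (\<integral>y. h' q y \<partial>QA)" if "x < of_rat q" for x q
          unfolding cdfb[OF g0m] g0cdf by (intro integral_mono ih iF F(1) that)
        show "(\<integral>y. h' q y \<partial>QA) \<le> cdf (QA \<bind> g0) x" if "of_rat q \<le> x" for x q
          unfolding cdfb[OF g0m] g0cdf by (intro integral_mono ih iF F(2) that)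
      qed (intro rd g g0m)+
      have "(\<lambda>n. \<integral>x. b x \<partial>(QA \<bind> g (r n))) \<longlonglongrightarrow> (\<integral>x. b x \<partial>(QA \<bind> g0))"
        by (rule weak_conv_imp_integral_bdd_continuous_conv[OF rd rd wc, where B=1])
           (use b g g0m in \<open>auto simp: continuous_on_eq_continuous_at\<close>)
      then have "(\<lambda>n. (\<integral>y. \<integral>x. b x \<partial>g (r n) y \<partial>QA) * measure Q A) \<longlonglongrightarrow> (\<integral>y. \<integral>x. b x \<partial>g0 y \<partial>QA) * measure Q A"
        unfolding ib[OF g(1)] ib[OF g0m] by (rule tendsto_mult_right)
      then show ?thesis
        using False by (simp add: QAi im[OF g(1)] im[OF g0m])
    qed
  qed (intro Q.finite_measure_axioms)
  then show thesis by (intro that[OF r g0m]) (simp add: kernel_lim_def)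
qed

section \<open>Actions in a compact subset of a Euclidean space\<close>

text \<open>The curve fills a cube of half-width \<open>R\<close> around \<open>U\<close>; adding 1
  to the bound makes \<open>R\<close> positive, so that the rescaling from the unit cube is
  invertible. \<open>idx\<close> assigns one coordinate of the space-filling curve to each basis
  vector.\<close>

lemma compact_curve:
  fixes U :: "'u::euclidean_space set"
  assumes "compact U"
  obtains \<psi> :: "real \<Rightarrow> 'u" where "continuous_on UNIV \<psi>" "U \<subseteq> \<psi> ` {0..1}"
proof -
  obtain R0 where R0: "\<And>x. x \<in> U \<Longrightarrow> norm x \<le> R0"
    using compact_imp_bounded[OF assms] unfolding bounded_iff by auto
  define R where "R = \<bar>R0\<bar> + 1"
  have R: "R > 0" "\<And>x. x \<in> U \<Longrightarrow> norm x \<le> R" using R0 by (force simp: R_def)+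
  define idx where "idx = to_nat_on (Basis :: 'u set)"
  have idx: "inj_on idx Basis" unfolding idx_def by (rule inj_on_to_nat_on) (simp add: countable_finite)
  define \<psi> where "\<psi> t = (\<Sum>b\<in>Basis. (2 * R * space_filling t (idx b) - R) *\<^sub>R b)" for t :: real
  have "continuous_on UNIV \<psi>"
    unfolding \<psi>_def by (intro continuous_intros continuous_on_space_filling)
  moreover have "U \<subseteq> \<psi> ` {0..1}"
  proof
    fix u assume "u \<in> U"
    have c: "\<bar>u \<bullet> b\<bar> \<le> R" if "b \<in> Basis" for b
      using Basis_le_norm[OF that, of u] R(2)[OF \<open>u \<in> U\<close>] by linarith
    define x where "x i = (if i \<in> idx ` Basis then (u \<bullet> inv_into Basis idx i + R) / (2 * R) else 0)" for i
    have "x i \<in> {0..1}" for i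
    proof (cases "i \<in> idx ` Basis")
      case True
      then have "\<bar>u \<bullet> inv_into Basis idx i\<bar> \<le> R" by (intro c inv_into_into)
      then show ?thesis using R(1) True by (auto simp: x_def field_simps)
    qed (simp add: x_def)
    then obtain t where t: "t \<in> {0..1}" "space_filling t = x" by (rule space_filling_onto)
    have "2 * R * x (idx b) - R = u \<bullet> b" if "b \<in> Basis" for b
      using that R(1) idx by (simp add: x_def)
    then have "\<psi> t = u" by (simp add: \<psi>_def t(2) euclidean_representation)
    then show "u \<in> \<psi> ` {0..1}" using t(1) by blast
  qed
  ultimately show thesis by (rule that)
qed

text \<open>The section is the first time at which the curve visits \<open>u\<close>. It is Borel
  because the points visited by time \<open>a\<close> form the compact image of a compact set of
  times.\<close>

lemma borel_section:
  fixes \<psi> :: "real \<Rightarrow> 'u::euclidean_space"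
  assumes "continuous_on UNIV \<psi>" "U \<subseteq> \<psi> ` {0..1}"
  obtains \<sigma> where "\<sigma> \<in> borel_on U \<rightarrow>\<^sub>M borel" "\<And>u. u \<in> U \<Longrightarrow> \<sigma> u \<in> {0..1}" "\<And>u. u \<in> U \<Longrightarrow> \<psi> (\<sigma> u) = u"
proof -
  define S where "S u = {0..1} \<inter> \<psi> -` {u}" for u
  define \<sigma> where "\<sigma> u = Inf (S u)" for u
  have "closed (\<psi> -` {u})" for u
    using continuous_closed_vimage[of "{u}" \<psi>] assms(1) by (auto simp: continuous_on_eq_continuous_at)
  then have "closed (S u)" for u unfolding S_def by (intro closed_Int) auto
  moreover have "S u \<noteq> {}" if "u \<in> U" for u using that assms(2) by (auto simp: S_def)
  moreover have "bdd_below (S u)" for u by (auto simp: S_def intro: bdd_belowI[of _ 0])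
  ultimately have \<sigma>S: "\<sigma> u \<in> S u" if "u \<in> U" for u
    using that closed_contains_Inf unfolding \<sigma>_def by blast
  have le: "\<sigma> u \<le> x" if "x \<in> S u" for u x
    unfolding \<sigma>_def by (rule cInf_lower[OF that]) (auto simp: S_def intro: bdd_belowI[of _ 0])
  have "\<sigma> \<in> borel_on U \<rightarrow>\<^sub>M borel"
  proof (rule borel_measurableI_le)
    fix a
    have "{u \<in> space (borel_on U). \<sigma> u \<le> a} = U \<inter> \<psi> ` ({0..1} \<inter> {..a})"
      using \<sigma>S le by (force simp: space_restrict_space S_def image_iff)
    moreover have "compact (\<psi> ` ({0..1} \<inter> {..a}))"
      by (intro compact_continuous_image continuous_on_subset[OF assms(1)] compact_Int_closed) auto
    ultimately show "{u \<in> space (borel_on U). \<sigma> u \<le> a} \<in> sets (borel_on U)"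
      by (auto simp: sets_restrict_space intro: borel_compact)
  qed
  then show thesis using \<sigma>S by (intro that) (auto simp: S_def)
qed

lemma (in prob_space) abs_integral_le:
  fixes f :: "'a \<Rightarrow> real"
  assumes "f \<in> borel_measurable M" "\<And>x. x \<in> space M \<Longrightarrow> \<bar>f x\<bar> \<le> B"
  shows "\<bar>\<integral>x. f x \<partial>M\<bar> \<le> B"
proof -
  have "0 \<le> B" using not_empty assms(2) by (metis abs_ge_zero equals0I order_trans)
  then have "\<bar>\<integral>x. f x \<partial>M\<bar> \<le> (\<integral>x. B \<partial>M)"
    using assms by (intro integral_abs_bound[THEN order_trans] integral_mono integrable_abs integrable_const_bound[where B=B]) auto
  then show ?thesis by (simp add: prob_space)
qed

lemma weak_lim_cong_AE:
  assumes r: "weak_lim M r r0" and "\<And>n x. x \<in> space M \<Longrightarrow> s n x = r n x" "AE x in M. s0 x = r0 x"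
    "s0 \<in> borel_measurable M" "\<And>x. x \<in> space M \<Longrightarrow> \<bar>s0 x\<bar> \<le> 1"
  shows "weak_lim M s s0"
  unfolding weak_lim_def
proof (intro conjI allI ballI impI)
  show "s n \<in> borel_measurable M" for n
    using weak_limD(1)[OF r, of n] assms(2)[of _ n] by (simp cong: measurable_cong)
  show "\<bar>s n x\<bar> \<le> 1" if "x \<in> space M" for n x
    using weak_limD(3)[OF r that] assms(2)[OF that] by simp
  fix f :: "'a \<Rightarrow> real" assume f: "integrable M f"
  have "(\<integral>x. f x * s0 x \<partial>M) = (\<integral>x. f x * r0 x \<partial>M)"
    using assms(3,4) weak_limD(2)[OF r] f by (intro integral_cong_AE) auto
  moreover have "(\<integral>x. f x * s n x \<partial>M) = (\<integral>x. f x * r n x \<partial>M)" for n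
    using assms(2) by (intro Bochner_Integration.integral_cong) auto
  ultimately show "(\<lambda>n. \<integral>x. f x * s n x \<partial>M) \<longlonglongrightarrow> (\<integral>x. f x * s0 x \<partial>M)"
    using weak_limD(5)[OF r f] by simp
qed (use assms in auto)

lemma kernel_integral_measurable:
  fixes b :: "'b \<Rightarrow> real"
  assumes "k \<in> M \<rightarrow>\<^sub>M prob_algebra N" "b \<in> borel_measurable N"
  shows "(\<lambda>y. \<integral>x. b x \<partial>k y) \<in> borel_measurable M"
  using measurable_prob_algebraD[OF assms(1)] assms(2) by measurable

lemma kernelD:
  assumes "k \<in> M \<rightarrow>\<^sub>M prob_algebra N" "y \<in> space M"
  shows "prob_space (k y)" "sets (k y) = sets N" "space (k y) = space N"
  using measurable_space[OF assms] sets_eq_imp_space_eq by (auto simp: space_prob_algebra)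

lemma kernel_abs_integral_le:
  fixes b :: "'b \<Rightarrow> real"
  assumes "k \<in> M \<rightarrow>\<^sub>M prob_algebra N" "y \<in> space M" "b \<in> borel_measurable N" "\<And>x. x \<in> space N \<Longrightarrow> \<bar>b x\<bar> \<le> B"
  shows "\<bar>\<integral>x. b x \<partial>k y\<bar> \<le> B"
proof (rule prob_space.abs_integral_le)
  show "b \<in> borel_measurable (k y)"
    using assms(3) unfolding measurable_cong_sets[OF kernelD(2)[OF assms(1,2)] refl] .
qed (use kernelD[OF assms(1,2)] assms(4) in auto)

text \<open>Policies with actions in \<open>U\<close> are lifted along a Borel section of a curve through \<open>U\<close>, which
  reduces the compactness to real actions.\<close>

lemma kernel_compact:
  fixes U :: "'u::euclidean_space set" and g :: "nat \<Rightarrow> 'a \<Rightarrow> 'u measure"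
  assumes "prob_space Q" and U: "compact U" "U \<noteq> {}"
    and G: "countable G" "Int_stable G" "G \<subseteq> Pow (space Q)" "sets Q = sigma_sets (space Q) G" "space Q \<in> G"
    and g: "\<And>n. g n \<in> Q \<rightarrow>\<^sub>M prob_algebra (borel_on U)"
  obtains r g0 where "strict_mono (r :: nat \<Rightarrow> nat)" "g0 \<in> Q \<rightarrow>\<^sub>M prob_algebra (borel_on U)"
    "kernel_lim Q (\<lambda>n. g (r n)) g0"
proof -
  interpret Q: prob_space Q by fact
  obtain \<psi> :: "real \<Rightarrow> 'u" where \<psi>: "continuous_on UNIV \<psi>" "U \<subseteq> \<psi> ` {0..1}" by (rule compact_curve[OF U(1)])
  obtain \<sigma> where \<sigma>m [measurable]: "\<sigma> \<in> borel_on U \<rightarrow>\<^sub>M borel" and \<sigma>01: "\<And>u. u \<in> U \<Longrightarrow> \<sigma> u \<in> {0..1}"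
    and \<psi>\<sigma>: "\<And>u. u \<in> U \<Longrightarrow> \<psi> (\<sigma> u) = u" by (rule borel_section[OF \<psi>]) blast
  have \<psi>m [measurable]: "\<psi> \<in> borel_measurable borel" using \<psi>(1) by (rule borel_measurable_continuous_onI)
  have Ub [measurable]: "U \<in> sets borel" using U(1) by (rule borel_compact)
  \<comment> \<open>Times at which the curve is inside \<open>U\<close>. The curve may leave
    \<open>U\<close>, so before the limit of the lifted kernels can be mapped back, it must be shown
    to charge \<open>C\<close> only.\<close>
  define C where "C = {0..1} \<inter> \<psi> -` U"
  have "closed (\<psi> -` U)"
    using continuous_closed_vimage[of U \<psi>] \<psi>(1) compact_imp_closed[OF U(1)] by (auto simp: continuous_on_eq_continuous_at)
  then have C: "closed C" unfolding C_def by (intro closed_Int) auto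
  have Cb [measurable]: "C \<in> sets borel" using C by simp
  have \<sigma>C: "\<sigma> u \<in> C" if "u \<in> U" for u using \<sigma>01[OF that] \<psi>\<sigma>[OF that] that by (auto simp: C_def)
  have Cne: "C \<noteq> {}" using \<sigma>C U(2) by auto
  define g' where "g' n y = distr (g n y) borel \<sigma>" for n y
  have g'm: "g' n \<in> Q \<rightarrow>\<^sub>M prob_algebra borel" for n
    unfolding g'_def by (rule measurable_compose[OF g measurable_distr_prob_space[OF \<sigma>m]])
  have sg [measurable_cong]: "sets (g n y) = sets (borel_on U)" and sp: "space (g n y) = U" if "y \<in> space Q" for n y
    using kernelD[OF g that, of n] by (auto simp: space_restrict_space)
  have \<sigma>g: "\<sigma> \<in> g n y \<rightarrow>\<^sub>M borel" if "y \<in> space Q" for n y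
    using \<sigma>m unfolding measurable_cong_sets[OF sg[OF that] refl] .
  have g'1: "measure (g' n y) {0..1} = 1" if y: "y \<in> space Q" for n y
  proof -
    interpret prob_space "g' n y" by (rule kernelD[OF g'm y])
    note [measurable] = \<sigma>g[OF y, of n]
    have "AE x in g' n y. x \<in> {0..1}"
    proof -
      have "AE u in g n y. \<sigma> u \<in> {0..1}" by (rule AE_I2) (use \<sigma>01 sp[OF y] in blast)
      then show ?thesis unfolding g'_def by (subst AE_distr_iff) (simp_all del: atLeastAtMost_iff)
    qed
    moreover have "{0..1} \<in> sets (g' n y)" by (simp add: g'_def)
    ultimately show ?thesis by (simp only: prob_eq_1)
  qed
  have ig': "(\<integral>x. b x \<partial>g' n y) = (\<integral>u. b (\<sigma> u) \<partial>g n y)" if "b \<in> borel_measurable borel" "y \<in> space Q" for b :: "real \<Rightarrow> real" and n y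
    unfolding g'_def by (rule integral_distr[OF \<sigma>g[OF that(2)] that(1)])
  obtain r g0' where r: "strict_mono r" and g0'm: "g0' \<in> Q \<rightarrow>\<^sub>M prob_algebra borel"
    and lim0: "kernel_lim Q (\<lambda>n. g' (r n)) g0'"
    by (rule real_kernel_compact[OF assms(1) G g'm g'1])
  have lim: "weak_lim Q (\<lambda>n y. \<integral>x. b x \<partial>g' (r n) y) (\<lambda>y. \<integral>x. b x \<partial>g0' y)"
    if "continuous_on UNIV b" "\<And>x. \<bar>b x\<bar> \<le> 1" for b
    using lim0 that by (simp add: kernel_lim_def)
  have sg0' [measurable_cong]: "sets (g0' y) = sets borel" if "y \<in> space Q" for y by (rule kernelD[OF g0'm that])
  \<comment> \<open>A bounded continuous function that vanishes exactly on \<open>C\<close>. Its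
    averages under the lifted kernels are 0, hence so is the limit, and the limit kernel is carried
    by \<open>C\<close> for almost every observation.\<close>
  define d where "d x = min 1 (infdist x C)" for x
  have dc: "continuous_on UNIV d" unfolding d_def by (intro continuous_intros)
  have dm [measurable]: "d \<in> borel_measurable borel" using dc by (rule borel_measurable_continuous_onI)
  have d01: "0 \<le> d x" "d x \<le> 1" for x by (auto simp: d_def infdist_nonneg)
  have dC: "d x = 0 \<longleftrightarrow> x \<in> C" for x
    using in_closed_iff_infdist_zero[OF C Cne, of x] by (auto simp: d_def min_def)
  have "weak_lim Q (\<lambda>n y. \<integral>x. d x \<partial>g' (r n) y) (\<lambda>y. \<integral>x. d x \<partial>g0' y)"
    using d01 by (intro lim dc) (simp add: abs_le_iff)
  from weak_limD(5)[OF this, of "\<lambda>_. 1"]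
  have "(\<lambda>n. \<integral>y. \<integral>x. d x \<partial>g' (r n) y \<partial>Q) \<longlonglongrightarrow> (\<integral>y. \<integral>x. d x \<partial>g0' y \<partial>Q)" by simp
  moreover have "(\<integral>y. \<integral>x. d x \<partial>g' n y \<partial>Q) = (\<integral>y. 0 \<partial>Q)" for n
  proof (intro Bochner_Integration.integral_cong refl)
    fix y assume y: "y \<in> space Q"
    have "(\<integral>u. d (\<sigma> u) \<partial>g n y) = (\<integral>u. 0 \<partial>g n y)"
      using \<sigma>C sp[OF y] by (intro Bochner_Integration.integral_cong refl) (simp add: dC)
    then show "(\<integral>x. d x \<partial>g' n y) = 0" by (simp add: ig'[OF dm y])
  qed
  ultimately have "(\<integral>y. \<integral>x. d x \<partial>g0' y \<partial>Q) = 0" by (simp add: LIMSEQ_const_iff)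
  moreover have "integrable Q (\<lambda>y. \<integral>x. d x \<partial>g0' y)"
  proof (intro Q.integrable_const_bound[where B=1] AE_I2 kernel_integral_measurable[OF g0'm dm])
    fix y assume "y \<in> space Q"
    then show "norm (\<integral>x. d x \<partial>g0' y) \<le> 1"
      unfolding real_norm_def by (rule kernel_abs_integral_le[OF g0'm _ dm]) (use d01 in \<open>simp add: abs_le_iff\<close>)
  qed
  moreover have "0 \<le> (\<integral>x. d x \<partial>g0' y)" for y using d01 by (intro integral_nonneg_AE) simp
  ultimately have "AE y in Q. (\<integral>x. d x \<partial>g0' y) = 0"
    using integral_nonneg_eq_0_iff_AE by blast
  with AE_space have AEC: "AE y in Q. AE x in g0' y. x \<in> C"
  proof eventually_elim
    case (elim y)
    interpret prob_space "g0' y" by (rule kernelD[OF g0'm elim(1)])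
    have "d \<in> borel_measurable (g0' y)" using dm unfolding measurable_cong_sets[OF sg0'[OF elim(1)] refl] .
    then have "integrable (g0' y) d"
      using d01 by (intro integrable_const_bound[where B=1]) (auto simp: abs_le_iff)
    then have "AE x in g0' y. d x = 0"
      using elim(2) d01 by (subst (asm) integral_nonneg_eq_0_iff_AE) auto
    then show ?case by (simp add: dC)
  qed
  obtain u0 where u0: "u0 \<in> U" using U(2) by auto
  \<comment> \<open>Times outside \<open>C\<close> are sent to an arbitrary action
    \<open>u0\<close>. This makes the pushforward a kernel into \<open>U\<close> at every
    observation and changes nothing almost everywhere.\<close>
  define \<psi>' where "\<psi>' t = (if t \<in> C then \<psi> t else u0)" for t
  have \<psi>'m: "\<psi>' \<in> borel \<rightarrow>\<^sub>M borel_on U"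
  proof (rule measurable_restrict_space2)
    show "\<psi>' \<in> borel_measurable borel" unfolding \<psi>'_def by measurable
  qed (use u0 in \<open>auto simp: \<psi>'_def C_def\<close>)
  define g0 where "g0 y = distr (g0' y) (borel_on U) \<psi>'" for y
  have g0m: "g0 \<in> Q \<rightarrow>\<^sub>M prob_algebra (borel_on U)"
    unfolding g0_def by (rule measurable_compose[OF g0'm measurable_distr_prob_space[OF \<psi>'m]])
  have main: "weak_lim Q (\<lambda>n y. \<integral>x. b x \<partial>g (r n) y) (\<lambda>y. \<integral>x. b x \<partial>g0 y)"
    if b: "continuous_on UNIV b" "\<And>x. \<bar>b x\<bar> \<le> 1" for b
  proof (rule weak_lim_cong_AE)
    have bm [measurable]: "b \<in> borel_measurable borel" using b(1) by (rule borel_measurable_continuous_onI)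
    have bU: "b \<in> borel_measurable (borel_on U)" by (rule measurable_restrict_space1) simp
    show "weak_lim Q (\<lambda>n y. \<integral>x. b (\<psi> x) \<partial>g' (r n) y) (\<lambda>y. \<integral>x. b (\<psi> x) \<partial>g0' y)"
      by (intro lim b(2) continuous_on_compose2[OF b(1) \<psi>(1)]) auto
    show "(\<integral>x. b x \<partial>g (r n) y) = (\<integral>x. b (\<psi> x) \<partial>g' (r n) y)" if y: "y \<in> space Q" for n y
      by (subst ig'[OF _ y]) (use sp[OF y] in \<open>auto simp: \<psi>\<sigma> intro!: Bochner_Integration.integral_cong\<close>)
    show "AE y in Q. (\<integral>x. b x \<partial>g0 y) = (\<integral>x. b (\<psi> x) \<partial>g0' y)"
      using AEC AE_space
    proof (eventually_elim, goal_cases)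
      case (1 y)
      have m: "\<psi>' \<in> g0' y \<rightarrow>\<^sub>M borel_on U" "\<psi> \<in> g0' y \<rightarrow>\<^sub>M borel"
        using \<psi>'m \<psi>m unfolding measurable_cong_sets[OF sg0'[OF 1(2)] refl] .
      have "(\<integral>x. b x \<partial>g0 y) = (\<integral>x. b (\<psi>' x) \<partial>g0' y)"
        unfolding g0_def by (rule integral_distr[OF m(1) bU])
      also have "\<dots> = (\<integral>x. b (\<psi> x) \<partial>g0' y)"
      proof (rule integral_cong_AE)
        show "(\<lambda>x. b (\<psi>' x)) \<in> borel_measurable (g0' y)" by (rule measurable_compose[OF m(1) bU])
        show "AE x in g0' y. b (\<psi>' x) = b (\<psi> x)" using 1(1) by eventually_elim (simp add: \<psi>'_def)
        show "(\<lambda>x. b (\<psi> x)) \<in> borel_measurable (g0' y)"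
          by (rule measurable_compose[OF m(2) bm])
      qed
      finally show ?case .
    qed
    show "(\<lambda>y. \<integral>x. b x \<partial>g0 y) \<in> borel_measurable Q" by (rule kernel_integral_measurable[OF g0m bU])
    show "\<bar>\<integral>x. b x \<partial>g0 y\<bar> \<le> 1" if "y \<in> space Q" for y
      by (rule kernel_abs_integral_le[OF g0m that bU b(2)])
  qed
  then show thesis by (intro that[OF r g0m]) (simp add: kernel_lim_def)
qed

section \<open>Integrands continuous in the action and measurable in the observation\<close>

text \<open>Normalized tents of radius \<open>e\<close> around an \<open>e / 2\<close>-net. At each
  point of \<open>U\<close> some tent is at least \<open>e / 2\<close>, so truncating the
  denominator at \<open>e / 2\<close> has no effect there and only avoids a division by zero
  elsewhere.\<close>

lemma compact_partition_of_unity: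
  fixes U :: "'u::metric_space set"
  assumes U: "compact U" "U \<noteq> {}" and e: "e > 0"
  obtains J :: nat and v p where "\<And>j. continuous_on UNIV (p j :: 'u \<Rightarrow> real)" "\<And>j u. p j u \<in> {0..1}"
    "\<And>u. u \<in> U \<Longrightarrow> (\<Sum>j<J. p j u) = 1" "\<And>j. v j \<in> U"
    "\<And>u j. p j u \<noteq> 0 \<Longrightarrow> dist u (v j) < e"
proof -
  obtain k where k: "finite k" "k \<subseteq> U" "U \<subseteq> (\<Union>x\<in>k. ball x (e / 2))"
    by (rule compactE_image[OF U(1), of U "\<lambda>x. ball x (e / 2)"]) (use e in auto)
  obtain h where h: "bij_betw h {0..<card k} k" using ex_bij_betw_nat_finite[OF k(1)] by auto
  obtain u0 where u0: "u0 \<in> U" using U by auto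
  define v where "v j = (if j < card k then h j else u0)" for j
  have vU: "v j \<in> U" for j using h k(2) u0 by (auto simp: v_def bij_betw_def)
  define hat where "hat j u = max 0 (e - dist u (v j))" for j u
  define S where "S u = (\<Sum>j<card k. hat j u)" for u
  define p where "p j u = (if j < card k then hat j u / max (e / 2) (S u) else 0)" for j u
  have hat0: "0 \<le> hat j u" for j u by (simp add: hat_def)
  have hatS: "hat j u \<le> S u" if "j < card k" for j u
    unfolding S_def using that hat0 by (intro member_le_sum) auto
  have Sbig: "e / 2 \<le> S u" if "u \<in> U" for u
  proof -
    have "u \<in> (\<Union>x\<in>k. ball x (e / 2))" using k(3) that by blast
    then obtain x where "x \<in> k" "dist x u < e / 2" by (auto simp: mem_ball)
    moreover then obtain j where j: "j < card k" "x = h j" using h unfolding bij_betw_def by (metis atLeastLessThan_iff imageE)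
    ultimately have "e / 2 \<le> hat j u" by (simp add: hat_def v_def dist_commute max_def)
    then show ?thesis using hatS[OF j(1), of u] by simp
  qed
  show thesis
  proof (rule that[of p "card k" v])
    show "continuous_on UNIV (p j)" for j
    proof (cases "j < card k")
      case True
      then have "p j = (\<lambda>u. hat j u / max (e / 2) (S u))" by (auto simp: p_def)
      moreover have "max (e / 2) (S u) \<noteq> 0" for u using e by (auto simp: max_def)
      ultimately show ?thesis
        unfolding hat_def S_def by (auto intro!: continuous_intros simp: S_def hat_def)
    qed (simp add: p_def)
    show "p j u \<in> {0..1}" for j u
    proof (cases "j < card k")
      case True
      have "hat j u \<le> max (e / 2) (S u)" using hatS[OF True, of u] by simp
      then show ?thesis using hat0[of j u] e True by (auto simp: p_def divide_le_eq max_def)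
    qed (simp add: p_def)
    show "(\<Sum>j<card k. p j u) = 1" if "u \<in> U" for u
    proof -
      have "(\<Sum>j<card k. p j u) = S u / max (e / 2) (S u)"
        by (simp add: p_def S_def sum_divide_distrib)
      then show ?thesis using Sbig[OF that] e by (simp add: max_def)
    qed
    show "dist u (v j) < e" if "p j u \<noteq> 0" for u j
      using that by (auto simp: p_def hat_def max_def split: if_splits)
  qed (rule vU)
qed

text \<open>Here the integrand depends on \<open>x\<close> as well. Pushing \<open>K x\<close>
  forward along \<open>Pair x\<close> turns it into a fixed integrand on the product, whose integral
  is measurable in the measure.\<close>

lemma kernel_integral_measurable2:
  fixes c :: "'x \<times> 's \<Rightarrow> real"
  assumes K: "K \<in> M \<rightarrow>\<^sub>M prob_algebra N" and c: "c \<in> borel_measurable (M \<Otimes>\<^sub>M N)"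
  shows "(\<lambda>x. \<integral>s. c (x, s) \<partial>K x) \<in> borel_measurable M"
proof -
  have "(\<lambda>x. distr (K x) (M \<Otimes>\<^sub>M N) (Pair x)) \<in> M \<rightarrow>\<^sub>M subprob_algebra (M \<Otimes>\<^sub>M N)"
    by (rule measurable_distr2[OF _ measurable_prob_algebraD[OF K]]) simp
  from measurable_compose[OF this integral_measurable_subprob_algebra[OF c]]
  have "(\<lambda>x. \<integral>z. c z \<partial>distr (K x) (M \<Otimes>\<^sub>M N) (Pair x)) \<in> borel_measurable M" .
  moreover have "(\<integral>z. c z \<partial>distr (K x) (M \<Otimes>\<^sub>M N) (Pair x)) = (\<integral>s. c (x, s) \<partial>K x)" if "x \<in> space M" for x
  proof (rule integral_distr[OF _ c])
    show "Pair x \<in> K x \<rightarrow>\<^sub>M M \<Otimes>\<^sub>M N"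
      using measurable_Pair1'[OF that, of N] unfolding measurable_cong_sets[OF kernelD(2)[OF K that] refl] .
  qed
  ultimately show ?thesis by (simp cong: measurable_cong)
qed

text \<open>Convergence of relaxed policies tested against products of an observation function and one of
  countably many action functions extends to integrands that are merely measurable in the
  observation: they are approximated by \<open>\<Sum>v. c (x, pt n v) * \<phi> n v s\<close>, uniformly in \<open>s\<close>.\<close>

lemma young_convergence:
  fixes c :: "'x \<times> 's::{metric_space, second_countable_topology} \<Rightarrow> real"
    and \<phi> :: "nat \<Rightarrow> 'v \<Rightarrow> 's \<Rightarrow> real"
  assumes "prob_space \<nu>"
    and S: "compact (space AM)" "space AM \<noteq> {}"
    and c: "c \<in> borel_measurable (\<nu> \<Otimes>\<^sub>M AM)" "\<And>x s. x \<in> space \<nu> \<Longrightarrow> s \<in> space AM \<Longrightarrow> \<bar>c (x, s)\<bar> \<le> C"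
      "\<And>x. x \<in> space \<nu> \<Longrightarrow> continuous_on (space AM) (\<lambda>s. c (x, s))"
    and \<Gamma>: "\<And>m. \<Gamma> m \<in> \<nu> \<rightarrow>\<^sub>M prob_algebra AM" "\<Gamma>0 \<in> \<nu> \<rightarrow>\<^sub>M prob_algebra AM"
    and V: "\<And>n. finite (V n)" "\<And>n v. v \<in> V n \<Longrightarrow> \<phi> n v \<in> borel_measurable AM" "\<And>n v. v \<in> V n \<Longrightarrow> continuous_on (space AM) (\<phi> n v)"
      "\<And>n v s. v \<in> V n \<Longrightarrow> s \<in> space AM \<Longrightarrow> \<phi> n v s \<in> {0..1}" "\<And>n s. s \<in> space AM \<Longrightarrow> (\<Sum>v\<in>V n. \<phi> n v s) = 1"
      "\<And>n v. v \<in> V n \<Longrightarrow> pt n v \<in> space AM"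
    and near: "\<And>N s v s0. strict_mono N \<Longrightarrow> (\<And>i. s i \<in> space AM) \<Longrightarrow> (\<And>i. v i \<in> V (N i)) \<Longrightarrow>
        (\<And>i. \<phi> (N i) (v i) (s i) \<noteq> 0) \<Longrightarrow> s \<longlonglongrightarrow> s0 \<Longrightarrow> (\<lambda>i. pt (N i) (v i)) \<longlonglongrightarrow> s0"
    and wl: "\<And>n v. v \<in> V n \<Longrightarrow> weak_lim \<nu> (\<lambda>m x. \<integral>s. \<phi> n v s \<partial>\<Gamma> m x) (\<lambda>x. \<integral>s. \<phi> n v s \<partial>\<Gamma>0 x)"
  shows "(\<lambda>m. \<integral>x. \<integral>s. c (x, s) \<partial>\<Gamma> m x \<partial>\<nu>) \<longlonglongrightarrow> (\<integral>x. \<integral>s. c (x, s) \<partial>\<Gamma>0 x \<partial>\<nu>)"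
proof -
  interpret \<nu>: prob_space \<nu> by fact
  define S where "S = space AM"
  \<comment> \<open>The uniform error is a supremum over all actions. Over a countable dense set it
    is measurable in \<open>x\<close>, and continuity in \<open>s\<close> recovers the bound on all
    of \<open>S\<close>.\<close>
  obtain D where D: "countable D" "D \<subseteq> S" "S \<subseteq> closure D" by (rule separable)
  have Dne: "D \<noteq> {}" using D(3) S(2) by (auto simp: S_def)
  define cn where "cn n x s = (\<Sum>v\<in>V n. c (x, pt n v) * \<phi> n v s)" for n x s
  define er where "er n x = (SUP s\<in>D. \<bar>c (x, s) - cn n x s\<bar>)" for n x
  have csec [measurable]: "(\<lambda>x. c (x, s)) \<in> borel_measurable \<nu>" if "s \<in> S" for s
    using measurable_compose[OF measurable_Pair2'[of s AM \<nu>] c(1)] that by (simp add: S_def)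
  have csec2: "(\<lambda>s. c (x, s)) \<in> borel_measurable AM" if "x \<in> space \<nu>" for x
    using measurable_compose[OF measurable_Pair1'[OF that, of AM] c(1)] .
  have C0: "0 \<le> C" using c(2) \<nu>.not_empty S(2) by (metis abs_ge_zero equals0I order_trans)
  have cn_le: "\<bar>cn n x s\<bar> \<le> C" if "x \<in> space \<nu>" "s \<in> S" for n x s
  proof -
    have "\<bar>cn n x s\<bar> \<le> (\<Sum>v\<in>V n. C * \<phi> n v s)"
      unfolding cn_def using V(4,6) c(2)[OF that(1)] that(2) C0
      by (intro sum_abs[THEN order_trans] sum_mono) (auto simp: abs_mult S_def intro!: mult_mono)
    also have "\<dots> = C" using V(5) that(2) by (simp add: sum_distrib_left[symmetric] S_def)
    finally show ?thesis .
  qed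
  have diff_le: "\<bar>c (x, s) - cn n x s\<bar> \<le> 2 * C" if "x \<in> space \<nu>" "s \<in> S" for n x s
    using cn_le[OF that, of n] c(2)[OF that(1), of s] that(2) by (auto simp: S_def)
  have bdd: "bdd_above ((\<lambda>s. \<bar>c (x, s) - cn n x s\<bar>) ` D)" if "x \<in> space \<nu>" for n x
    using diff_le[OF that] D(2) by (auto intro!: bdd_aboveI[of _ "2 * C"])
  have er_le: "er n x \<le> 2 * C" "0 \<le> er n x" if x: "x \<in> space \<nu>" for n x
  proof -
    show "er n x \<le> 2 * C" unfolding er_def by (rule cSUP_least[OF Dne]) (use diff_le[OF x] D(2) in auto)
    obtain s where "s \<in> D" using Dne by auto
    then have "\<bar>c (x, s) - cn n x s\<bar> \<le> er n x" unfolding er_def by (intro cSUP_upper bdd x)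
    then show "0 \<le> er n x" by linarith
  qed
  have er_bound: "\<bar>c (x, s) - cn n x s\<bar> \<le> er n x" if x: "x \<in> space \<nu>" "s \<in> S" for n x s
  proof -
    obtain d where d: "\<And>i::nat. d i \<in> D" "d \<longlonglongrightarrow> s" using D(3) x(2) closure_sequential by blast
    have "continuous_on S (\<lambda>s. \<bar>c (x, s) - cn n x s\<bar>)"
      unfolding cn_def using c(3)[OF x(1)] V(3) by (auto intro!: continuous_intros simp: S_def)
    then have "(\<lambda>i. \<bar>c (x, d i) - cn n x (d i)\<bar>) \<longlonglongrightarrow> \<bar>c (x, s) - cn n x s\<bar>"
      using d D(2) x(2) by (intro continuous_on_tendsto_compose[where s=S and f="\<lambda>s. \<bar>c (x, s) - cn n x s\<bar>"]) (auto intro!: always_eventually)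
    then show ?thesis
      by (rule LIMSEQ_le_const2) (auto simp: er_def intro!: cSUP_upper bdd x d)
  qed
  \<comment> \<open>If the error did not vanish, there would be actions \<open>s i\<close> and nodes
    with nonzero weight at them between which \<open>c\<close> differs by at least
    \<open>e / 2\<close>. Along a subsequence both converge to the same point by compactness and
    \<open>near\<close>, contradicting continuity of the cost in the action.\<close>
  have er_lim: "(\<lambda>n. er n x) \<longlonglongrightarrow> 0" if x: "x \<in> space \<nu>" for x
  proof (rule ccontr)
    assume "\<not> ?thesis"
    then obtain e where e: "e > 0" "\<not> eventually (\<lambda>n. dist (er n x) 0 < e) sequentially"
      unfolding tendsto_iff by auto
    from not_eventually_sequentiallyD[OF e(2)] obtain N :: "nat \<Rightarrow> nat" where N: "strict_mono N" "\<And>i. \<not> dist (er (N i) x) 0 < e" by auto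
    have N2: "e \<le> er (N i) x" for i using N(2)[of i] er_le(2)[OF x, of "N i"] by (simp add: dist_real_def)
    have "\<exists>s v. s \<in> S \<and> v \<in> V (N i) \<and> \<phi> (N i) v s \<noteq> 0 \<and> e / 2 \<le> \<bar>c (x, s) - c (x, pt (N i) v)\<bar>" for i
    proof -
      have "e / 2 < er (N i) x" using N2[of i] e(1) by simp
      then obtain s where s: "s \<in> D" "e / 2 < \<bar>c (x, s) - cn (N i) x s\<bar>"
        unfolding er_def using less_cSUP_iff[OF Dne bdd[OF x]] by blast
      then have sS: "s \<in> S" using D(2) by auto
      show ?thesis
      proof (rule ccontr)
        assume neg: "\<not> ?thesis"
        \<comment> \<open>As the weights sum to 1, the error at \<open>s\<close> is a weighted
          average of differences between \<open>s\<close> and the nodes; if all those with nonzero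
          weight were small, the error would be too.\<close>
        have "c (x, s) - cn (N i) x s = (\<Sum>v\<in>V (N i). (c (x, s) - c (x, pt (N i) v)) * \<phi> (N i) v s)"
          using V(5)[of s "N i"] sS by (simp add: cn_def left_diff_distrib sum_subtractf sum_distrib_left[symmetric] S_def)
        also have "\<bar>\<dots>\<bar> \<le> (\<Sum>v\<in>V (N i). e / 2 * \<phi> (N i) v s)"
        proof (intro sum_abs[THEN order_trans] sum_mono)
          fix v assume v: "v \<in> V (N i)"
          show "\<bar>(c (x, s) - c (x, pt (N i) v)) * \<phi> (N i) v s\<bar> \<le> e / 2 * \<phi> (N i) v s"
          proof (cases "\<phi> (N i) v s = 0")
            case False
            then have "\<bar>c (x, s) - c (x, pt (N i) v)\<bar> \<le> e / 2" using neg sS v by force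
            then show ?thesis
              using V(4)[OF v, of s] sS unfolding abs_mult by (intro mult_mono) (auto simp: S_def e(1) less_imp_le)
          qed simp
        qed
        also have "\<dots> = e / 2" using V(5)[of s "N i"] sS unfolding sum_distrib_left[symmetric] by (simp add: S_def)
        finally show False using s(2) by simp
      qed
    qed
    then obtain s v where sv: "\<And>i. s i \<in> S" "\<And>i. v i \<in> V (N i)" "\<And>i. \<phi> (N i) (v i) (s i) \<noteq> 0"
      "\<And>i. e / 2 \<le> \<bar>c (x, s i) - c (x, pt (N i) (v i))\<bar>" by metis
    obtain s0 r where r: "s0 \<in> S" "strict_mono (r :: nat \<Rightarrow> nat)" "(s \<circ> r) \<longlonglongrightarrow> s0"
      using S(1) sv(1) compact_eq_seq_compact_metric unfolding S_def seq_compact_def by metis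
    have l1: "(\<lambda>i. s (r i)) \<longlonglongrightarrow> s0" using r(3) by (simp add: o_def)
    have l2: "(\<lambda>i. pt (N (r i)) (v (r i))) \<longlonglongrightarrow> s0"
      using near[of "N \<circ> r" "\<lambda>i. s (r i)" "\<lambda>i. v (r i)" s0] strict_mono_o[OF N(1) r(2)] sv l1 by (simp add: S_def o_def)
    have "(\<lambda>i. \<bar>c (x, s (r i)) - c (x, pt (N (r i)) (v (r i)))\<bar>) \<longlonglongrightarrow> \<bar>c (x, s0) - c (x, s0)\<bar>"
      by (intro tendsto_intros continuous_on_tendsto_compose[OF c(3)[OF x] l1] continuous_on_tendsto_compose[OF c(3)[OF x] l2])
         (use r(1) sv V(6) in \<open>auto simp: S_def\<close>)
    then have "(\<lambda>i. \<bar>c (x, s (r i)) - c (x, pt (N (r i)) (v (r i)))\<bar>) \<longlonglongrightarrow> 0" by simp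
    from LIMSEQ_le_const[OF this, of "e / 2"] show False using sv(4) e(1) by force
  qed
  have erm [measurable]: "er n \<in> borel_measurable \<nu>" for n
    unfolding er_def[abs_def]
  proof (rule borel_measurable_cSUP[OF D(1)])
    fix s assume "s \<in> D"
    then have "s \<in> S" using D(2) by auto
    then show "(\<lambda>x. \<bar>c (x, s) - cn n x s\<bar>) \<in> borel_measurable \<nu>"
      unfolding cn_def using V(6) csec by (auto simp: S_def intro!: borel_measurable_abs borel_measurable_diff borel_measurable_sum borel_measurable_times)
  qed (rule bdd)
  have er_int: "integrable \<nu> (er n)" for n
    using er_le by (intro \<nu>.integrable_const_bound[where B="2 * C"]) auto
  have "(\<lambda>n. \<integral>x. er n x \<partial>\<nu>) \<longlonglongrightarrow> (\<integral>x. 0 \<partial>\<nu>)"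
    by (rule integral_dominated_convergence[where w="\<lambda>_. 2 * C"]) (use er_lim er_le in auto)
  then have er_int_lim: "(\<lambda>n. \<integral>x. er n x \<partial>\<nu>) \<longlonglongrightarrow> 0" by simp
  define I where "I K = (\<integral>x. \<integral>s. c (x, s) \<partial>K x \<partial>\<nu>)" for K
  define In where "In n K = (\<integral>x. \<integral>s. cn n x s \<partial>K x \<partial>\<nu>)" for n K
  have inner_m: "(\<lambda>x. \<integral>s. c (x, s) \<partial>K x) \<in> borel_measurable \<nu>" if "K \<in> \<nu> \<rightarrow>\<^sub>M prob_algebra AM" for K
    by (rule kernel_integral_measurable2[OF that c(1)])
  have cint: "integrable (K x) (\<lambda>s. c (x, s))" "integrable (K x) (\<phi> n v)"
    if "K \<in> \<nu> \<rightarrow>\<^sub>M prob_algebra AM" "x \<in> space \<nu>" "v \<in> V n" for K x n v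
  proof -
    interpret prob_space "K x" by (rule kernelD[OF that(1,2)])
    note k = kernelD[OF that(1,2)]
    show "integrable (K x) (\<lambda>s. c (x, s))"
      using c(2)[OF that(2)] k(3) csec2[OF that(2)]
      by (intro integrable_const_bound[where B=C] AE_I2) (simp_all add: measurable_cong_sets[OF k(2) refl])
    show "integrable (K x) (\<phi> n v)"
      using V(2,4)[OF that(3)] k(3)
      by (intro integrable_const_bound[where B=1] AE_I2) (simp_all add: measurable_cong_sets[OF k(2) refl])
  qed
  have cn_eq: "(\<integral>s. cn n x s \<partial>K x) = (\<Sum>v\<in>V n. c (x, pt n v) * (\<integral>s. \<phi> n v s \<partial>K x))"
    and cn_int: "integrable (K x) (cn n x)"
    if "K \<in> \<nu> \<rightarrow>\<^sub>M prob_algebra AM" "x \<in> space \<nu>" for K x n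
    unfolding cn_def[abs_def] using cint(2)[OF that]
    by (auto intro!: Bochner_Integration.integrable_sum integrable_mult_right)
  have term_int: "integrable \<nu> (\<lambda>x. c (x, pt n v) * (\<integral>s. \<phi> n v s \<partial>K x))"
    if "K \<in> \<nu> \<rightarrow>\<^sub>M prob_algebra AM" "v \<in> V n" for K n v
  proof (rule integrable_times_bounded[where B=1])
    show "integrable \<nu> (\<lambda>x. c (x, pt n v))"
      using c(2) V(6)[OF that(2)] csec[of "pt n v"] by (intro \<nu>.integrable_const_bound[where B=C]) (auto simp: S_def)
    show "(\<lambda>x. \<integral>s. \<phi> n v s \<partial>K x) \<in> borel_measurable \<nu>" by (rule kernel_integral_measurable[OF that(1) V(2)[OF that(2)]])
    show "\<bar>\<integral>s. \<phi> n v s \<partial>K x\<bar> \<le> 1" if "x \<in> space \<nu>" for x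
      by (rule kernel_abs_integral_le[OF \<open>K \<in> _\<close> that V(2)[OF \<open>v \<in> V n\<close>]]) (use V(4)[OF \<open>v \<in> V n\<close>] in auto)
  qed
  have In_eq: "In n K = (\<Sum>v\<in>V n. \<integral>x. c (x, pt n v) * (\<integral>s. \<phi> n v s \<partial>K x) \<partial>\<nu>)" if "K \<in> \<nu> \<rightarrow>\<^sub>M prob_algebra AM" for n K
  proof -
    have "In n K = (\<integral>x. (\<Sum>v\<in>V n. c (x, pt n v) * (\<integral>s. \<phi> n v s \<partial>K x)) \<partial>\<nu>)"
      unfolding In_def by (intro Bochner_Integration.integral_cong refl cn_eq[OF that])
    also have "\<dots> = (\<Sum>v\<in>V n. \<integral>x. c (x, pt n v) * (\<integral>s. \<phi> n v s \<partial>K x) \<partial>\<nu>)"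
      by (intro Bochner_Integration.integral_sum term_int that)
    finally show ?thesis .
  qed
  \<comment> \<open>The bound is the same for every kernel, so it applies along the whole sequence
    and to its limit.\<close>
  have approx: "\<bar>I K - In n K\<bar> \<le> (\<integral>x. er n x \<partial>\<nu>)" if K: "K \<in> \<nu> \<rightarrow>\<^sub>M prob_algebra AM" for K n
  proof -
    have i1: "integrable \<nu> (\<lambda>x. \<integral>s. c (x, s) \<partial>K x)"
    proof (intro \<nu>.integrable_const_bound[where B=C] AE_I2 inner_m[OF K])
      fix x assume "x \<in> space \<nu>"
      then show "norm (\<integral>s. c (x, s) \<partial>K x) \<le> C"
        unfolding real_norm_def by (rule kernel_abs_integral_le[OF K _ csec2]) (use c(2) \<open>x \<in> space \<nu>\<close> in auto)
    qed
    have i2: "integrable \<nu> (\<lambda>x. \<integral>s. cn n x s \<partial>K x)"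
      using term_int[OF K] by (subst Bochner_Integration.integrable_cong[OF refl cn_eq[OF K]]) auto
    have "\<bar>I K - In n K\<bar> = \<bar>\<integral>x. (\<integral>s. c (x, s) \<partial>K x) - (\<integral>s. cn n x s \<partial>K x) \<partial>\<nu>\<bar>"
      unfolding I_def In_def using i1 i2 by simp
    also have "\<dots> \<le> (\<integral>x. \<bar>(\<integral>s. c (x, s) \<partial>K x) - (\<integral>s. cn n x s \<partial>K x)\<bar> \<partial>\<nu>)" by (rule integral_abs_bound)
    also have "\<dots> \<le> (\<integral>x. er n x \<partial>\<nu>)"
    proof (intro integral_mono integrable_abs Bochner_Integration.integrable_diff i1 i2 er_int)
      fix x assume x: "x \<in> space \<nu>"
      interpret Kx: prob_space "K x" by (rule kernelD[OF K x])
      have ic: "integrable (K x) (\<lambda>s. c (x, s))"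
        using c(2)[OF x] kernelD[OF K x] csec2[OF x]
        by (intro Kx.integrable_const_bound[where B=C] AE_I2) (simp_all add: measurable_cong_sets[OF kernelD(2)[OF K x] refl])
      have "(\<integral>s. c (x, s) \<partial>K x) - (\<integral>s. cn n x s \<partial>K x) = (\<integral>s. c (x, s) - cn n x s \<partial>K x)"
        using ic cn_int[OF K x] by simp
      also have "\<bar>\<dots>\<bar> \<le> er n x"
        using ic cn_int[OF K x] er_bound[OF x] kernelD(3)[OF K x]
        by (intro Kx.abs_integral_le borel_measurable_diff) (auto simp: S_def)
      finally show "\<bar>(\<integral>s. c (x, s) \<partial>K x) - (\<integral>s. cn n x s \<partial>K x)\<bar> \<le> er n x" .
    qed
    finally show ?thesis .
  qed
  have In_lim: "(\<lambda>m. In n (\<Gamma> m)) \<longlonglongrightarrow> In n \<Gamma>0" for n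
    unfolding In_eq[OF \<Gamma>(1)] In_eq[OF \<Gamma>(2)]
  proof (intro tendsto_sum)
    fix v assume v: "v \<in> V n"
    have "integrable \<nu> (\<lambda>x. c (x, pt n v))"
      using c(2) V(6)[OF v] csec[of "pt n v"] by (intro \<nu>.integrable_const_bound[where B=C]) (auto simp: S_def)
    then show "(\<lambda>m. \<integral>x. c (x, pt n v) * (\<integral>s. \<phi> n v s \<partial>\<Gamma> m x) \<partial>\<nu>) \<longlonglongrightarrow> (\<integral>x. c (x, pt n v) * (\<integral>s. \<phi> n v s \<partial>\<Gamma>0 x) \<partial>\<nu>)"
      by (rule weak_limD(5)[OF wl[OF v]])
  qed
  have "(\<lambda>m. I (\<Gamma> m)) \<longlonglongrightarrow> I \<Gamma>0"
  proof (rule tendstoI)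
    fix e :: real assume "e > 0"
    then have "eventually (\<lambda>n. (\<integral>x. er n x \<partial>\<nu>) < e / 3) sequentially"
      by (intro order_tendstoD(2)[OF er_int_lim]) auto
    then obtain n where n: "(\<integral>x. er n x \<partial>\<nu>) < e / 3" by (auto simp: eventually_sequentially)
    have "eventually (\<lambda>m. dist (In n (\<Gamma> m)) (In n \<Gamma>0) < e / 3) sequentially"
      by (rule tendstoD[OF In_lim]) (use \<open>e > 0\<close> in auto)
    then show "eventually (\<lambda>m. dist (I (\<Gamma> m)) (I \<Gamma>0) < e) sequentially"
    proof eventually_elim
      case (elim m)
      then show ?case using approx[OF \<Gamma>(1), of m n] approx[OF \<Gamma>(2), of n] n unfolding dist_real_def by linarith
    qed
  qed
  then show ?thesis by (simp add: I_def)
qed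

section \<open>Continuous games on compact subsets of the Hilbert cube\<close>

text \<open>The game is pulled back along the space-filling curve and solved on the line. The
  equilibrium measures are then moved to [0,1], together with maps \<open>\<theta>1\<close>,
  \<open>\<theta>2\<close> whose values are strategies for every parameter and not only almost
  surely.\<close>

lemma nash_equilibrium_cube:
  fixes X1 :: "('i::countable \<Rightarrow> real) set" and X2 :: "('j::countable \<Rightarrow> real) set"
    and \<Phi>1 \<Phi>2 :: "('i \<Rightarrow> real) \<times> ('j \<Rightarrow> real) \<Rightarrow> real"
  assumes X: "closed X1" "closed X2" "X1 \<noteq> {}" "X2 \<noteq> {}" "\<And>x i. x \<in> X1 \<Longrightarrow> x i \<in> {0..1}" "\<And>x i. x \<in> X2 \<Longrightarrow> x i \<in> {0..1}"
    and \<Phi>: "continuous_on (X1 \<times> X2) \<Phi>1" "continuous_on (X1 \<times> X2) \<Phi>2"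
  obtains a b \<theta>1 \<theta>2 where "a \<in> space (prob_algebra (borel_on {0..1::real}))" "b \<in> space (prob_algebra (borel_on {0..1::real}))"
    "\<theta>1 \<in> borel_on {0..1} \<rightarrow>\<^sub>M borel" "\<theta>2 \<in> borel_on {0..1} \<rightarrow>\<^sub>M borel" "\<And>t. \<theta>1 t \<in> X1" "\<And>t. \<theta>2 t \<in> X2"
    "\<And>x. x \<in> X1 \<Longrightarrow> (\<integral>s. \<integral>t. \<Phi>1 (\<theta>1 s, \<theta>2 t) \<partial>b \<partial>a) \<le> (\<integral>t. \<Phi>1 (x, \<theta>2 t) \<partial>b)"
    "\<And>x. x \<in> X2 \<Longrightarrow> (\<integral>s. \<integral>t. \<Phi>2 (\<theta>1 s, \<theta>2 t) \<partial>b \<partial>a) \<le> (\<integral>s. \<Phi>2 (\<theta>1 s, x) \<partial>a)"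
proof -
  define K1 where "K1 = {0..1} \<inter> (space_filling :: real \<Rightarrow> 'i \<Rightarrow> real) -` X1"
  define K2 where "K2 = {0..1} \<inter> (space_filling :: real \<Rightarrow> 'j \<Rightarrow> real) -` X2"
  have sc1: "continuous_on A (space_filling :: real \<Rightarrow> 'i \<Rightarrow> real)" for A
    by (intro continuous_on_coordinatewise_then_product continuous_on_space_filling)
  have sc2: "continuous_on A (space_filling :: real \<Rightarrow> 'j \<Rightarrow> real)" for A
    by (intro continuous_on_coordinatewise_then_product continuous_on_space_filling)
  have K: "compact K1" "compact K2"
    unfolding K1_def K2_def using continuous_on_closed_vimage[of UNIV] sc1[of UNIV] sc2[of UNIV] X(1,2)
    by (auto intro!: compact_Int_closed)
  have on1: "\<exists>s\<in>K1. space_filling s = x" if "x \<in> X1" for x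
    using space_filling_onto[of x] X(5)[OF that] that by (metis IntI K1_def vimageI)
  have on2: "\<exists>s\<in>K2. space_filling s = x" if "x \<in> X2" for x
    using space_filling_onto[of x] X(6)[OF that] that by (metis IntI K2_def vimageI)
  obtain k1 k2 where k: "k1 \<in> K1" "k2 \<in> K2" using on1 on2 X(3,4) by blast
  have "\<exists>C G. continuous_on UNIV G \<and> (\<forall>x. \<bar>G x\<bar> \<le> C) \<and> (\<forall>s\<in>K1. \<forall>t\<in>K2. G (s, t) = \<Phi> (space_filling s, space_filling t))"
    if "continuous_on (X1 \<times> X2) \<Phi>" for \<Phi> :: "('i \<Rightarrow> real) \<times> ('j \<Rightarrow> real) \<Rightarrow> real"
  proof -
    let ?H = "\<lambda>x. \<Phi> (space_filling (fst x), space_filling (snd x))"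
    have c: "continuous_on (K1 \<times> K2) ?H"
    proof (rule continuous_on_compose2[OF that])
      show "continuous_on (K1 \<times> K2) (\<lambda>x. (space_filling (fst x) :: 'i \<Rightarrow> real, space_filling (snd x) :: 'j \<Rightarrow> real))"
        by (intro continuous_on_Pair continuous_on_compose2[OF sc1[of UNIV]] continuous_on_compose2[OF sc2[of UNIV]] continuous_on_fst continuous_on_snd continuous_on_id) auto
    qed (auto simp: K1_def K2_def)
    have cK: "compact (K1 \<times> K2)" by (intro compact_Times K)
    have "bounded (?H ` (K1 \<times> K2))" by (rule compact_imp_bounded[OF compact_continuous_image[OF c cK]])
    then obtain C where C0: "\<forall>y\<in>?H ` (K1 \<times> K2). norm y \<le> C" unfolding bounded_iff by blast
    have C: "\<bar>?H x\<bar> \<le> C" if "x \<in> K1 \<times> K2" for x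
      using bspec[OF C0 imageI[OF that]] by simp
    have "0 \<le> C" using C[of "(k1, k2)"] k by (meson SigmaI abs_ge_zero order_trans)
    \<comment> \<open>Tietze's theorem extends the pulled-back cost to the whole plane with the same
      bound, which is the form solved by \<open>nash_equilibrium_compact_real\<close>.\<close>
    obtain G where "continuous_on UNIV G" "\<And>x. x \<in> K1 \<times> K2 \<Longrightarrow> G x = ?H x" "\<And>x. x \<in> UNIV \<Longrightarrow> norm (G x) \<le> C"
      using Tietze[of "K1 \<times> K2" ?H UNIV C] c C compact_imp_closed[OF cK] \<open>0 \<le> C\<close> by auto
    then show ?thesis by (intro exI[of _ C] exI[of _ G]) auto
  qed
  then obtain C1 G1 C2 G2 where G1: "continuous_on UNIV G1" "\<And>x. \<bar>G1 x\<bar> \<le> C1" "\<And>s t. s \<in> K1 \<Longrightarrow> t \<in> K2 \<Longrightarrow> G1 (s, t) = \<Phi>1 (space_filling s, space_filling t)"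
    and G2: "continuous_on UNIV G2" "\<And>x. \<bar>G2 x\<bar> \<le> C2" "\<And>s t. s \<in> K1 \<Longrightarrow> t \<in> K2 \<Longrightarrow> G2 (s, t) = \<Phi>2 (space_filling s, space_filling t)"
    using \<Phi> by metis
  have Gb: "\<bar>G1 x\<bar> \<le> max C1 C2" "\<bar>G2 x\<bar> \<le> max C1 C2" for x
    using G1(2)[of x] G2(2)[of x] by auto
  have "K1 \<noteq> {}" "K2 \<noteq> {}" using k by auto
  obtain a' b' where ab: "real_distribution a'" "real_distribution b'" "AE s in a'. s \<in> K1" "AE t in b'. t \<in> K2"
    and ne1: "\<And>s. s \<in> K1 \<Longrightarrow> (\<integral>s. \<integral>t. G1 (s, t) \<partial>b' \<partial>a') \<le> (\<integral>t. G1 (s, t) \<partial>b')"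
    and ne2: "\<And>t. t \<in> K2 \<Longrightarrow> (\<integral>s. \<integral>t. G2 (s, t) \<partial>b' \<partial>a') \<le> (\<integral>s. G2 (s, t) \<partial>a')"
    using nash_equilibrium_compact_real[OF K \<open>K1 \<noteq> {}\<close> \<open>K2 \<noteq> {}\<close> G1(1) G2(1) Gb] by metis
  interpret a': real_distribution a' by fact
  interpret b': real_distribution b' by fact
  \<comment> \<open>Parameters outside \<open>K1\<close>, a null set for \<open>a'\<close>, are sent
    to a fixed point of \<open>K1\<close>. Because \<open>c1\<close> is idempotent, integrating
    along it under \<open>a\<close> agrees with integrating under \<open>a'\<close>.\<close>
  define c1 where "c1 s = (if s \<in> K1 then s else k1)" for s
  define c2 where "c2 s = (if s \<in> K2 then s else k2)" for s
  have cK: "c1 s \<in> K1" "c2 s \<in> K2" for s using k by (auto simp: c1_def c2_def)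
  have cc: "c1 (c1 s) = c1 s" "c2 (c2 s) = c2 s" for s using cK by (auto simp: c1_def c2_def)
  have Kb [measurable]: "K1 \<in> sets borel" "K2 \<in> sets borel" using K by (auto intro: borel_compact)
  have cb [measurable]: "c1 \<in> borel_measurable borel" "c2 \<in> borel_measurable borel"
    unfolding c1_def[abs_def] c2_def[abs_def] by measurable
  have c01 [measurable]: "c1 \<in> borel \<rightarrow>\<^sub>M borel_on {0..1}" "c2 \<in> borel \<rightarrow>\<^sub>M borel_on {0..1}"
    using cK by (auto intro!: measurable_restrict_space2 cb simp: K1_def K2_def)
  have c1a: "c1 \<in> a' \<rightarrow>\<^sub>M borel_on {0..1}" and c2b: "c2 \<in> b' \<rightarrow>\<^sub>M borel_on {0..1}"
    using c01 by (simp_all add: measurable_cong_sets[OF a'.events_eq_borel refl] measurable_cong_sets[OF b'.events_eq_borel refl])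
  define a where "a = distr a' (borel_on {0..1}) c1"
  define b where "b = distr b' (borel_on {0..1}) c2"
  define \<theta>1 :: "real \<Rightarrow> 'i \<Rightarrow> real" where "\<theta>1 s = space_filling (c1 s)" for s
  define \<theta>2 :: "real \<Rightarrow> 'j \<Rightarrow> real" where "\<theta>2 s = space_filling (c2 s)" for s
  have Gm [measurable]: "G1 \<in> borel_measurable borel" "G2 \<in> borel_measurable borel"
    using G1(1) G2(1) by (auto intro: borel_measurable_continuous_onI)
  have ia: "(\<integral>s. f (c1 s) \<partial>a) = (\<integral>s. f s \<partial>a')" if f: "f \<in> borel_measurable borel" for f :: "real \<Rightarrow> real"
  proof -
    have fa: "f \<in> borel_measurable a'" using f by simp
    have fc: "(\<lambda>s. f (c1 s)) \<in> borel_measurable borel" using measurable_compose[OF cb(1) f] .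
    have "(\<integral>s. f (c1 s) \<partial>a) = (\<integral>s. f (c1 (c1 s)) \<partial>a')"
      unfolding a_def by (rule integral_distr[OF c1a]) (rule measurable_restrict_space1[OF fc])
    also have "\<dots> = (\<integral>s. f s \<partial>a')"
      using ab(3) fa fc by (intro integral_cong_AE) (auto simp: cc, auto simp: c1_def elim: eventually_mono)
    finally show ?thesis .
  qed
  have ib: "(\<integral>s. f (c2 s) \<partial>b) = (\<integral>s. f s \<partial>b')" if f: "f \<in> borel_measurable borel" for f :: "real \<Rightarrow> real"
  proof -
    have fb: "f \<in> borel_measurable b'" using f by simp
    have fc: "(\<lambda>s. f (c2 s)) \<in> borel_measurable borel" using measurable_compose[OF cb(2) f] .
    have "(\<integral>s. f (c2 s) \<partial>b) = (\<integral>s. f (c2 (c2 s)) \<partial>b')"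
      unfolding b_def by (rule integral_distr[OF c2b]) (rule measurable_restrict_space1[OF fc])
    also have "\<dots> = (\<integral>s. f s \<partial>b')"
      using ab(4) fb fc by (intro integral_cong_AE) (auto simp: cc, auto simp: c2_def elim: eventually_mono)
    finally show ?thesis .
  qed
  have sect: "(\<lambda>t. G (s, t)) \<in> borel_measurable borel" "(\<lambda>t. G (t, s)) \<in> borel_measurable borel"
    "(\<lambda>s. \<integral>t. G (s, t) \<partial>b') \<in> borel_measurable borel"
    if "G \<in> borel_measurable borel" for G :: "real \<times> real \<Rightarrow> real" and s
  proof -
    have [measurable]: "G \<in> borel_measurable (borel \<Otimes>\<^sub>M borel)" using that by (simp add: borel_prod)
    show "(\<lambda>t. G (s, t)) \<in> borel_measurable borel" "(\<lambda>t. G (t, s)) \<in> borel_measurable borel" by measurable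
    show "(\<lambda>s. \<integral>t. G (s, t) \<partial>b') \<in> borel_measurable borel" by (rule b'.borel_measurable_lebesgue_integral) measurable
  qed
  have \<Phi>G1: "\<Phi>1 (\<theta>1 s, \<theta>2 t) = G1 (c1 s, c2 t)" and \<Phi>G2: "\<Phi>2 (\<theta>1 s, \<theta>2 t) = G2 (c1 s, c2 t)" for s t
    using G1(3)[OF cK] G2(3)[OF cK] by (simp_all add: \<theta>1_def \<theta>2_def)
  show thesis
  proof (rule that[of a b \<theta>1 \<theta>2])
    show "a \<in> space (prob_algebra (borel_on {0..1}))" "b \<in> space (prob_algebra (borel_on {0..1}))"
      using a'.prob_space_distr[OF c1a] b'.prob_space_distr[OF c2b] by (auto simp: space_prob_algebra a_def b_def)
    show "\<theta>1 \<in> borel_on {0..1} \<rightarrow>\<^sub>M borel" "\<theta>2 \<in> borel_on {0..1} \<rightarrow>\<^sub>M borel"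
      unfolding \<theta>1_def[abs_def] \<theta>2_def[abs_def]
      by (rule measurable_restrict_space1, rule measurable_compose[OF cb(1)], rule borel_measurable_continuous_onI[OF sc1])
        (rule measurable_restrict_space1, rule measurable_compose[OF cb(2)], rule borel_measurable_continuous_onI[OF sc2])
    show "\<theta>1 t \<in> X1" "\<theta>2 t \<in> X2" for t using cK[of t] by (auto simp: \<theta>1_def \<theta>2_def K1_def K2_def)
    show "(\<integral>s. \<integral>t. \<Phi>1 (\<theta>1 s, \<theta>2 t) \<partial>b \<partial>a) \<le> (\<integral>t. \<Phi>1 (x, \<theta>2 t) \<partial>b)" if xX: "x \<in> X1" for x
    proof -
      obtain s where s: "s \<in> K1" "space_filling s = x" using on1[OF xX] by auto
      then have x: "\<Phi>1 (x, \<theta>2 t) = G1 (s, c2 t)" for t using G1(3)[OF s(1) cK(2)] by (simp add: \<theta>2_def)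
      show ?thesis unfolding \<Phi>G1 x ib[OF sect(1)[OF Gm(1)]] ia[OF sect(3)[OF Gm(1)]] by (rule ne1[OF s(1)])
    qed
    show "(\<integral>s. \<integral>t. \<Phi>2 (\<theta>1 s, \<theta>2 t) \<partial>b \<partial>a) \<le> (\<integral>s. \<Phi>2 (\<theta>1 s, x) \<partial>a)" if xX: "x \<in> X2" for x
    proof -
      obtain s where s: "s \<in> K2" "space_filling s = x" using on2[OF xX] by auto
      then have x: "\<Phi>2 (\<theta>1 t, x) = G2 (c1 t, s)" for t using G2(3)[OF cK(1) s(1)] by (simp add: \<theta>1_def)
      show ?thesis unfolding \<Phi>G2 x ib[OF sect(1)[OF Gm(2)]] ia[OF sect(3)[OF Gm(2)]] ia[OF sect(2)[OF Gm(2)]] by (rule ne2[OF s(1)])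
    qed
  qed
qed

section \<open>The weak topology on policies\<close>

text \<open>Finite intersections of a countable base form a countable family that is stable under
  intersection. The empty intersection contributes the whole space, so that its trace
  \<open>Y\<close> belongs to the family, as \<open>weak_limI\<close> asks.\<close>

lemma countable_Int_stable_generator:
  fixes Y :: "'y::second_countable_topology set"
  assumes Y: "Y \<in> sets borel"
  obtains A :: "nat \<Rightarrow> 'y set" where "Int_stable (range A)" "range A \<subseteq> Pow Y"
    "sets (borel_on Y) = sigma_sets Y (range A)" "Y \<in> range A"
proof -
  obtain B :: "'y set set" where B: "countable B" "topological_basis B" using ex_countable_basis by blast
  define G0 where "G0 = Inter ` {F. finite F \<and> F \<subseteq> B}"
  have G0: "countable G0" "B \<subseteq> G0" "UNIV \<in> G0" "Int_stable G0"
  proof -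
    show "countable G0" unfolding G0_def by (intro countable_image countable_Collect_finite_subset B)
    show "B \<subseteq> G0"
    proof
      fix b assume "b \<in> B"
      then show "b \<in> G0" unfolding G0_def by (intro image_eqI[of _ _ "{b}"]) auto
    qed
    show "UNIV \<in> G0" unfolding G0_def by (intro image_eqI[of _ _ "{}"]) auto
    show "Int_stable G0"
      unfolding Int_stable_def G0_def
    proof (intro ballI)
      fix a b assume "a \<in> Inter ` {F. finite F \<and> F \<subseteq> B}" "b \<in> Inter ` {F. finite F \<and> F \<subseteq> B}"
      then obtain F F' where "a = \<Inter>F" "b = \<Inter>F'" "finite F" "finite F'" "F \<subseteq> B" "F' \<subseteq> B" by auto
      then show "a \<inter> b \<in> Inter ` {F. finite F \<and> F \<subseteq> B}"
        by (intro image_eqI[of _ _ "F \<union> F'"]) (auto simp: Inter_Un_distrib)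
    qed
  qed
  have "sets borel = sigma_sets UNIV B" by (subst borel_eq_countable_basis[OF B]) simp
  moreover have "sigma_sets UNIV G0 = sigma_sets UNIV B"
  proof (rule sigma_sets_eqI)
    fix a assume "a \<in> G0"
    then obtain F where F: "a = \<Inter>F" "finite F" "F \<subseteq> B" by (auto simp: G0_def)
    have "open a" unfolding F(1) using F(2,3) B(2) by (intro open_Inter) (auto intro: topological_basis_open)
    then have "a \<in> sets borel" by simp
    then show "a \<in> sigma_sets UNIV B" using \<open>sets borel = sigma_sets UNIV B\<close> by simp
  qed (use G0(2) in auto)
  ultimately have sb: "sets borel = sigma_sets UNIV G0" by simp
  have "sets (borel_on Y) = sigma_sets Y ((\<inter>) Y ` G0)"
    unfolding sets_restrict_space sb by (rule sigma_sets_Int) (use Y sb in auto)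
  moreover have "range (from_nat_into ((\<inter>) Y ` G0)) = (\<inter>) Y ` G0"
    by (rule range_from_nat_into) (use G0 in auto)
  moreover have "Int_stable ((\<inter>) Y ` G0)"
    unfolding Int_stable_def
  proof (intro ballI)
    fix a b assume "a \<in> (\<inter>) Y ` G0" "b \<in> (\<inter>) Y ` G0"
    then obtain a' b' where "a = Y \<inter> a'" "b = Y \<inter> b'" "a' \<in> G0" "b' \<in> G0" by auto
    then show "a \<inter> b \<in> (\<inter>) Y ` G0"
      using Int_stableD[OF G0(4)] by (intro image_eqI[of _ _ "a' \<inter> b'"]) auto
  qed
  moreover have "Y \<in> (\<inter>) Y ` G0" using G0(3) by (intro image_eqI[of _ _ UNIV]) auto
  ultimately show thesis by (intro that[of "from_nat_into ((\<inter>) Y ` G0)"]) auto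
qed

section \<open>Borel sets of an abstract topology\<close>

lemma space_borel_of [simp]: "space (borel_of T) = topspace T"
  unfolding borel_of_def by (rule space_measure_of) (auto dest: openin_subset)

lemma sets_borel_of: "sets (borel_of T) = sigma_sets (topspace T) {S. openin T S}"
  unfolding borel_of_def by (rule sets_measure_of) (auto dest: openin_subset)

lemma openin_in_borel_of: "openin T S \<Longrightarrow> S \<in> sets (borel_of T)"
  by (auto simp: sets_borel_of)

lemma measurable_borel_ofI:
  assumes "\<And>S. openin T S \<Longrightarrow> f -` S \<inter> space M \<in> sets M" "\<And>x. x \<in> space M \<Longrightarrow> f x \<in> topspace T"
  shows "f \<in> M \<rightarrow>\<^sub>M borel_of T"
  unfolding borel_of_def by (rule measurable_measure_of) (use assms in \<open>auto dest: openin_subset\<close>)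

lemma continuous_map_borel_of:
  assumes "continuous_map T T' f"
  shows "f \<in> borel_of T \<rightarrow>\<^sub>M borel_of T'"
proof (rule measurable_borel_ofI)
  fix S assume "openin T' S"
  then have "openin T {x \<in> topspace T. f x \<in> S}" by (rule openin_continuous_map_preimage[OF assms])
  moreover have "{x \<in> topspace T. f x \<in> S} = f -` S \<inter> space (borel_of T)" by auto
  ultimately show "f -` S \<inter> space (borel_of T) \<in> sets (borel_of T)" by (simp add: openin_in_borel_of)
qed (use assms in \<open>auto simp: continuous_map_def\<close>)

lemma continuous_map_borel:
  fixes f :: "'a \<Rightarrow> 'b::topological_space"
  assumes "continuous_map T euclidean f"
  shows "f \<in> borel_measurable (borel_of T)"
proof (rule borel_measurableI)
  fix S :: "'b set" assume "open S"
  then have "openin T {x \<in> topspace T. f x \<in> S}" by (intro openin_continuous_map_preimage[OF assms]) simp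
  moreover have "{x \<in> topspace T. f x \<in> S} = f -` S \<inter> space (borel_of T)" by auto
  ultimately show "f -` S \<inter> space (borel_of T) \<in> sets (borel_of T)" by (simp add: openin_in_borel_of)
qed

lemma continuous_map_borel_on:
  assumes "continuous_map (top_of_set X) T f"
  shows "f \<in> borel_on X \<rightarrow>\<^sub>M borel_of T"
proof (rule measurable_borel_ofI)
  fix S assume "openin T S"
  then have "openin (top_of_set X) {x \<in> topspace (top_of_set X). f x \<in> S}" by (rule openin_continuous_map_preimage[OF assms])
  then obtain V where "open V" "{x \<in> X. f x \<in> S} = X \<inter> V" by (auto simp: openin_open)
  moreover have "{x \<in> X. f x \<in> S} = f -` S \<inter> space (borel_on X)" by (auto simp: space_restrict_space)
  ultimately show "f -` S \<inter> space (borel_on X) \<in> sets (borel_on X)"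
    by (auto simp: sets_restrict_space)
qed (use assms in \<open>auto simp: continuous_map_def space_restrict_space\<close>)

section \<open>Weakly continuous maps and evaluation on Borel sets\<close>

lemma topspace_weak_topology [simp]: "topspace (weak_topology X) = space (prob_algebra (borel_on X))"
proof -
  have "space (prob_algebra (borel_on X)) = {m \<in> space (prob_algebra (borel_on X)). (\<integral>x. 0 \<partial>m) \<in> (UNIV :: real set)}"
    by simp
  then have "space (prob_algebra (borel_on X)) \<in> {{m \<in> space (prob_algebra (borel_on X)). (\<integral>x. f x \<partial>m) \<in> V} | f V.
        continuous_on X (f :: 'a \<Rightarrow> real) \<and> bounded (f ` X) \<and> open V}"
    by (intro CollectI exI[of _ "\<lambda>_. 0"] exI[of _ UNIV]) (auto intro: bounded_subset[of "{0}"])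
  then show ?thesis unfolding weak_topology_def topology_generated_by_topspace by blast
qed

lemma continuous_map_weak_integral:
  fixes f :: "'a::topological_space \<Rightarrow> real"
  assumes "continuous_on X f" "bounded (f ` X)"
  shows "continuous_map (weak_topology X) euclideanreal (\<lambda>m. \<integral>x. f x \<partial>m)"
  unfolding continuous_map
proof (intro conjI allI impI)
  fix V :: "real set" assume "openin euclideanreal V"
  then show "openin (weak_topology X) {m \<in> topspace (weak_topology X). (\<integral>x. f x \<partial>m) \<in> V}"
    unfolding topspace_weak_topology using assms unfolding weak_topology_def
    by (intro topology_generated_by_Basis) auto
qed simp

lemma continuous_map_into_weak_topology:
  assumes "\<And>x. x \<in> topspace T \<Longrightarrow> h x \<in> space (prob_algebra (borel_on X))"
    and "\<And>f :: 'a::topological_space \<Rightarrow> real. continuous_on X f \<Longrightarrow> bounded (f ` X) \<Longrightarrow> continuous_map T euclideanreal (\<lambda>x. \<integral>y. f y \<partial>h x)"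
  shows "continuous_map T (weak_topology X) h"
  unfolding weak_topology_def
proof (rule continuous_on_generated_topo)
  fix U assume "U \<in> {{m \<in> space (prob_algebra (borel_on X)). (\<integral>x. f x \<partial>m) \<in> V} | f V.
        continuous_on X (f :: 'a \<Rightarrow> real) \<and> bounded (f ` X) \<and> open V}"
  then obtain f :: "'a \<Rightarrow> real" and V where U: "U = {m \<in> space (prob_algebra (borel_on X)). (\<integral>x. f x \<partial>m) \<in> V}"
    and f: "continuous_on X f" "bounded (f ` X)" "open V" by (elim CollectE exE conjE)
  have "h -` U \<inter> topspace T = {x \<in> topspace T. (\<integral>y. f y \<partial>h x) \<in> V}"
    using assms(1) by (auto simp: U)
  then show "openin T (h -` U \<inter> topspace T)"
    using openin_continuous_map_preimage[OF assms(2)[OF f(1,2)], of V] f(3) by simp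
next
  show "h ` topspace T \<subseteq> \<Union> {{m \<in> space (prob_algebra (borel_on X)). (\<integral>x. f x \<partial>m) \<in> V} | f V.
        continuous_on X (f :: 'a \<Rightarrow> real) \<and> bounded (f ` X) \<and> open V}"
    unfolding topspace_weak_topology[of X, unfolded weak_topology_def topology_generated_by_topspace]
    using assms(1) by (rule image_subsetI)
qed

text \<open>The indicator of a closed set is a pointwise limit of bounded continuous functions, so
  evaluation on it is a limit of weakly continuous functions. This makes integrals of merely
  measurable functions, such as indicators of observation events, Borel functions of the
  policy.\<close>

lemma measurable_borel_of_weak_topology:
  fixes X :: "'a::metric_space set"
  assumes "X \<in> sets borel"
  shows "(\<lambda>m. m) \<in> borel_of (weak_topology X) \<rightarrow>\<^sub>M prob_algebra (borel_on X)"
proof (rule measurable_prob_algebra_generated[where \<Omega>=X and G="(\<inter>) X ` Collect closed"])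
  show "sets (borel_on X) = sigma_sets X ((\<inter>) X ` Collect closed)"
  proof -
    have sb: "sets borel = sigma_sets UNIV (Collect (closed :: 'a set \<Rightarrow> bool))" by (subst borel_eq_closed) simp
    show ?thesis unfolding sets_restrict_space sb by (rule sigma_sets_Int) (use assms sb in auto)
  qed
  show "Int_stable ((\<inter>) X ` Collect closed)"
    unfolding Int_stable_def
  proof (intro ballI)
    fix a b assume "a \<in> (\<inter>) X ` Collect closed" "b \<in> (\<inter>) X ` Collect closed"
    then obtain a' b' where "a = X \<inter> a'" "b = X \<inter> b'" "closed a'" "closed b'" by auto
    then show "a \<inter> b \<in> (\<inter>) X ` Collect closed"
      by (intro image_eqI[of _ _ "a' \<inter> b'"]) auto
  qed
  fix A assume "A \<in> (\<inter>) X ` Collect closed"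
  then obtain C where A: "A = X \<inter> C" and C: "closed C" by auto
  show "(\<lambda>m. emeasure m A) \<in> borel_measurable (borel_of (weak_topology X))"
  \<comment> \<open>By convention \<open>infdist\<close> to the empty set is 0, so the functions
    \<open>f n\<close> would then be constantly 1.\<close>
  proof (cases "C = {}")
    case False
    define f where "f n x = max 0 (1 - real n * infdist x C)" for n x
    have fc: "continuous_on S (f n)" for n S unfolding f_def by (intro continuous_intros)
    have f01: "\<bar>f n x\<bar> \<le> 1" for n x using infdist_nonneg[of x C] by (auto simp: f_def)
    have flim: "(\<lambda>n. f n x) \<longlonglongrightarrow> indicator C x" for x
    proof (cases "x \<in> C")
      case True
      then show ?thesis by (simp add: f_def)
    next
      case out: False
      then have pos: "infdist x C > 0"
        using in_closed_iff_infdist_zero[OF C False, of x] infdist_nonneg[of x C] by (auto simp: less_le)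
      obtain n0 :: nat where n0: "1 / infdist x C < real n0" using reals_Archimedean2 by blast
      have "f n x = 0" if "n \<ge> n0" for n
      proof -
        have "1 / infdist x C < real n" using n0 that by (meson less_le_trans of_nat_le_iff)
        then show ?thesis using pos by (simp add: f_def field_simps)
      qed
      then show ?thesis using out by (intro tendsto_eventually) (auto simp: eventually_sequentially)
    qed
    have mf: "(\<lambda>m. \<integral>x. f n x \<partial>m) \<in> borel_measurable (borel_of (weak_topology X))" for n
      by (intro continuous_map_borel continuous_map_weak_integral fc)
        (use f01 in \<open>auto simp: bounded_iff intro!: exI[of _ 1]\<close>)
    have lim: "(\<lambda>n. \<integral>x. f n x \<partial>m) \<longlonglongrightarrow> measure m A" if "m \<in> space (borel_of (weak_topology X))" for m
    proof -
      have m: "prob_space m" "sets m = sets (borel_on X)" using that by (auto simp: space_prob_algebra)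
      interpret prob_space m by (rule m)
      have sp: "space m = X" using sets_eq_imp_space_eq[OF m(2)] by (simp add: space_restrict_space)
      have "(\<lambda>n. \<integral>x. f n x \<partial>m) \<longlonglongrightarrow> (\<integral>x. indicator C x \<partial>m)"
      proof (rule integral_dominated_convergence[where w="\<lambda>_. 1"])
        show "f n \<in> borel_measurable m" for n
          unfolding measurable_cong_sets[OF m(2) refl]
          by (rule measurable_restrict_space1[OF borel_measurable_continuous_onI[OF fc]])
        show "indicator C \<in> borel_measurable m"
          unfolding measurable_cong_sets[OF m(2) refl] by (rule measurable_restrict_space1) (use C in simp)
      qed (use flim f01 in auto)
      moreover have "(\<integral>x. indicator C x \<partial>m) = measure m A"
        using sp by (simp add: A Int_commute)
      ultimately show ?thesis by simp
    qed
    have "(\<lambda>m. measure m A) \<in> borel_measurable (borel_of (weak_topology X))"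
      by (rule borel_measurable_LIMSEQ_real[OF lim mf])
    then have "(\<lambda>m. ennreal (measure m A)) \<in> borel_measurable (borel_of (weak_topology X))" by simp
    moreover have "emeasure m A = ennreal (measure m A)" if "m \<in> space (borel_of (weak_topology X))" for m
      using that by (intro finite_measure.emeasure_eq_measure) (auto simp: space_prob_algebra prob_space_def)
    ultimately show ?thesis by (subst measurable_cong) assumption+
  qed (simp add: A)
qed (auto simp: space_prob_algebra)

section \<open>Team policies\<close>

lemma borel_on_prod_measurable:
  fixes U :: "'u::euclidean_space set" and Y :: "'y::euclidean_space set"
  shows "(\<lambda>x. (snd x, fst x)) \<in> borel_on Y \<Otimes>\<^sub>M borel_on U \<rightarrow>\<^sub>M borel_on (U \<times> Y)"
proof (rule measurable_restrict_space2)
  have 1: "snd \<in> borel_on Y \<Otimes>\<^sub>M borel_on U \<rightarrow>\<^sub>M borel"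
    using measurable_compose[OF measurable_snd measurable_restrict_space1[OF measurable_ident[of borel]]] by (simp add: id_def)
  have 2: "fst \<in> borel_on Y \<Otimes>\<^sub>M borel_on U \<rightarrow>\<^sub>M borel"
    using measurable_compose[OF measurable_fst measurable_restrict_space1[OF measurable_ident[of borel]]] by (simp add: id_def)
  show "(\<lambda>x. (snd x, fst x)) \<in> borel_on Y \<Otimes>\<^sub>M borel_on U \<rightarrow>\<^sub>M borel"
    using borel_measurable_Pair[OF 1 2] by simp
qed (auto simp: space_pair_measure space_restrict_space)

lemma kernel_joint:
  fixes U :: "'u::euclidean_space set" and Y :: "'y::euclidean_space set" and f :: "'u \<times> 'y \<Rightarrow> real"
  assumes Q: "Q \<in> space (prob_algebra (borel_on Y))" and g: "\<gamma> \<in> borel_on Y \<rightarrow>\<^sub>M prob_algebra (borel_on U)"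
  shows "kernel_joint U Y Q \<gamma> \<in> space (prob_algebra (borel_on (U \<times> Y)))"
    and "f \<in> borel_measurable (borel_on (U \<times> Y)) \<Longrightarrow> (\<And>u y. u \<in> U \<Longrightarrow> y \<in> Y \<Longrightarrow> \<bar>f (u, y)\<bar> \<le> B) \<Longrightarrow>
      (\<integral>z. f z \<partial>kernel_joint U Y Q \<gamma>) = (\<integral>y. \<integral>u. f (u, y) \<partial>\<gamma> y \<partial>Q)"
proof -
  have Qp: "prob_space Q" and Qs: "sets Q = sets (borel_on Y)" using Q by (auto simp: space_prob_algebra)
  interpret prob_space Q by fact
  have sp: "space Q = Y" using sets_eq_imp_space_eq[OF Qs] by (simp add: space_restrict_space)
  let ?D = "\<lambda>y. distr (\<gamma> y) (borel_on (U \<times> Y)) (\<lambda>u. (u, y))"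
  have pm: "case_prod (\<lambda>y u. (u, y)) \<in> borel_on Y \<Otimes>\<^sub>M borel_on U \<rightarrow>\<^sub>M borel_on (U \<times> Y)"
    using borel_on_prod_measurable[of Y U] by (simp add: case_prod_unfold)
  have "?D \<in> borel_on Y \<rightarrow>\<^sub>M prob_algebra (borel_on (U \<times> Y))"
    by (rule measurable_distr_prob_space2[OF g pm])
  then have D: "?D \<in> Q \<rightarrow>\<^sub>M prob_algebra (borel_on (U \<times> Y))"
    unfolding measurable_cong_sets[OF Qs refl] .
  show "kernel_joint U Y Q \<gamma> \<in> space (prob_algebra (borel_on (U \<times> Y)))"
    unfolding kernel_joint_def space_prob_algebra
    using prob_space_bind'[OF _ D, of Q] sets_bind'[OF _ D, of Q] Qp by (auto simp: space_prob_algebra)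
  assume f: "f \<in> borel_measurable (borel_on (U \<times> Y))" and B: "\<And>u y. u \<in> U \<Longrightarrow> y \<in> Y \<Longrightarrow> \<bar>f (u, y)\<bar> \<le> B"
  have "(\<integral>z. f z \<partial>kernel_joint U Y Q \<gamma>) = (\<integral>y. \<integral>z. f z \<partial>?D y \<partial>Q)"
    unfolding kernel_joint_def
  proof (rule integral_bind[OF f _ measurable_prob_algebraD[OF D], where B=B and B'=1])
    show "finite_measure Q" by unfold_locales
    show "AE y in Q. emeasure (?D y) (space (?D y)) \<le> ennreal 1"
      using kernelD(1)[OF D] by (intro AE_I2) (simp add: prob_space.measure_le_1)
  qed (use B in \<open>auto simp: space_restrict_space\<close>)
  also have "\<dots> = (\<integral>y. \<integral>u. f (u, y) \<partial>\<gamma> y \<partial>Q)"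
  proof (intro Bochner_Integration.integral_cong refl integral_distr[OF _ f])
    fix y assume y: "y \<in> space Q"
    then have yY: "y \<in> space (borel_on Y)" by (simp add: sp space_restrict_space)
    have "(\<lambda>u. (u, y)) \<in> borel_on U \<rightarrow>\<^sub>M borel_on (U \<times> Y)"
      using measurable_compose[OF measurable_Pair1'[OF yY, of "borel_on U"] pm] by simp
    then show "(\<lambda>u. (u, y)) \<in> \<gamma> y \<rightarrow>\<^sub>M borel_on (U \<times> Y)"
      unfolding measurable_cong_sets[OF kernelD(2)[OF g yY] refl] .
  qed
  finally show "(\<integral>z. f z \<partial>kernel_joint U Y Q \<gamma>) = (\<integral>y. \<integral>u. f (u, y) \<partial>\<gamma> y \<partial>Q)" .
qed

lemma borel_on_space [simp]: "space (borel_on X) = X"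
  by (simp add: space_restrict_space)

section \<open>Coordinates of the policies of one team\<close>

locale team =
  fixes U :: "'u::euclidean_space set" and Y :: "'y::euclidean_space set" and N :: nat and Q :: "nat \<Rightarrow> 'y measure"
  assumes U: "compact U" "U \<noteq> {}" and Y: "Y \<in> sets borel"
    and Q: "\<And>k. k < N \<Longrightarrow> Q k \<in> space (prob_algebra (borel_on Y))"
begin

text \<open>Fixed once by choice, so that \<open>coord\<close> can be a definition inside the
  locale; the partitions of unity are fixed in the same way by \<open>part\<close>.\<close>

definition obs_gen :: "nat \<Rightarrow> 'y set" where
  "obs_gen = (SOME obs_gen. Int_stable (range obs_gen) \<and> range obs_gen \<subseteq> Pow Y \<and> sets (borel_on Y) = sigma_sets Y (range obs_gen) \<and> Y \<in> range obs_gen)"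

lemma obs_gen: "Int_stable (range obs_gen)" "range obs_gen \<subseteq> Pow Y" "sets (borel_on Y) = sigma_sets Y (range obs_gen)" "Y \<in> range obs_gen"
proof -
  have "\<exists>obs_gen :: nat \<Rightarrow> 'y set. Int_stable (range obs_gen) \<and> range obs_gen \<subseteq> Pow Y \<and> sets (borel_on Y) = sigma_sets Y (range obs_gen) \<and> Y \<in> range obs_gen"
    using countable_Int_stable_generator[OF Y] by metis
  from someI_ex[OF this, folded obs_gen_def]
  show "Int_stable (range obs_gen)" "range obs_gen \<subseteq> Pow Y" "sets (borel_on Y) = sigma_sets Y (range obs_gen)" "Y \<in> range obs_gen" by auto
qed

lemma obs_gen_sets: "obs_gen i \<in> sets (borel_on Y)"
  unfolding obs_gen(3) by auto

definition is_partition :: "nat \<Rightarrow> nat \<times> (nat \<Rightarrow> 'u) \<times> (nat \<Rightarrow> 'u \<Rightarrow> real) \<Rightarrow> bool" where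
  "is_partition n = (\<lambda>(bump_count, bump_center, bump). (\<forall>j. continuous_on UNIV (bump j)) \<and> (\<forall>j u. bump j u \<in> {0..1}) \<and>
     (\<forall>u\<in>U. (\<Sum>j<bump_count. bump j u) = 1) \<and> (\<forall>j. bump_center j \<in> U) \<and> (\<forall>u j. bump j u \<noteq> 0 \<longrightarrow> dist u (bump_center j) < 1 / real (Suc n)))"

definition part :: "nat \<Rightarrow> nat \<times> (nat \<Rightarrow> 'u) \<times> (nat \<Rightarrow> 'u \<Rightarrow> real)" where
  "part n = (SOME P. is_partition n P)"

definition bump_count where "bump_count n = fst (part n)"
definition bump_center where "bump_center n = fst (snd (part n))"
definition bump where "bump n = snd (snd (part n))"

lemma bump: "continuous_on UNIV (bump n j)" "bump n j u \<in> {0..1}" "u \<in> U \<Longrightarrow> (\<Sum>j<bump_count n. bump n j u) = 1" "bump_center n j \<in> U"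
    "bump n j u \<noteq> 0 \<Longrightarrow> dist u (bump_center n j) < 1 / real (Suc n)"
proof -
  have "\<exists>P. is_partition n P"
  proof (rule compact_partition_of_unity[OF U, of "1 / real (Suc n)"])
    fix bump_count :: nat and bump_center and bump :: "nat \<Rightarrow> 'u \<Rightarrow> real"
    assume "\<And>j. continuous_on UNIV (bump j)" "\<And>j u. bump j u \<in> {0..1}" "\<And>u. u \<in> U \<Longrightarrow> (\<Sum>j<bump_count. bump j u) = 1" "\<And>j. bump_center j \<in> U"
      "\<And>u j. bump j u \<noteq> 0 \<Longrightarrow> dist u (bump_center j) < 1 / real (Suc n)"
    then show "\<exists>P. is_partition n P" by (intro exI[of _ "(bump_count, bump_center, bump)"]) (simp add: is_partition_def)
  qed simp
  from someI_ex[OF this, folded part_def]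
  show "continuous_on UNIV (bump n j)" "bump n j u \<in> {0..1}" "u \<in> U \<Longrightarrow> (\<Sum>j<bump_count n. bump n j u) = 1" "bump_center n j \<in> U"
    "bump n j u \<noteq> 0 \<Longrightarrow> dist u (bump_center n j) < 1 / real (Suc n)"
    by (auto simp: is_partition_def bump_count_def bump_center_def bump_def case_prod_unfold)
qed

text \<open>The supports of the bumps shrink with the level, so a bump that is nonzero at
  \<open>s i\<close> has its center close to \<open>s i\<close>. For a single action this is the
  hypothesis \<open>near\<close> of \<open>young_convergence\<close>.\<close>

lemma partition_points_lim:
  assumes M: "strict_mono (M :: nat \<Rightarrow> nat)" and h: "\<And>i. bump (M i) (h i) (s i) \<noteq> 0" and s: "s \<longlonglongrightarrow> s0"
  shows "(\<lambda>i. bump_center (M i) (h i)) \<longlonglongrightarrow> s0"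
proof (rule Lim_transform2[OF s])
  show "(\<lambda>i. s i - bump_center (M i) (h i)) \<longlonglongrightarrow> 0"
  proof (rule Lim_null_comparison[OF always_eventually])
    show "\<forall>i. norm (s i - bump_center (M i) (h i)) \<le> 1 / real (Suc (M i))"
      using bump(5)[OF h] by (auto simp: dist_norm less_imp_le)
    show "(\<lambda>i. 1 / real (Suc (M i))) \<longlonglongrightarrow> 0"
      using LIMSEQ_subseq_LIMSEQ[OF LIMSEQ_Suc[OF lim_1_over_n[where 'a=real]] M] by (simp add: o_def)
  qed
qed

lemma bump_measurable: "bump n j \<in> borel_measurable (borel_on U)"
  by (rule measurable_restrict_space1[OF borel_measurable_continuous_onI[OF bump(1)]])

lemma bump_abs: "\<bar>bump n j u\<bar> \<le> 1"
  using bump(2)[of n j u] by auto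

abbreviation \<Gamma> :: "(nat \<Rightarrow> ('u \<times> 'y) measure) set" where
  "\<Gamma> \<equiv> \<Pi>\<^sub>E k\<in>{..<N}. policies U Y (Q k)"

definition ker :: "nat \<Rightarrow> (nat \<Rightarrow> ('u \<times> 'y) measure) \<Rightarrow> 'y \<Rightarrow> 'u measure" where
  "ker k g = policy_kernel U Y (Q k) (g k)"

text \<open>The coordinates of a team policy in the Hilbert cube. They determine the topology and the cost, so
  that the closed set \<open>coord ` \<Gamma>\<close> can replace the space of team policies. They do not depend on the
  choice of the representing kernels.\<close>

definition coord :: "(nat \<Rightarrow> ('u \<times> 'y) measure) \<Rightarrow> nat \<times> nat \<times> nat \<times> nat \<Rightarrow> real" where
  "coord g = (\<lambda>(k, i, n, j). if k < N then \<integral>z. indicator (obs_gen i) (snd z) * bump n j (fst z) \<partial>g k else 0)"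

lemma Qk: "k < N \<Longrightarrow> prob_space (Q k)" "k < N \<Longrightarrow> sets (Q k) = sets (borel_on Y)" "k < N \<Longrightarrow> space (Q k) = Y"
  using Q[of k] sets_eq_imp_space_eq[of "Q k" "borel_on Y"] by (auto simp: space_prob_algebra)

lemma ker:
  assumes "g \<in> \<Gamma>" "k < N"
  shows "ker k g \<in> borel_on Y \<rightarrow>\<^sub>M prob_algebra (borel_on U)" "kernel_joint U Y (Q k) (ker k g) = g k"
proof -
  have "g k \<in> policies U Y (Q k)" using assms by auto
  then have "\<exists>\<gamma>. \<gamma> \<in> borel_on Y \<rightarrow>\<^sub>M prob_algebra (borel_on U) \<and> kernel_joint U Y (Q k) \<gamma> = g k"
    by (auto simp: policies_def)
  from someI_ex[OF this, folded policy_kernel_def ker_def]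
  show "ker k g \<in> borel_on Y \<rightarrow>\<^sub>M prob_algebra (borel_on U)" "kernel_joint U Y (Q k) (ker k g) = g k"
    unfolding ker_def by auto
qed

lemma kerQ: "g \<in> \<Gamma> \<Longrightarrow> k < N \<Longrightarrow> ker k g \<in> Q k \<rightarrow>\<^sub>M prob_algebra (borel_on U)"
  using ker(1)[of g k] by (simp add: measurable_cong_sets[OF Qk(2) refl])

definition action_mean :: "nat \<Rightarrow> nat \<Rightarrow> ('y \<Rightarrow> 'u measure) \<Rightarrow> 'y \<Rightarrow> real" where
  "action_mean n j \<gamma> y = (\<integral>u. bump n j u \<partial>\<gamma> y)"

lemma action_mean:
  assumes "k < N" "\<gamma> \<in> Q k \<rightarrow>\<^sub>M prob_algebra (borel_on U)"
  shows "action_mean n j \<gamma> \<in> borel_measurable (Q k)" "y \<in> space (Q k) \<Longrightarrow> action_mean n j \<gamma> y \<in> {0..1}"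
proof -
  show "action_mean n j \<gamma> \<in> borel_measurable (Q k)"
    unfolding action_mean_def[abs_def] by (rule kernel_integral_measurable[OF assms(2) bump_measurable])
  show "action_mean n j \<gamma> y \<in> {0..1}" if "y \<in> space (Q k)"
  proof -
    have "\<bar>action_mean n j \<gamma> y\<bar> \<le> 1"
      unfolding action_mean_def by (rule kernel_abs_integral_le[OF assms(2) that bump_measurable bump_abs])
    moreover have "0 \<le> action_mean n j \<gamma> y"
      unfolding action_mean_def by (intro integral_nonneg_AE AE_I2) (use bump(2) in auto)
    ultimately show ?thesis by auto
  qed
qed

lemma coord_integrand:
  "(\<lambda>z. indicator (obs_gen i) (snd z) * bump n j (fst z) :: real) \<in> borel_measurable (borel_on (U \<times> Y))"
  "\<bar>indicator (obs_gen i) (snd z) * bump n j (fst z)\<bar> \<le> 1"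
proof -
  have id: "(\<lambda>z. z) \<in> borel_on (U \<times> Y) \<rightarrow>\<^sub>M borel" by (rule measurable_restrict_space1) simp
  have 1: "fst \<in> borel_on (U \<times> Y) \<rightarrow>\<^sub>M borel" and 2: "snd \<in> borel_on (U \<times> Y) \<rightarrow>\<^sub>M borel"
    using measurable_compose[OF id borel_measurable_continuous_onI[OF continuous_on_fst[OF continuous_on_id]]]
      measurable_compose[OF id borel_measurable_continuous_onI[OF continuous_on_snd[OF continuous_on_id]]] by simp_all
  have Ab: "obs_gen i \<in> sets borel" using obs_gen_sets[of i] Y by (auto simp: sets_restrict_space)
  show "(\<lambda>z. indicator (obs_gen i) (snd z) * bump n j (fst z) :: real) \<in> borel_measurable (borel_on (U \<times> Y))"
    using measurable_compose[OF 2 borel_measurable_indicator[OF Ab]]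
      measurable_compose[OF 1 borel_measurable_continuous_onI[OF bump(1)]] by (rule borel_measurable_times)
  show "\<bar>indicator (obs_gen i) (snd z) * bump n j (fst z)\<bar> \<le> 1"
    using bump_abs[of n j "fst z"] by (auto split: split_indicator)
qed

lemma coord_kernel_joint:
  assumes "k < N" "\<gamma> \<in> borel_on Y \<rightarrow>\<^sub>M prob_algebra (borel_on U)" "g k = kernel_joint U Y (Q k) \<gamma>"
  shows "coord g (k, i, n, j) = (\<integral>y. indicator (obs_gen i) y * action_mean n j \<gamma> y \<partial>Q k)"
proof -
  have "coord g (k, i, n, j) = (\<integral>z. indicator (obs_gen i) (snd z) * bump n j (fst z) \<partial>kernel_joint U Y (Q k) \<gamma>)"
    using assms by (simp add: coord_def)
  also have "\<dots> = (\<integral>y. \<integral>u. indicator (obs_gen i) (snd (u, y)) * bump n j (fst (u, y)) \<partial>\<gamma> y \<partial>Q k)"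
    by (rule kernel_joint(2)[OF Q[OF assms(1)] assms(2) coord_integrand(1), where B=1]) (rule coord_integrand(2))
  finally show ?thesis by (simp add: action_mean_def)
qed

lemma coord_ker:
  assumes "g \<in> \<Gamma>" "k < N"
  shows "coord g (k, i, n, j) = (\<integral>y. indicator (obs_gen i) y * action_mean n j (ker k g) y \<partial>Q k)"
  by (rule coord_kernel_joint[OF assms(2)]) (simp_all add: ker[OF assms])

lemma coord_01:
  assumes "g \<in> \<Gamma>"
  shows "coord g c \<in> {0..1}"
proof (cases c)
  case (fields k i n j)
  show ?thesis
  proof (cases "k < N")
    case True
    interpret prob_space "Q k" by (rule Qk(1)[OF True])
    note am = action_mean[OF True kerQ[OF assms True], where n=n and j=j]
    have Ai: "obs_gen i \<in> sets (Q k)" using obs_gen_sets Qk(2)[OF True] by simp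
    have "\<bar>\<integral>y. indicator (obs_gen i) y * action_mean n j (ker k g) y \<partial>Q k\<bar> \<le> 1"
      using am Ai by (intro abs_integral_le) (auto simp: abs_mult split: split_indicator)
    moreover have "0 \<le> (\<integral>y. indicator (obs_gen i) y * action_mean n j (ker k g) y \<partial>Q k)"
      using am by (intro integral_nonneg_AE AE_I2) auto
    ultimately show ?thesis using coord_ker[OF assms True, of i n j] by (simp add: fields)
  qed (simp add: coord_def fields)
qed

text \<open>Convergence of coordinates is convergence of the action averages tested on a generating
  family of observation events; under the fixed marginal \<open>Q k\<close> this already amounts to
  weak-star convergence.\<close>

lemma weak_lim_action_mean:
  assumes g: "\<And>m. g m \<in> \<Gamma>" "g0 \<in> \<Gamma>" and lim: "\<And>c. (\<lambda>m. coord (g m) c) \<longlonglongrightarrow> coord g0 c" and k: "k < N"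
  shows "weak_lim (Q k) (\<lambda>m. action_mean n j (ker k (g m))) (action_mean n j (ker k g0))"
proof (rule weak_limI[where G="range obs_gen"])
  show "finite_measure (Q k)" using Qk(1)[OF k] by (simp add: prob_space_def)
  show "action_mean n j (ker k (g m)) \<in> borel_measurable (Q k)" "action_mean n j (ker k g0) \<in> borel_measurable (Q k)" for m
    by (intro action_mean[OF k] kerQ g k)+
  show "\<bar>action_mean n j (ker k (g m)) y\<bar> \<le> 1" "\<bar>action_mean n j (ker k g0) y\<bar> \<le> 1" if "y \<in> space (Q k)" for m y
    using action_mean(2)[OF k kerQ[OF g(1)[of m] k] that, where n=n and j=j] action_mean(2)[OF k kerQ[OF g(2) k] that, where n=n and j=j] by auto
  show "Int_stable (range obs_gen)" "range obs_gen \<subseteq> Pow (space (Q k))" "sets (Q k) = sigma_sets (space (Q k)) (range obs_gen)" "space (Q k) \<in> range obs_gen"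
    using obs_gen Qk(2,3)[OF k] by auto
  fix B assume "B \<in> range obs_gen"
  then obtain i where "B = obs_gen i" by auto
  then show "(\<lambda>m. \<integral>y. indicator B y * action_mean n j (ker k (g m)) y \<partial>Q k) \<longlonglongrightarrow> (\<integral>y. indicator B y * action_mean n j (ker k g0) y \<partial>Q k)"
    using lim[of "(k, i, n, j)"] by (simp add: coord_ker[OF g(1) k] coord_ker[OF g(2) k])
qed

lemma \<Gamma>_nonempty: "\<Gamma> \<noteq> {}"
proof -
  obtain u where u: "u \<in> U" using U by auto
  have "(\<lambda>_. return (borel_on U) u) \<in> borel_on Y \<rightarrow>\<^sub>M prob_algebra (borel_on U)"
    using u by (intro measurable_const) (auto simp: space_prob_algebra prob_space_return)
  then have "policies U Y (Q k) \<noteq> {}" for k by (auto simp: policies_def)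
  then show ?thesis by (simp add: PiE_eq_empty_iff)
qed

text \<open>The compactness of kernels is applied to each decision maker with a subsequence of its
  own. This is consistent because the coordinates converge along the full sequence, so any
  subsequence identifies their limit.\<close>

lemma closed_coord: "closed (coord ` \<Gamma>)"
  unfolding closed_sequential_limits
proof (intro allI impI)
  fix x l assume "(\<forall>m. x m \<in> coord ` \<Gamma>) \<and> x \<longlonglongrightarrow> l"
  then have "\<forall>m. \<exists>g\<in>\<Gamma>. x m = coord g" and l: "\<And>c. (\<lambda>m. x m c) \<longlonglongrightarrow> l c"
    by (auto simp: tendsto_fun_iff)
  then obtain g where g: "\<And>m. g m \<in> \<Gamma>" and x: "\<And>m. x m = coord (g m)" by metis
  have "\<exists>\<gamma>. \<gamma> \<in> borel_on Y \<rightarrow>\<^sub>M prob_algebra (borel_on U) \<and>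
      (\<forall>i n j. l (k, i, n, j) = (\<integral>y. indicator (obs_gen i) y * action_mean n j \<gamma> y \<partial>Q k))" if k: "k < N" for k
  proof -
    interpret prob_space "Q k" by (rule Qk(1)[OF k])
    have GA: "countable (range obs_gen)" "Int_stable (range obs_gen)" "range obs_gen \<subseteq> Pow (space (Q k))" "sets (Q k) = sigma_sets (space (Q k)) (range obs_gen)" "space (Q k) \<in> range obs_gen"
      using obs_gen Qk(2,3)[OF k] by auto
    obtain r \<gamma> where r: "strict_mono r" and \<gamma>: "\<gamma> \<in> Q k \<rightarrow>\<^sub>M prob_algebra (borel_on U)"
      and kl: "kernel_lim (Q k) (\<lambda>m. ker k (g (r m))) \<gamma>"
      by (rule kernel_compact[OF Qk(1)[OF k] U GA, of "\<lambda>m. ker k (g m)"]) (rule kerQ[OF g k])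
    have "l (k, i, n, j) = (\<integral>y. indicator (obs_gen i) y * action_mean n j \<gamma> y \<partial>Q k)" for i n j
    proof (rule LIMSEQ_unique)
      show "(\<lambda>m. x (r m) (k, i, n, j)) \<longlonglongrightarrow> l (k, i, n, j)"
        using LIMSEQ_subseq_LIMSEQ[OF l r] by (simp add: o_def)
      have "weak_lim (Q k) (\<lambda>m y. action_mean n j (ker k (g (r m))) y) (\<lambda>y. action_mean n j \<gamma> y)"
        using kl bump(1) bump_abs unfolding kernel_lim_def action_mean_def by simp
      moreover have "integrable (Q k) (indicator (obs_gen i) :: _ \<Rightarrow> real)"
        using obs_gen_sets Qk(2)[OF k] by (intro integrable_indicator_finite) simp
      ultimately show "(\<lambda>m. x (r m) (k, i, n, j)) \<longlonglongrightarrow> (\<integral>y. indicator (obs_gen i) y * action_mean n j \<gamma> y \<partial>Q k)"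
        unfolding x coord_ker[OF g k] by (rule weak_limD(5))
    qed
    then show ?thesis using \<gamma> by (auto simp: measurable_cong_sets[OF Qk(2)[OF k] refl])
  qed
  then obtain \<gamma> where \<gamma>: "\<And>k. k < N \<Longrightarrow> \<gamma> k \<in> borel_on Y \<rightarrow>\<^sub>M prob_algebra (borel_on U)"
    and l\<gamma>: "\<And>k i n j. k < N \<Longrightarrow> l (k, i, n, j) = (\<integral>y. indicator (obs_gen i) y * action_mean n j (\<gamma> k) y \<partial>Q k)"
    by metis
  define g0 where "g0 = (\<lambda>k\<in>{..<N}. kernel_joint U Y (Q k) (\<gamma> k))"
  have "g0 \<in> \<Gamma>" using \<gamma> by (auto simp: g0_def policies_def)
  moreover have "coord g0 = l"
  proof
    fix c :: "nat \<times> nat \<times> nat \<times> nat"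
    obtain k i n j where c: "c = (k, i, n, j)" by (metis prod.exhaust)
    show "coord g0 c = l c"
    proof (cases "k < N")
      case True
      then show ?thesis unfolding c l\<gamma>[OF True] by (intro coord_kernel_joint \<gamma>) (simp_all add: g0_def)
    next
      case False
      then have "(\<lambda>m. x m c) = (\<lambda>m. 0)" by (simp add: x coord_def c)
      then show ?thesis using l[of c] False by (simp add: LIMSEQ_const_iff coord_def c)
    qed
  qed
  ultimately show "l \<in> coord ` \<Gamma>" by auto
qed

text \<open>The coordinates test only indicators of observation events times bumps of actions;
  \<open>young_convergence\<close> extends this to every bounded continuous function of action and
  observation, that is, to weak convergence of each policy.\<close>

lemma coord_weak_lim:
  fixes f :: "'u \<times> 'y \<Rightarrow> real"
  assumes g: "\<And>m. g m \<in> \<Gamma>" "g0 \<in> \<Gamma>" and lim: "\<And>c. (\<lambda>m. coord (g m) c) \<longlonglongrightarrow> coord g0 c" and k: "k < N"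
    and f: "continuous_on (U \<times> Y) f" "bounded (f ` (U \<times> Y))"
  shows "(\<lambda>m. \<integral>z. f z \<partial>g m k) \<longlonglongrightarrow> (\<integral>z. f z \<partial>g0 k)"
proof -
  have UY: "U \<times> Y \<in> sets borel" using borel_compact[OF U(1)] Y by (rule borel_Times)
  have fm: "f \<in> borel_measurable (borel_on (U \<times> Y))"
    by (rule borel_measurable_continuous_on_restrict[OF f(1)])
  obtain B where "\<forall>x\<in>f ` (U \<times> Y). norm x \<le> B" using f(2) unfolding bounded_iff by blast
  then have B: "\<bar>f (u, y)\<bar> \<le> B" if "u \<in> U" "y \<in> Y" for u y using that by auto
  have eq: "(\<integral>z. f z \<partial>h k) = (\<integral>y. \<integral>u. f (u, y) \<partial>ker k h y \<partial>Q k)" if "h \<in> \<Gamma>" for h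
    using kernel_joint(2)[OF Q[OF k] ker(1)[OF that k] fm B] ker(2)[OF that k] by simp
  have "(\<lambda>m. \<integral>y. \<integral>u. (\<lambda>(y, u). f (u, y)) (y, u) \<partial>ker k (g m) y \<partial>Q k) \<longlonglongrightarrow> (\<integral>y. \<integral>u. (\<lambda>(y, u). f (u, y)) (y, u) \<partial>ker k g0 y \<partial>Q k)"
  proof (rule young_convergence[where AM="borel_on U" and C=B and V="\<lambda>n. {..<bump_count n}" and \<phi>=bump and pt=bump_center])
    show "prob_space (Q k)" by (rule Qk(1)[OF k])
    show "compact (space (borel_on U))" "space (borel_on U) \<noteq> {}" using U by auto
    have "(\<lambda>(y, u). f (u, y)) \<in> borel_measurable (borel_on Y \<Otimes>\<^sub>M borel_on U)"
      using measurable_compose[OF borel_on_prod_measurable fm] by (simp add: case_prod_unfold)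
    then show "(\<lambda>(y, u). f (u, y)) \<in> borel_measurable (Q k \<Otimes>\<^sub>M borel_on U)"
      by (simp add: measurable_cong_sets[OF sets_pair_measure_cong[OF Qk(2)[OF k] refl] refl])
    show "\<bar>(\<lambda>(y, u). f (u, y)) (y, u)\<bar> \<le> B" if "y \<in> space (Q k)" "u \<in> space (borel_on U)" for y u
      using B that Qk(3)[OF k] by auto
    show "continuous_on (space (borel_on U)) (\<lambda>u. (\<lambda>(y, u). f (u, y)) (y, u))" if "y \<in> space (Q k)" for y
      using that Qk(3)[OF k] by (auto intro!: continuous_on_compose2[OF f(1)] continuous_intros)
    show "ker k (g m) \<in> Q k \<rightarrow>\<^sub>M prob_algebra (borel_on U)" "ker k g0 \<in> Q k \<rightarrow>\<^sub>M prob_algebra (borel_on U)" for m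
      by (intro kerQ g k)+
    show "bump n j \<in> borel_measurable (borel_on U)" for n j by (rule bump_measurable)
    show "continuous_on (space (borel_on U)) (bump n j)" for n j by (rule continuous_on_subset[OF bump(1)]) simp
    show "bump n j u \<in> {0..1}" for n j u by (rule bump(2))
    show "(\<Sum>j<bump_count n. bump n j u) = 1" if "u \<in> space (borel_on U)" for n u using bump(3) that by simp
    show "bump_center n j \<in> space (borel_on U)" for n j using bump(4) by simp
    show "weak_lim (Q k) (\<lambda>m y. \<integral>u. bump n j u \<partial>ker k (g m) y) (\<lambda>y. \<integral>u. bump n j u \<partial>ker k g0 y)" for n j
      using weak_lim_action_mean[OF g lim k, of n j] by (simp add: action_mean_def[abs_def])
    show "(\<lambda>i. bump_center (M i) (h i)) \<longlonglongrightarrow> s0"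
      if "strict_mono M" "\<And>i. bump (M i) (h i) (s i) \<noteq> 0" "s \<longlonglongrightarrow> s0" for M h s s0
      by (rule partition_points_lim[OF that(1,2,3)])
  qed auto
  then show ?thesis by (simp add: eq[OF g(1)] eq[OF g(2)])
qed

lemma policies_subset: "k < N \<Longrightarrow> policies U Y (Q k) \<subseteq> space (prob_algebra (borel_on (U \<times> Y)))"
  using kernel_joint(1)[OF Q] by (auto simp: policies_def)

lemma topspace_policy_top: "k < N \<Longrightarrow> topspace (policy_top U Y (Q k)) = policies U Y (Q k)"
  using policies_subset[of k] by (auto simp: policy_top_def)

lemma topspace_team_top: "topspace (team_top U Y N Q) = \<Gamma>"
  unfolding team_top_def topspace_product_topology by (intro PiE_cong) (simp add: topspace_policy_top)

lemma component_measurable: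
  assumes "k < N"
  shows "(\<lambda>g. g k) \<in> borel_of (team_top U Y N Q) \<rightarrow>\<^sub>M borel_of (policy_top U Y (Q k))"
  unfolding team_top_def
  using assms by (intro continuous_map_borel_of) (use continuous_map_product_projection[of k "{..<N}" "\<lambda>k. policy_top U Y (Q k)"] in simp)

lemma policy_measurable: "(\<lambda>m. m) \<in> borel_of (policy_top U Y (Q k)) \<rightarrow>\<^sub>M prob_algebra (borel_on (U \<times> Y))"
proof -
  have "continuous_map (policy_top U Y (Q k)) (weak_topology (U \<times> Y)) (\<lambda>m. m)"
    unfolding policy_top_def using continuous_map_from_subtopology[OF continuous_map_id] by (simp add: id_def)
  from measurable_compose[OF continuous_map_borel_of[OF this] measurable_borel_of_weak_topology]
  show ?thesis using borel_Times[OF borel_compact[OF U(1)] Y] by simp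
qed

text \<open>Indicators of observation events are not continuous, so measurability comes from
  evaluation of policies on Borel sets and not from the weak topology directly.\<close>

lemma coord_measurable: "coord \<in> borel_of (team_top U Y N Q) \<rightarrow>\<^sub>M borel"
proof (rule measurable_coordinatewise_then_product)
  fix c :: "nat \<times> nat \<times> nat \<times> nat"
  obtain k i n j where c: "c = (k, i, n, j)" by (metis prod.exhaust)
  show "(\<lambda>g. coord g c) \<in> borel_measurable (borel_of (team_top U Y N Q))"
  proof (cases "k < N")
    case True
    have "(\<lambda>g. g k) \<in> borel_of (team_top U Y N Q) \<rightarrow>\<^sub>M subprob_algebra (borel_on (U \<times> Y))"
      by (rule measurable_compose[OF component_measurable[OF True] measurable_prob_algebraD[OF policy_measurable]])
    from measurable_compose[OF this integral_measurable_subprob_algebra[OF coord_integrand(1)]]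
    show ?thesis using True by (simp add: coord_def c)
  qed (simp add: coord_def c)
qed

section \<open>Policies parametrized by coordinates, and their mixtures\<close>

text \<open>Any policy with the given coordinates would do, since policies with equal coordinates
  have equal costs (\<open>pure_cost_coord\<close>).\<close>

definition policy_of :: "(nat \<times> nat \<times> nat \<times> nat \<Rightarrow> real) \<Rightarrow> nat \<Rightarrow> ('u \<times> 'y) measure" where
  "policy_of = inv_into \<Gamma> coord"

lemma policy_of:
  assumes "x \<in> coord ` \<Gamma>"
  shows "policy_of x \<in> \<Gamma>" "coord (policy_of x) = x"
  unfolding policy_of_def by (rule inv_into_into[OF assms], rule f_inv_into_f[OF assms])

text \<open>The domain is metric, so continuity into the weak topology can be tested on sequences,
  integral by integral; there it is \<open>coord_weak_lim\<close>.\<close>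

lemma continuous_map_policy_of: "continuous_map (top_of_set (coord ` \<Gamma>)) (team_top U Y N Q) policy_of"
  unfolding team_top_def continuous_map_componentwise
proof (intro conjI ballI)
  show "policy_of ` topspace (top_of_set (coord ` \<Gamma>)) \<subseteq> extensional {..<N}"
    using policy_of(1) by (auto simp: PiE_def)
  fix k assume "k \<in> {..<N}"
  then have k: "k < N" by simp
  have "policy_of x k \<in> policies U Y (Q k)" if "x \<in> coord ` \<Gamma>" for x
    using policy_of(1)[OF that] k by auto
  moreover have "continuous_map (top_of_set (coord ` \<Gamma>)) (weak_topology (U \<times> Y)) (\<lambda>x. policy_of x k)"
  proof (rule continuous_map_into_weak_topology)
    show "policy_of x k \<in> space (prob_algebra (borel_on (U \<times> Y)))" if "x \<in> topspace (top_of_set (coord ` \<Gamma>))" for x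
      using policy_of(1)[of x] that k policies_subset[OF k] by auto
    fix f :: "'u \<times> 'y \<Rightarrow> real" assume f: "continuous_on (U \<times> Y) f" "bounded (f ` (U \<times> Y))"
    have "continuous_on (coord ` \<Gamma>) (\<lambda>x. \<integral>z. f z \<partial>policy_of x k)"
      unfolding continuous_on_sequentially
    proof (intro allI ballI impI, elim conjE)
      fix x a assume a: "a \<in> coord ` \<Gamma>" and x: "\<forall>n. x n \<in> coord ` \<Gamma>" "x \<longlonglongrightarrow> a"
      have "(\<lambda>m. \<integral>z. f z \<partial>policy_of (x m) k) \<longlonglongrightarrow> (\<integral>z. f z \<partial>policy_of a k)"
      proof (rule coord_weak_lim[OF _ _ _ k f])
        show "policy_of (x m) \<in> \<Gamma>" "policy_of a \<in> \<Gamma>" for m using a x policy_of(1) by auto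
        have "coord (policy_of (x m)) = x m" "coord (policy_of a) = a" for m using a x policy_of(2) by auto
        then show "(\<lambda>m. coord (policy_of (x m)) c) \<longlonglongrightarrow> coord (policy_of a) c" for c
          using x(2)[unfolded tendsto_fun_iff, rule_format, of c] by simp
      qed
      then show "((\<lambda>x. \<integral>z. f z \<partial>policy_of x k) \<circ> x) \<longlonglongrightarrow> (\<integral>z. f z \<partial>policy_of a k)" by (simp add: o_def)
    qed
    then show "continuous_map (top_of_set (coord ` \<Gamma>)) euclideanreal (\<lambda>x. \<integral>z. f z \<partial>policy_of x k)"
      by simp
  qed
  ultimately show "continuous_map (top_of_set (coord ` \<Gamma>)) (policy_top U Y (Q k)) (\<lambda>x. policy_of x k)"
    unfolding policy_top_def by (auto simp: continuous_map_in_subtopology)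
qed

text \<open>Law of the random team policy that arises when all members act on one common signal
  \<open>z\<close> drawn from \<open>\<eta>\<close>.\<close>

definition mixed :: "real measure \<Rightarrow> (real \<Rightarrow> nat \<times> nat \<times> nat \<times> nat \<Rightarrow> real) \<Rightarrow> (nat \<Rightarrow> ('u \<times> 'y) measure) measure" where
  "mixed \<eta> \<theta> = distr \<eta> (borel_of (team_top U Y N Q)) (\<lambda>z. policy_of (\<theta> z))"

lemma policy_of_measurable:
  assumes "\<theta> \<in> borel_on {0..1} \<rightarrow>\<^sub>M borel" "\<And>t. \<theta> t \<in> coord ` \<Gamma>"
  shows "(\<lambda>z. policy_of (\<theta> z)) \<in> borel_on {0..1} \<rightarrow>\<^sub>M borel_of (team_top U Y N Q)"
proof (rule measurable_compose[OF _ continuous_map_borel_on[OF continuous_map_policy_of]])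
  show "\<theta> \<in> borel_on {0..1} \<rightarrow>\<^sub>M borel_on (coord ` \<Gamma>)"
    by (rule measurable_restrict_space2) (use assms in auto)
qed

lemma mixed_L_CO:
  assumes \<eta>: "\<eta> \<in> space (prob_algebra (borel_on {0..1}))"
    and \<theta>: "\<theta> \<in> borel_on {0..1} \<rightarrow>\<^sub>M borel" "\<And>t. \<theta> t \<in> coord ` \<Gamma>"
  shows "mixed \<eta> \<theta> \<in> L_CO U Y N Q"
proof -
  have \<eta>s: "sets \<eta> = sets (borel_on {0..1})" and \<eta>bump: "prob_space \<eta>" using \<eta> by (auto simp: space_prob_algebra)
  have m: "(\<lambda>z. policy_of (\<theta> z)) \<in> \<eta> \<rightarrow>\<^sub>M borel_of (team_top U Y N Q)"
    using policy_of_measurable[OF \<theta>] by (simp add: measurable_cong_sets[OF \<eta>s refl])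
  have mix: "mixed \<eta> \<theta> \<in> L_team U Y N Q"
    using prob_space.prob_space_distr[OF \<eta>bump m] by (simp add: mixed_def L_team_def space_prob_algebra)
  define K where "K k z = return (borel_of (policy_top U Y (Q k))) (policy_of (\<theta> z) k)" for k z
  have mk: "(\<lambda>z. policy_of (\<theta> z) k) \<in> borel_on {0..1} \<rightarrow>\<^sub>M borel_of (policy_top U Y (Q k))" if "k < N" for k
    using measurable_compose[OF policy_of_measurable[OF \<theta>] component_measurable[OF that]] .
  have K: "K k \<in> borel_on {0..1} \<rightarrow>\<^sub>M prob_algebra (borel_of (policy_top U Y (Q k)))" if "k < N" for k
    using measurable_compose[OF mk[OF that] measurable_return_prob_space] unfolding K_def[abs_def] .
  have "emeasure (mixed \<eta> \<theta>) (\<Pi>\<^sub>E k\<in>{..<N}. B k) = (\<integral>\<^sup>+z. (\<Prod>k<N. emeasure (K k z) (B k)) \<partial>\<eta>)"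
    if B: "\<forall>k<N. B k \<in> sets (borel_of (policy_top U Y (Q k)))" for B
  proof -
    \<comment> \<open>Boxes are Borel in the product topology because the projections are
      continuous; writing the box as a finite intersection of preimages makes this
      applicable.\<close>
    have sub: "(\<Pi>\<^sub>E k\<in>{..<N}. B k) = {g \<in> space (borel_of (team_top U Y N Q)). \<forall>k\<in>{..<N}. g k \<in> B k}"
    proof -
      have "B k \<subseteq> policies U Y (Q k)" if "k < N" for k
        using sets.sets_into_space[OF B[rule_format, OF that]] topspace_policy_top[OF that] by simp
      then have "(\<Pi>\<^sub>E k\<in>{..<N}. B k) \<subseteq> \<Gamma>" by (intro PiE_mono) simp
      then show ?thesis
        unfolding space_borel_of topspace_team_top by (auto intro: PiE_mem PiE_I PiE_arb)
    qed
    have Bm: "(\<Pi>\<^sub>E k\<in>{..<N}. B k) \<in> sets (borel_of (team_top U Y N Q))"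
      unfolding sub
    proof (rule sets.sets_Collect_finite_All)
      show "{g \<in> space (borel_of (team_top U Y N Q)). g k \<in> B k} \<in> sets (borel_of (team_top U Y N Q))" if "k \<in> {..<N}" for k
      proof -
        have "(\<lambda>g. g k) -` B k \<inter> space (borel_of (team_top U Y N Q)) \<in> sets (borel_of (team_top U Y N Q))"
          by (rule measurable_sets[OF component_measurable]) (use that B in auto)
        moreover have "(\<lambda>g. g k) -` B k \<inter> space (borel_of (team_top U Y N Q)) = {g \<in> space (borel_of (team_top U Y N Q)). g k \<in> B k}"
          by blast
        ultimately show ?thesis by simp
      qed
    qed auto
    have "emeasure (mixed \<eta> \<theta>) (\<Pi>\<^sub>E k\<in>{..<N}. B k) = (\<integral>\<^sup>+g. indicator (\<Pi>\<^sub>E k\<in>{..<N}. B k) g \<partial>mixed \<eta> \<theta>)"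
      using Bm by (simp add: mixed_def)
    also have "\<dots> = (\<integral>\<^sup>+z. indicator (\<Pi>\<^sub>E k\<in>{..<N}. B k) (policy_of (\<theta> z)) \<partial>\<eta>)"
      unfolding mixed_def by (rule nn_integral_distr[OF m]) (use Bm in simp)
    also have "\<dots> = (\<integral>\<^sup>+z. (\<Prod>k<N. emeasure (K k z) (B k)) \<partial>\<eta>)"
    proof (rule nn_integral_cong)
      fix z
      have "policy_of (\<theta> z) \<in> \<Gamma>" by (rule policy_of(1)[OF \<theta>(2)])
      then have "indicator (\<Pi>\<^sub>E k\<in>{..<N}. B k) (policy_of (\<theta> z)) = (\<Prod>k<N. indicator (B k) (policy_of (\<theta> z) k) :: ennreal)"
        by (auto simp: indicator_def PiE_iff)
      then show "indicator (\<Pi>\<^sub>E k\<in>{..<N}. B k) (policy_of (\<theta> z)) = (\<Prod>k<N. emeasure (K k z) (B k))"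
        using B by (simp add: K_def)
    qed
    finally show ?thesis .
  qed
  then show ?thesis unfolding L_CO_def using mix \<eta> K by blast
qed

end

section \<open>Team actions and densities\<close>

text \<open>\<open>product_prob_space\<close> asks for a probability measure at every index, whereas
  here the factors are probability measures on \<open>I\<close> only. Filling the other indices with
  a point mass leaves the product unchanged.\<close>

lemma PiM_prob_extension:
  assumes "\<And>i. i \<in> I \<Longrightarrow> prob_space (M i)"
  obtains M' where "\<And>i. prob_space (M' i)" "\<And>i. i \<in> I \<Longrightarrow> M' i = M i" "PiM I M = PiM I M'"
proof (rule that)
  let ?M' = "\<lambda>i. if i \<in> I then M i else return (count_space UNIV) undefined"
  show "prob_space (?M' i)" for i using assms by (auto intro: prob_space_return)
  show "PiM I M = PiM I ?M'" by (rule PiM_cong) auto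
qed auto

lemma product_prob_space_of_prob: "(\<And>i. prob_space (M i)) \<Longrightarrow> product_prob_space M"
  by (auto simp: product_prob_space_def product_sigma_finite_def product_prob_space_axioms_def prob_space_imp_sigma_finite)

lemma emeasure_PiM_prob:
  assumes "finite I" "\<And>i. i \<in> I \<Longrightarrow> prob_space (M i)" "\<And>i. i \<in> I \<Longrightarrow> A i \<in> sets (M i)"
  shows "emeasure (PiM I M) (PiE I A) = (\<Prod>i\<in>I. emeasure (M i) (A i))"
proof -
  obtain M' where M': "\<And>i. prob_space (M' i)" "\<And>i. i \<in> I \<Longrightarrow> M' i = M i" "PiM I M = PiM I M'"
    using PiM_prob_extension[of I M] assms(2) by metis
  interpret product_prob_space M' by (rule product_prob_space_of_prob[OF M'(1)])
  show ?thesis unfolding M'(3) using emeasure_PiM[OF assms(1), of A] assms(3) M'(2) by simp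
qed

lemma integral_PiM_prod_prob:
  fixes f :: "'i \<Rightarrow> 'a \<Rightarrow> real"
  assumes "finite I" "\<And>i. i \<in> I \<Longrightarrow> prob_space (M i)" "\<And>i. i \<in> I \<Longrightarrow> integrable (M i) (f i)"
  shows "(\<integral>x. (\<Prod>i\<in>I. f i (x i)) \<partial>PiM I M) = (\<Prod>i\<in>I. \<integral>x. f i x \<partial>M i)"
proof -
  obtain M' where M': "\<And>i. prob_space (M' i)" "\<And>i. i \<in> I \<Longrightarrow> M' i = M i" "PiM I M = PiM I M'"
    using PiM_prob_extension[of I M] assms(2) by metis
  interpret product_prob_space M' by (rule product_prob_space_of_prob[OF M'(1)])
  show ?thesis unfolding M'(3) using product_integral_prod[OF assms(1), of f] assms(3) M'(2) by simp
qed

lemma weak_lim_PiM_prob: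
  assumes "finite I" "\<And>i. i \<in> I \<Longrightarrow> prob_space (M i)" "\<And>i. i \<in> I \<Longrightarrow> weak_lim (M i) (r i) (r0 i)"
  shows "weak_lim (PiM I M) (\<lambda>n x. \<Prod>i\<in>I. r i n (x i)) (\<lambda>x. \<Prod>i\<in>I. r0 i (x i))"
proof -
  obtain M' where M': "\<And>i. prob_space (M' i)" "\<And>i. i \<in> I \<Longrightarrow> M' i = M i" "PiM I M = PiM I M'"
    using PiM_prob_extension[of I M] assms(2) by metis
  show ?thesis unfolding M'(3) using assms(3) M'(2) by (intro weak_lim_PiM[OF assms(1) M'(1)]) simp
qed

section \<open>Density of the joint law of state and observations\<close>

text \<open>The density moves into the test function: integrability of \<open>f\<close> under the
  weighted measure is integrability of \<open>D * f\<close> under \<open>M\<close>. This is how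
  absolute continuity enters the convergence of costs.\<close>

lemma weak_lim_density:
  assumes r: "weak_lim M r r0" and D: "D \<in> borel_measurable M" "\<And>x. x \<in> space M \<Longrightarrow> 0 \<le> D x"
  shows "weak_lim (density M (\<lambda>x. ennreal (D x))) r r0"
  unfolding weak_lim_def
proof (intro conjI allI ballI impI)
  have Dn: "AE x in M. 0 \<le> D x" using D(2) by (rule AE_I2)
  note m = weak_limD(1,2)[OF r]
  show "r n \<in> borel_measurable (density M (\<lambda>x. ennreal (D x)))" "r0 \<in> borel_measurable (density M (\<lambda>x. ennreal (D x)))" for n
    using m by auto
  show "\<bar>r n x\<bar> \<le> 1" "\<bar>r0 x\<bar> \<le> 1" if "x \<in> space (density M (\<lambda>x. ennreal (D x)))" for n x
    using weak_limD(3,4)[OF r] that by auto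
  fix f :: "'a \<Rightarrow> real" assume f: "integrable (density M (\<lambda>x. ennreal (D x))) f"
  then have fm: "f \<in> borel_measurable M" by auto
  have fD: "integrable M (\<lambda>x. D x * f x)" using f integrable_density[OF fm D(1) Dn] by simp
  have eq: "(\<integral>x. f x * h x \<partial>density M (\<lambda>x. ennreal (D x))) = (\<integral>x. (D x * f x) * h x \<partial>M)" if "h \<in> borel_measurable M" for h
    using integral_density[OF borel_measurable_times[OF fm that] D(1) Dn] by (simp add: mult.assoc)
  show "(\<lambda>n. \<integral>x. f x * r n x \<partial>density M (\<lambda>x. ennreal (D x))) \<longlonglongrightarrow> (\<integral>x. f x * r0 x \<partial>density M (\<lambda>x. ennreal (D x)))"
    unfolding eq[OF m(1)] eq[OF m(2)] by (rule weak_limD(5)[OF r fD])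
qed

text \<open>For almost every \<open>w\<close> the density formula is known on a generator. For each
  such \<open>w\<close>, uniqueness of measures extends it to all events, and integrating over
  \<open>L\<close> compares \<open>\<mu>\<close> with the density measure on rectangles.\<close>

lemma joint_law_density:
  assumes L: "prob_space L" and R: "prob_space R"
    and \<mu>: "finite_measure \<mu>" "sets \<mu> = sets (L \<Otimes>\<^sub>M R)"
    and \<kappa>: "\<And>w. w \<in> space L \<Longrightarrow> sets (\<kappa> w) = sets R" "\<And>w. w \<in> space L \<Longrightarrow> prob_space (\<kappa> w)"
    and D: "D \<in> borel_measurable (L \<Otimes>\<^sub>M R)"
    and cond: "\<And>A B. A \<in> sets L \<Longrightarrow> B \<in> sets R \<Longrightarrow> emeasure \<mu> (A \<times> B) = (\<integral>\<^sup>+w\<in>A. emeasure (\<kappa> w) B \<partial>L)"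
    and G: "Int_stable G" "G \<subseteq> Pow (space R)" "sets R = sigma_sets (space R) G" "space R \<in> G"
    and dens: "AE w in L. \<forall>B\<in>G. emeasure (\<kappa> w) B = (\<integral>\<^sup>+z\<in>B. D (w, z) \<partial>R)"
  shows "\<mu> = density (L \<Otimes>\<^sub>M R) D"
proof -
  interpret L: prob_space L by fact
  interpret R: prob_space R by fact
  interpret \<mu>: finite_measure \<mu> by fact
  have Dw: "(\<lambda>z. D (w, z)) \<in> borel_measurable R" if "w \<in> space L" for w
    using measurable_compose[OF measurable_Pair1'[OF that, of R] D] .
  have AEk: "AE w in L. \<forall>B\<in>sets R. emeasure (\<kappa> w) B = (\<integral>\<^sup>+z\<in>B. D (w, z) \<partial>R)"
    using dens AE_space
  proof eventually_elim
    case (elim w)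
    have "\<kappa> w = density R (\<lambda>z. D (w, z))"
    proof (rule measure_eqI_generator_eq[OF G(1,2), where A="\<lambda>_. space R"])
      fix X assume X: "X \<in> G"
      then have "X \<in> sets R" using G(3) by auto
      then show "emeasure (\<kappa> w) X = emeasure (density R (\<lambda>z. D (w, z))) X"
        using elim X Dw by (simp add: emeasure_density)
    next
      show "emeasure (\<kappa> w) (space R) \<noteq> \<infinity>" for i :: nat
        using finite_measure.emeasure_finite[of "\<kappa> w"] \<kappa>(2)[OF elim(2)] by (auto simp: prob_space_def)
    qed (use G \<kappa>(1)[OF elim(2)] in auto)
    then show ?case using Dw[OF elim(2)] by (simp add: emeasure_density)
  qed
  show ?thesis
  proof (rule measure_eqI_generator_eq[OF Int_stable_pair_measure_generator[of L R], where A="\<lambda>_. space L \<times> space R"])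
    show "{a \<times> b |a b. a \<in> sets L \<and> b \<in> sets R} \<subseteq> Pow (space L \<times> space R)"
      by (auto dest: sets.sets_into_space)
    show "sets \<mu> = sigma_sets (space L \<times> space R) {a \<times> b |a b. a \<in> sets L \<and> b \<in> sets R}"
      "sets (density (L \<Otimes>\<^sub>M R) D) = sigma_sets (space L \<times> space R) {a \<times> b |a b. a \<in> sets L \<and> b \<in> sets R}"
      by (simp_all add: \<mu>(2) sets_pair_measure)
    show "range (\<lambda>_::nat. space L \<times> space R) \<subseteq> {a \<times> b |a b. a \<in> sets L \<and> b \<in> sets R}" by auto
    show "emeasure \<mu> (space L \<times> space R) \<noteq> \<infinity>" for i :: nat by simp
    fix X assume "X \<in> {a \<times> b |a b. a \<in> sets L \<and> b \<in> sets R}"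
    then obtain a b where X: "X = a \<times> b" and a: "a \<in> sets L" and b: "b \<in> sets R" by auto
    have m: "(\<lambda>x. D x * indicator X x) \<in> borel_measurable (L \<Otimes>\<^sub>M R)"
      unfolding X using D a b by measurable
    have "emeasure (density (L \<Otimes>\<^sub>M R) D) X = (\<integral>\<^sup>+x. D x * indicator X x \<partial>(L \<Otimes>\<^sub>M R))"
      unfolding X using a b D by (intro emeasure_density) auto
    also have "\<dots> = (\<integral>\<^sup>+w. \<integral>\<^sup>+z. D (w, z) * indicator X (w, z) \<partial>R \<partial>L)"
      by (rule R.nn_integral_fst[symmetric, OF m])
    also have "\<dots> = (\<integral>\<^sup>+w. (\<integral>\<^sup>+z\<in>b. D (w, z) \<partial>R) * indicator a w \<partial>L)"
      by (intro nn_integral_cong) (auto simp: X indicator_times split: split_indicator)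
    also have "\<dots> = (\<integral>\<^sup>+w\<in>a. emeasure (\<kappa> w) b \<partial>L)"
      using AEk b by (intro nn_integral_cong_AE) (auto elim!: eventually_mono)
    also have "\<dots> = emeasure \<mu> X" unfolding X by (rule cond[OF a b, symmetric])
    finally show "emeasure \<mu> X = emeasure (density (L \<Otimes>\<^sub>M R) D) X" ..
  qed auto
qed

text \<open>These are the boxes on which absolute continuity is formulated. Being stable under
  intersection and generating, they determine the law of all observations.\<close>

lemma pair_PiM_generator:
  fixes M1 :: "'i \<Rightarrow> 'a measure" and M2 :: "'j \<Rightarrow> 'b measure"
  assumes "finite I" "finite I'"
  defines "G \<equiv> {PiE I B1 \<times> PiE I' B2 | B1 B2. (\<forall>i\<in>I. B1 i \<in> sets (M1 i)) \<and> (\<forall>i\<in>I'. B2 i \<in> sets (M2 i))}"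
  shows "Int_stable G" "G \<subseteq> Pow (space (PiM I M1 \<Otimes>\<^sub>M PiM I' M2))"
    "sets (PiM I M1 \<Otimes>\<^sub>M PiM I' M2) = sigma_sets (space (PiM I M1 \<Otimes>\<^sub>M PiM I' M2)) G" "space (PiM I M1 \<Otimes>\<^sub>M PiM I' M2) \<in> G"
proof -
  have G: "G = {a \<times> b | a b. a \<in> prod_algebra I M1 \<and> b \<in> prod_algebra I' M2}"
    unfolding G_def prod_algebra_eq_finite[OF assms(1)] prod_algebra_eq_finite[OF assms(2)]
    by (rule set_eqI, simp only: mem_Collect_eq Pi_iff, blast)
  show "Int_stable G"
    unfolding Int_stable_def G
  proof safe
    fix a b a' b' assume "a \<in> prod_algebra I M1" "a' \<in> prod_algebra I M1" "b \<in> prod_algebra I' M2" "b' \<in> prod_algebra I' M2"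
    then show "\<exists>c d. a \<times> b \<inter> a' \<times> b' = c \<times> d \<and> c \<in> prod_algebra I M1 \<and> d \<in> prod_algebra I' M2"
      by (intro exI[of _ "a \<inter> a'"] exI[of _ "b \<inter> b'"]) (auto intro: Int_stableD[OF Int_stable_prod_algebra])
  qed
  have p1: "prod_algebra I M1 \<subseteq> Pow (space (PiM I M1))" and p2: "prod_algebra I' M2 \<subseteq> Pow (space (PiM I' M2))"
    unfolding space_PiM by (rule prod_algebra_sets_into_space)+
  then show sub: "G \<subseteq> Pow (space (PiM I M1 \<Otimes>\<^sub>M PiM I' M2))" unfolding G by (auto simp: space_pair_measure)
  have s1: "space (PiM I M1) \<in> prod_algebra I M1" and s2: "space (PiM I' M2) \<in> prod_algebra I' M2"
    unfolding space_PiM prod_algebra_eq_finite[OF assms(1)] prod_algebra_eq_finite[OF assms(2)] by auto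
  then show "space (PiM I M1 \<Otimes>\<^sub>M PiM I' M2) \<in> G" unfolding G space_pair_measure by blast
  have "sets (PiM I M1 \<Otimes>\<^sub>M PiM I' M2) = sets (sigma (space (PiM I M1) \<times> space (PiM I' M2)) {a \<times> b |a b. a \<in> prod_algebra I M1 \<and> b \<in> prod_algebra I' M2})"
    by (rule sets_pair_eq[where Ca="{space (PiM I M1)}" and Cb="{space (PiM I' M2)}"])
      (use p1 p2 s1 s2 in \<open>auto simp: sets_PiM space_PiM\<close>)
  also have "\<dots> = sigma_sets (space (PiM I M1 \<Otimes>\<^sub>M PiM I' M2)) G"
    using sub unfolding G by (subst sets_measure_of) (auto simp: space_pair_measure)
  finally show "sets (PiM I M1 \<Otimes>\<^sub>M PiM I' M2) = sigma_sets (space (PiM I M1 \<Otimes>\<^sub>M PiM I' M2)) G" .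
qed

section \<open>Joint actions of a team\<close>

context team
begin

lemma team_actions_eq: "team_actions U Y N Q g y = (\<Pi>\<^sub>M k\<in>{..<N}. ker k g (y k))"
  by (simp add: team_actions_def ker_def)

lemma team_actions_measurable:
  assumes g: "g \<in> \<Gamma>"
  shows "team_actions U Y N Q g \<in> borel_vec N Y \<rightarrow>\<^sub>M prob_algebra (borel_vec N U)"
proof (rule measurable_prob_algebra_generated[where \<Omega>="\<Pi>\<^sub>E k\<in>{..<N}. U" and G="prod_algebra {..<N} (\<lambda>_. borel_on U)"])
  show "sets (borel_vec N U) = sigma_sets (\<Pi>\<^sub>E k\<in>{..<N}. U) (prod_algebra {..<N} (\<lambda>_. borel_on U))"
    by (simp add: sets_PiM)
  show "Int_stable (prod_algebra {..<N} (\<lambda>_. borel_on U))" by (rule Int_stable_prod_algebra)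
  show "prod_algebra {..<N} (\<lambda>_. borel_on U) \<subseteq> Pow (\<Pi>\<^sub>E k\<in>{..<N}. U)"
    using prod_algebra_sets_into_space[of "{..<N}" "\<lambda>_. borel_on U"] by simp
  have yk: "y k \<in> space (borel_on Y)" if "y \<in> space (borel_vec N Y)" "k < N" for y k
    using that by (auto simp: space_PiM PiE_iff)
  have kp: "prob_space (ker k g (y k))" "sets (ker k g (y k)) = sets (borel_on U)" if "y \<in> space (borel_vec N Y)" "k < N" for y k
    using kernelD[OF ker(1)[OF g that(2)] yk[OF that]] by auto
  show "prob_space (team_actions U Y N Q g y)" if "y \<in> space (borel_vec N Y)" for y
    unfolding team_actions_eq by (rule prob_space_PiM) (use kp(1)[OF that] in auto)
  show "sets (team_actions U Y N Q g y) = sets (borel_vec N U)" if "y \<in> space (borel_vec N Y)" for y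
    unfolding team_actions_eq by (rule sets_PiM_cong) (use kp(2)[OF that] in auto)
  fix B assume "B \<in> prod_algebra {..<N} (\<lambda>_. borel_on U)"
  then obtain E where B: "B = PiE {..<N} E" and E: "\<And>k. k < N \<Longrightarrow> E k \<in> sets (borel_on U)"
    by (auto simp: prod_algebra_eq_finite)
  have "emeasure (team_actions U Y N Q g y) B = (\<Prod>k<N. emeasure (ker k g (y k)) (E k))" if "y \<in> space (borel_vec N Y)" for y
    unfolding team_actions_eq B by (rule emeasure_PiM_prob) (use kp[OF that] E in auto)
  moreover have "(\<lambda>y. \<Prod>k<N. emeasure (ker k g (y k)) (E k)) \<in> borel_measurable (borel_vec N Y)"
  proof (rule borel_measurable_prod_ennreal)
    fix k assume "k \<in> {..<N}"
    then have k: "k < N" by simp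
    have "(\<lambda>y. ker k g (y k)) \<in> borel_vec N Y \<rightarrow>\<^sub>M subprob_algebra (borel_on U)"
    proof (rule measurable_compose[OF _ measurable_prob_algebraD[OF ker(1)[OF g k]]])
      show "(\<lambda>y. y k) \<in> borel_vec N Y \<rightarrow>\<^sub>M borel_on Y" using k by (intro measurable_component_singleton) simp
    qed
    from measurable_compose[OF this measurable_emeasure_subprob_algebra[OF E[OF k]]]
    show "(\<lambda>y. emeasure (ker k g (y k)) (E k)) \<in> borel_measurable (borel_vec N Y)" .
  qed
  ultimately show "(\<lambda>y. emeasure (team_actions U Y N Q g y) B) \<in> borel_measurable (borel_vec N Y)"
    by (subst measurable_cong) assumption+
qed

text \<open>Products of the members' partitions of unity. By distributivity they form a partition of
  unity on the joint actions, and under independent kernels their integrals factor over the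
  members.\<close>

definition team_bump :: "nat \<Rightarrow> (nat \<Rightarrow> nat) \<Rightarrow> (nat \<Rightarrow> 'u) \<Rightarrow> real" where
  "team_bump n a u = (\<Prod>k<N. bump n (a k) (u k))"

definition team_index :: "nat \<Rightarrow> (nat \<Rightarrow> nat) set" where
  "team_index n = (\<Pi>\<^sub>E k\<in>{..<N}. {..<bump_count n})"

definition team_point :: "nat \<Rightarrow> (nat \<Rightarrow> nat) \<Rightarrow> nat \<Rightarrow> 'u" where
  "team_point n a = (\<lambda>k\<in>{..<N}. bump_center n (a k))"

lemma team_bump:
  shows "finite (team_index n)" "team_bump n a \<in> borel_measurable (borel_vec N U)" "continuous_on S (team_bump n a)"
    "team_bump n a u \<in> {0..1}" "u \<in> space (borel_vec N U) \<Longrightarrow> (\<Sum>a\<in>team_index n. team_bump n a u) = 1"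
    "team_point n a \<in> space (borel_vec N U)"
proof -
  show "finite (team_index n)" unfolding team_index_def by (intro finite_PiE) auto
  show "team_bump n a \<in> borel_measurable (borel_vec N U)"
    unfolding team_bump_def[abs_def]
  proof (rule borel_measurable_prod)
    fix k assume "k \<in> {..<N}"
    then have "(\<lambda>u. u k) \<in> borel_vec N U \<rightarrow>\<^sub>M borel_on U" by (rule measurable_component_singleton)
    from measurable_compose[OF this bump_measurable]
    show "(\<lambda>u. bump n (a k) (u k)) \<in> borel_measurable (borel_vec N U)" .
  qed
  show "continuous_on S (team_bump n a)"
    unfolding team_bump_def[abs_def]
    by (intro continuous_on_prod continuous_on_compose2[OF bump(1)] continuous_on_subset[OF continuous_on_product_coordinates]) auto
  show "team_bump n a u \<in> {0..1}"
    unfolding team_bump_def using bump(2) by (auto intro!: prod_nonneg prod_le_1)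
  show "(\<Sum>a\<in>team_index n. team_bump n a u) = 1" if "u \<in> space (borel_vec N U)"
  proof -
    have "(\<Sum>a\<in>team_index n. team_bump n a u) = (\<Prod>k<N. \<Sum>j<bump_count n. bump n j (u k))"
      unfolding team_bump_def team_index_def by (subst prod_sum_PiE) auto
    also have "\<dots> = 1" using that bump(3) by (intro prod.neutral) (auto simp: space_PiM PiE_iff)
    finally show ?thesis .
  qed
  show "team_point n a \<in> space (borel_vec N U)" using bump(4) by (auto simp: team_point_def space_PiM)
qed

lemma compact_actions: "compact (space (borel_vec N U))" "space (borel_vec N U) \<noteq> {}"
proof -
  \<comment> \<open>Joint actions are functions equal to \<open>undefined\<close> from index
    \<open>N\<close> on. Singletons at those indices exhibit the set as a product of compact sets
    over all indices.\<close>
  have "space (borel_vec N U) = PiE UNIV (\<lambda>k. if k < N then U else {undefined})"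
    by (auto simp: space_PiM PiE_def extensional_def Pi_iff split: if_splits)
  moreover have "compact (PiE UNIV (\<lambda>k. if k < N then U else {undefined}))"
    using U(1) by (intro compact_PiE_euclidean) auto
  ultimately show "compact (space (borel_vec N U))" by simp
  show "space (borel_vec N U) \<noteq> {}" using team_bump(6) by blast
qed

lemma team_point_lim:
  assumes M: "strict_mono (M :: nat \<Rightarrow> nat)" and s: "\<And>i. s i \<in> space (borel_vec N U)"
    and a: "\<And>i. team_bump (M i) (a i) (s i) \<noteq> 0" and lim: "s \<longlonglongrightarrow> s0"
  shows "(\<lambda>i. team_point (M i) (a i)) \<longlonglongrightarrow> s0"
  unfolding tendsto_fun_iff
proof
  fix k
  have lk: "(\<lambda>i. s i k) \<longlonglongrightarrow> s0 k" using lim by (simp add: tendsto_fun_iff)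
  show "(\<lambda>i. team_point (M i) (a i) k) \<longlonglongrightarrow> s0 k"
  proof (cases "k < N")
    case True
    then have "(\<lambda>i. bump_center (M i) (a i k)) \<longlonglongrightarrow> s0 k"
      using a by (intro partition_points_lim[OF M _ lk]) (auto simp: team_bump_def)
    then show ?thesis using True by (simp add: team_point_def)
  next
    case False
    then have "s i k = undefined" for i using s[of i] PiE_arb[of "s i" "{..<N}" "\<lambda>_. U" k] by (simp add: space_PiM)
    then show ?thesis using lk False by (simp add: team_point_def)
  qed
qed

lemma integral_team_bump:
  assumes g: "g \<in> \<Gamma>" and y: "y \<in> space (borel_vec N Y)"
  shows "(\<integral>u. team_bump n a u \<partial>team_actions U Y N Q g y) = (\<Prod>k<N. action_mean n (a k) (ker k g) (y k))"
  unfolding team_bump_def team_actions_eq action_mean_def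
proof (rule integral_PiM_prod_prob)
  fix k assume "k \<in> {..<N}"
  then have k: "k < N" by simp
  have yk: "y k \<in> space (borel_on Y)" using y k by (auto simp: space_PiM PiE_iff)
  note K = kernelD[OF ker(1)[OF g k] yk]
  show "prob_space (ker k g (y k))" by (rule K)
  interpret prob_space "ker k g (y k)" by (rule K)
  show "integrable (ker k g (y k)) (bump n (a k))"
  proof (rule integrable_const_bound[where B=1])
    show "bump n (a k) \<in> borel_measurable (ker k g (y k))"
      using bump_measurable by (simp add: measurable_cong_sets[OF K(2) refl])
  qed (use bump_abs in auto)
qed simp

lemma weak_lim_team_bump:
  assumes g: "\<And>m. g m \<in> \<Gamma>" "g0 \<in> \<Gamma>" and lim: "\<And>c. (\<lambda>m. coord (g m) c) \<longlonglongrightarrow> coord g0 c"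
  shows "weak_lim (PiM {..<N} Q) (\<lambda>m y. \<Prod>k<N. action_mean n (a k) (ker k (g m)) (y k)) (\<lambda>y. \<Prod>k<N. action_mean n (a k) (ker k g0) (y k))"
  by (rule weak_lim_PiM_prob) (use Qk(1) weak_lim_action_mean[OF g lim] in auto)

lemma sets_PiM_Q: "sets (PiM {..<N} Q) = sets (borel_vec N Y)" "space (PiM {..<N} Q) = space (borel_vec N Y)"
proof -
  show s: "sets (PiM {..<N} Q) = sets (borel_vec N Y)" by (rule sets_PiM_cong) (use Qk(2) in auto)
  show "space (PiM {..<N} Q) = space (borel_vec N Y)" by (rule sets_eq_imp_space_eq[OF s])
qed

lemma prob_space_PiM_Q: "prob_space (PiM {..<N} Q)"
  by (rule prob_space_PiM) (use Qk(1) in auto)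

end

section \<open>The two-team game\<close>

text \<open>The game once the law of state and observations is in density form: \<open>L\<close> is
  the law of the state, and \<open>D\<close> the density of \<open>\<mu>\<close> with respect to the
  product of \<open>L\<close> and the reference measures. The conditional law and the functions
  \<open>f1\<close>, \<open>f2\<close> enter through \<open>D\<close> alone.\<close>

locale two_teams = t1: team U1 Y1 N1 Q1 + t2: team U2 Y2 N2 Q2
  for U1 :: "'u1::euclidean_space set" and Y1 :: "'y1::euclidean_space set" and N1 Q1
    and U2 :: "'u2::euclidean_space set" and Y2 :: "'y2::euclidean_space set" and N2 Q2 +
  fixes W :: "'w::polish_space set" and L :: "'w measure"
    and D :: "'w \<times> (nat \<Rightarrow> 'y1) \<times> (nat \<Rightarrow> 'y2) \<Rightarrow> real"
    and \<mu> :: "('w \<times> (nat \<Rightarrow> 'y1) \<times> (nat \<Rightarrow> 'y2)) measure"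
  assumes L: "prob_space L" "sets L = sets (borel_on W)"
    and D: "D \<in> borel_measurable (L \<Otimes>\<^sub>M (PiM {..<N1} Q1 \<Otimes>\<^sub>M PiM {..<N2} Q2))"
      "\<And>x. x \<in> space (L \<Otimes>\<^sub>M (PiM {..<N1} Q1 \<Otimes>\<^sub>M PiM {..<N2} Q2)) \<Longrightarrow> 0 \<le> D x"
    and \<mu>: "prob_space \<mu>" "\<mu> = density (L \<Otimes>\<^sub>M (PiM {..<N1} Q1 \<Otimes>\<^sub>M PiM {..<N2} Q2)) (\<lambda>x. ennreal (D x))"
begin

abbreviation "actions \<equiv> borel_vec N1 U1 \<Otimes>\<^sub>M borel_vec N2 U2"

definition admissible :: "('w \<times> (nat \<Rightarrow> 'u1) \<times> (nat \<Rightarrow> 'u2) \<Rightarrow> real) \<Rightarrow> bool" where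
  "admissible c \<longleftrightarrow> c \<in> borel_measurable (borel_on W \<Otimes>\<^sub>M actions) \<and>
     (\<exists>C. \<forall>w\<in>W. \<forall>u\<in>space actions. 0 \<le> c (w, u) \<and> c (w, u) \<le> C) \<and>
     (\<forall>w\<in>W. continuous_on (space actions) (\<lambda>u. c (w, u)))"

definition acts :: "(nat \<Rightarrow> ('u1 \<times> 'y1) measure) \<Rightarrow> (nat \<Rightarrow> ('u2 \<times> 'y2) measure) \<Rightarrow>
    'w \<times> (nat \<Rightarrow> 'y1) \<times> (nat \<Rightarrow> 'y2) \<Rightarrow> ((nat \<Rightarrow> 'u1) \<times> (nat \<Rightarrow> 'u2)) measure" where
  "acts g1 g2 x = team_actions U1 Y1 N1 Q1 g1 (fst (snd x)) \<Otimes>\<^sub>M team_actions U2 Y2 N2 Q2 g2 (snd (snd x))"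

text \<open>Cost of two non-randomized team policies. A Bochner integral suits limit arguments;
  \<open>inner_cost\<close> links it to the extended nonnegative integrals in
  \<open>expected_cost\<close>.\<close>

definition pure_cost where
  "pure_cost c g1 g2 = (\<integral>x. \<integral>u. c (fst x, u) \<partial>acts g1 g2 x \<partial>\<mu>)"

lemma sets_\<mu>: "sets \<mu> = sets (borel_on W \<Otimes>\<^sub>M (borel_vec N1 Y1 \<Otimes>\<^sub>M borel_vec N2 Y2))"
  unfolding \<mu>(2) sets_density by (intro sets_pair_measure_cong L t1.sets_PiM_Q t2.sets_PiM_Q)

lemma space_\<mu>: "space \<mu> = W \<times> space (borel_vec N1 Y1) \<times> space (borel_vec N2 Y2)"
  using sets_eq_imp_space_eq[OF sets_\<mu>] by (simp add: space_pair_measure)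

lemma acts_measurable:
  assumes "g1 \<in> t1.\<Gamma>" "g2 \<in> t2.\<Gamma>"
  shows "acts g1 g2 \<in> \<mu> \<rightarrow>\<^sub>M prob_algebra actions"
proof -
  have 1: "(\<lambda>x. fst (snd x)) \<in> \<mu> \<rightarrow>\<^sub>M borel_vec N1 Y1" and 2: "(\<lambda>x. snd (snd x)) \<in> \<mu> \<rightarrow>\<^sub>M borel_vec N2 Y2"
    unfolding measurable_cong_sets[OF sets_\<mu> refl]
    by (rule measurable_compose[OF measurable_snd measurable_fst], rule measurable_compose[OF measurable_snd measurable_snd])
  show ?thesis
    unfolding acts_def[abs_def]
    by (rule measurable_pair_prob[OF measurable_compose[OF 1 t1.team_actions_measurable[OF assms(1)]]
      measurable_compose[OF 2 t2.team_actions_measurable[OF assms(2)]]])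
qed

context
  fixes c assumes c: "admissible c"
begin

lemma cost_measurable: "(\<lambda>(x, u). c (fst x, u)) \<in> borel_measurable (\<mu> \<Otimes>\<^sub>M actions)"
proof -
  have "(\<lambda>z. (fst (fst z), snd z)) \<in> \<mu> \<Otimes>\<^sub>M actions \<rightarrow>\<^sub>M borel_on W \<Otimes>\<^sub>M actions"
  proof (rule measurable_Pair[OF _ measurable_snd])
    have "fst \<in> \<mu> \<rightarrow>\<^sub>M borel_on W" unfolding measurable_cong_sets[OF sets_\<mu> refl] by (rule measurable_fst)
    from measurable_compose[OF measurable_fst this] show "(\<lambda>z. fst (fst z)) \<in> \<mu> \<Otimes>\<^sub>M actions \<rightarrow>\<^sub>M borel_on W" .
  qed
  from measurable_compose[OF this, of c borel] show ?thesis
    using c by (simp add: admissible_def case_prod_unfold)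
qed

lemma cost_section_measurable:
  assumes "x \<in> space \<mu>"
  shows "(\<lambda>u. c (fst x, u)) \<in> borel_measurable actions"
  using measurable_compose[OF measurable_Pair1'[OF assms, of actions] cost_measurable] by simp

text \<open>\<open>young_convergence\<close> is applied to the kernel of all actions. Its test
  functions factor over teams and members, so their integrals converge weak-star under the product
  of the reference measures, then under the product with the law of the state, and finally under
  \<open>\<mu>\<close> by \<open>weak_lim_density\<close>.\<close>

lemma pure_cost_lim:
  assumes g1: "\<And>m. g1 m \<in> t1.\<Gamma>" "h1 \<in> t1.\<Gamma>" "\<And>i. (\<lambda>m. t1.coord (g1 m) i) \<longlonglongrightarrow> t1.coord h1 i"
    and g2: "\<And>m. g2 m \<in> t2.\<Gamma>" "h2 \<in> t2.\<Gamma>" "\<And>i. (\<lambda>m. t2.coord (g2 m) i) \<longlonglongrightarrow> t2.coord h2 i"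
  shows "(\<lambda>m. pure_cost c (g1 m) (g2 m)) \<longlonglongrightarrow> pure_cost c h1 h2"
proof -
  obtain C where C: "\<And>w u. w \<in> W \<Longrightarrow> u \<in> space actions \<Longrightarrow> 0 \<le> c (w, u) \<and> c (w, u) \<le> C"
    using c unfolding admissible_def by blast
  let ?\<phi> = "\<lambda>n v u. t1.team_bump n (fst v) (fst u) * t2.team_bump n (snd v) (snd u)"
  have "(\<lambda>m. \<integral>x. \<integral>u. (\<lambda>(x, u). c (fst x, u)) (x, u) \<partial>acts (g1 m) (g2 m) x \<partial>\<mu>) \<longlonglongrightarrow>
      (\<integral>x. \<integral>u. (\<lambda>(x, u). c (fst x, u)) (x, u) \<partial>acts h1 h2 x \<partial>\<mu>)"
  proof (rule young_convergence[where C=C and V="\<lambda>n. t1.team_index n \<times> t2.team_index n"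
      and \<phi>="?\<phi>"
      and pt="\<lambda>n v. (t1.team_point n (fst v), t2.team_point n (snd v))"])
    show "prob_space \<mu>" by (rule \<mu>)
    show "compact (space actions)" "space actions \<noteq> {}"
      using t1.compact_actions t2.compact_actions by (simp_all add: space_pair_measure compact_Times)
    show "(\<lambda>(x, u). c (fst x, u)) \<in> borel_measurable (\<mu> \<Otimes>\<^sub>M actions)" by (rule cost_measurable)
    show "\<bar>(\<lambda>(x, u). c (fst x, u)) (x, u)\<bar> \<le> C" if "x \<in> space \<mu>" "u \<in> space actions" for x u
      using C[of "fst x" u] that by (auto simp: space_\<mu>)
    show "continuous_on (space actions) (\<lambda>u. (\<lambda>(x, u). c (fst x, u)) (x, u))" if "x \<in> space \<mu>" for x
      using c that unfolding admissible_def by (auto simp: space_\<mu>)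
    show "acts (g1 m) (g2 m) \<in> \<mu> \<rightarrow>\<^sub>M prob_algebra actions" "acts h1 h2 \<in> \<mu> \<rightarrow>\<^sub>M prob_algebra actions" for m
      by (intro acts_measurable g1 g2)+
    show "finite (t1.team_index n \<times> t2.team_index n)" for n
      by (intro finite_cartesian_product t1.team_bump t2.team_bump)
    fix n v assume v: "v \<in> t1.team_index n \<times> t2.team_index n"
    show "?\<phi> n v \<in> borel_measurable actions"
      by (intro borel_measurable_times measurable_compose[OF measurable_fst t1.team_bump(2)] measurable_compose[OF measurable_snd t2.team_bump(2)])
    show "continuous_on (space actions) (?\<phi> n v)"
      by (intro continuous_on_mult continuous_on_compose2[OF t1.team_bump(3)[of UNIV]] continuous_on_compose2[OF t2.team_bump(3)[of UNIV]]
        continuous_on_fst continuous_on_snd continuous_on_id) auto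
    show "?\<phi> n v u \<in> {0..1}" for u
      using t1.team_bump(4)[of n "fst v" "fst u"] t2.team_bump(4)[of n "snd v" "snd u"] by (auto intro!: mult_le_one)
    show "(t1.team_point n (fst v), t2.team_point n (snd v)) \<in> space actions"
      using t1.team_bump(6) t2.team_bump(6) by (simp add: space_pair_measure)
    show "weak_lim \<mu> (\<lambda>m x. \<integral>u. ?\<phi> n v u \<partial>acts (g1 m) (g2 m) x)
        (\<lambda>x. \<integral>u. ?\<phi> n v u \<partial>acts h1 h2 x)"
    proof -
      let ?r1 = "\<lambda>g y. \<Prod>k<N1. t1.action_mean n (fst v k) (t1.ker k g) (y k)"
      let ?r2 = "\<lambda>g y. \<Prod>k<N2. t2.action_mean n (snd v k) (t2.ker k g) (y k)"
      \<comment> \<open>The factor 1 stands for a constant function of the state; it gives the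
        integral the product form that \<open>weak_lim_pair\<close> handles.\<close>
      have split: "(\<integral>u. ?\<phi> n v u \<partial>acts f1 f2 x)
          = 1 * (?r1 f1 (fst (snd x)) * ?r2 f2 (snd (snd x)))"
        if f: "f1 \<in> t1.\<Gamma>" "f2 \<in> t2.\<Gamma>" and x: "x \<in> space \<mu>" for f1 f2 x
      proof -
        have y: "fst (snd x) \<in> space (borel_vec N1 Y1)" "snd (snd x) \<in> space (borel_vec N2 Y2)" using x by (auto simp: space_\<mu>)
        note k1 = kernelD[OF t1.team_actions_measurable[OF f(1)] y(1)]
        note k2 = kernelD[OF t2.team_actions_measurable[OF f(2)] y(2)]
        interpret p1: prob_space "team_actions U1 Y1 N1 Q1 f1 (fst (snd x))" by (rule k1)
        interpret p2: prob_space "team_actions U2 Y2 N2 Q2 f2 (snd (snd x))" by (rule k2)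
        interpret pp: pair_prob_space "team_actions U1 Y1 N1 Q1 f1 (fst (snd x))" "team_actions U2 Y2 N2 Q2 f2 (snd (snd x))" ..
        have b1: "t1.team_bump n (fst v) \<in> borel_measurable (team_actions U1 Y1 N1 Q1 f1 (fst (snd x)))"
          using t1.team_bump(2) by (simp add: measurable_cong_sets[OF k1(2) refl])
        have b2: "t2.team_bump n (snd v) \<in> borel_measurable (team_actions U2 Y2 N2 Q2 f2 (snd (snd x)))"
          using t2.team_bump(2) by (simp add: measurable_cong_sets[OF k2(2) refl])
        have int: "integrable (acts f1 f2 x) (?\<phi> n v)"
          unfolding acts_def
        proof (rule pp.integrable_const_bound[where B=1])
          show "AE u in team_actions U1 Y1 N1 Q1 f1 (fst (snd x)) \<Otimes>\<^sub>M team_actions U2 Y2 N2 Q2 f2 (snd (snd x)).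
              norm (?\<phi> n v u) \<le> 1"
          proof (rule AE_I2)
            fix u
            show "norm (?\<phi> n v u) \<le> 1"
              using t1.team_bump(4)[of n "fst v" "fst u"] t2.team_bump(4)[of n "snd v" "snd u"] by (auto intro!: mult_le_one simp: abs_mult)
          qed
        qed (intro borel_measurable_times measurable_compose[OF measurable_fst b1] measurable_compose[OF measurable_snd b2])
        have "(\<integral>u. ?\<phi> n v u \<partial>acts f1 f2 x)
          = (\<integral>u1. \<integral>u2. t1.team_bump n (fst v) u1 * t2.team_bump n (snd v) u2 \<partial>team_actions U2 Y2 N2 Q2 f2 (snd (snd x)) \<partial>team_actions U1 Y1 N1 Q1 f1 (fst (snd x)))"
          using pp.integral_fst'[OF int[unfolded acts_def]] by (simp add: acts_def)
        also have "\<dots> = ?r1 f1 (fst (snd x)) * ?r2 f2 (snd (snd x))"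
          by (simp add: t1.integral_team_bump[OF f(1) y(1)] t2.integral_team_bump[OF f(2) y(2)])
        finally show ?thesis by simp
      qed
      have "weak_lim (PiM {..<N1} Q1 \<Otimes>\<^sub>M PiM {..<N2} Q2) (\<lambda>m y. ?r1 (g1 m) (fst y) * ?r2 (g2 m) (snd y)) (\<lambda>y. ?r1 h1 (fst y) * ?r2 h2 (snd y))"
        using t1.prob_space_PiM_Q t2.prob_space_PiM_Q
        by (intro weak_lim_pair t1.weak_lim_team_bump t2.weak_lim_team_bump g1 g2) (auto simp: prob_space_def)
      moreover have "weak_lim L (\<lambda>_ _. 1) (\<lambda>_. 1)" by (simp add: weak_lim_def)
      moreover have "prob_space (PiM {..<N1} Q1 \<Otimes>\<^sub>M PiM {..<N2} Q2)"
        by (intro prob_space_pair t1.prob_space_PiM_Q t2.prob_space_PiM_Q)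
      ultimately have "weak_lim (L \<Otimes>\<^sub>M (PiM {..<N1} Q1 \<Otimes>\<^sub>M PiM {..<N2} Q2))
          (\<lambda>m x. 1 * (?r1 (g1 m) (fst (snd x)) * ?r2 (g2 m) (snd (snd x)))) (\<lambda>x. 1 * (?r1 h1 (fst (snd x)) * ?r2 h2 (snd (snd x))))"
        using L(1) weak_lim_pair[of L "PiM {..<N1} Q1 \<Otimes>\<^sub>M PiM {..<N2} Q2" "\<lambda>_ _. 1" "\<lambda>_. 1"
          "\<lambda>m y. ?r1 (g1 m) (fst y) * ?r2 (g2 m) (snd y)" "\<lambda>y. ?r1 h1 (fst y) * ?r2 h2 (snd y)"]
        by (simp add: prob_space_def)
      from weak_lim_density[OF this D]
      have wl: "weak_lim \<mu> (\<lambda>m x. 1 * (?r1 (g1 m) (fst (snd x)) * ?r2 (g2 m) (snd (snd x)))) (\<lambda>x. 1 * (?r1 h1 (fst (snd x)) * ?r2 h2 (snd (snd x))))"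
        by (simp only: \<mu>(2)[symmetric])
      show ?thesis
      proof (rule weak_lim_cong_AE[OF wl])
        have bm: "?\<phi> n v \<in> borel_measurable actions"
          by (intro borel_measurable_times measurable_compose[OF measurable_fst t1.team_bump(2)] measurable_compose[OF measurable_snd t2.team_bump(2)])
        show "(\<lambda>x. \<integral>u. ?\<phi> n v u \<partial>acts h1 h2 x) \<in> borel_measurable \<mu>"
          by (rule kernel_integral_measurable[OF acts_measurable[OF g1(2) g2(2)] bm])
        show "\<bar>\<integral>u. ?\<phi> n v u \<partial>acts h1 h2 x\<bar> \<le> 1" if "x \<in> space \<mu>" for x
          unfolding split[OF g1(2) g2(2) that] by (rule weak_limD(4)[OF wl that])
        show "AE x in \<mu>. (\<integral>u. ?\<phi> n v u \<partial>acts h1 h2 x) = 1 * (?r1 h1 (fst (snd x)) * ?r2 h2 (snd (snd x)))"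
          by (rule AE_I2) (rule split[OF g1(2) g2(2)])
      qed (rule split[OF g1(1) g2(1)])
    qed
  next
    show "(\<Sum>v\<in>t1.team_index n \<times> t2.team_index n. ?\<phi> n v u) = 1"
      if "u \<in> space actions" for n u
    proof -
      have "(\<Sum>v\<in>t1.team_index n \<times> t2.team_index n. ?\<phi> n v u)
        = (\<Sum>a\<in>t1.team_index n. t1.team_bump n a (fst u)) * (\<Sum>b\<in>t2.team_index n. t2.team_bump n b (snd u))"
        by (simp add: sum_product sum.cartesian_product case_prod_unfold)
      then show ?thesis
        using that t1.team_bump(5)[of "fst u" n] t2.team_bump(5)[of "snd u" n] by (auto simp: space_pair_measure)
    qed
    fix M :: "nat \<Rightarrow> nat" and s v s0
    assume M: "strict_mono M" and s: "\<And>i. s i \<in> space actions"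
      and nz: "\<And>i. t1.team_bump (M i) (fst (v i)) (fst (s i)) * t2.team_bump (M i) (snd (v i)) (snd (s i)) \<noteq> 0"
      and l: "s \<longlonglongrightarrow> s0"
    have "fst (s i) \<in> space (borel_vec N1 U1)" "snd (s i) \<in> space (borel_vec N2 U2)" for i
      using s[of i] by (auto simp: space_pair_measure)
    moreover have "t1.team_bump (M i) (fst (v i)) (fst (s i)) \<noteq> 0" "t2.team_bump (M i) (snd (v i)) (snd (s i)) \<noteq> 0" for i
      using nz[of i] by auto
    ultimately have "(\<lambda>i. (t1.team_point (M i) (fst (v i)), t2.team_point (M i) (snd (v i)))) \<longlonglongrightarrow> (fst s0, snd s0)"
      by (intro tendsto_Pair t1.team_point_lim[OF M _ _ tendsto_fst[OF l]] t2.team_point_lim[OF M _ _ tendsto_snd[OF l]])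
    then show "(\<lambda>i. (t1.team_point (M i) (fst (v i)), t2.team_point (M i) (snd (v i)))) \<longlonglongrightarrow> s0" by simp
  qed
  then show ?thesis by (simp add: pure_cost_def)
qed

lemma inner_cost:
  assumes g: "g1 \<in> t1.\<Gamma>" "g2 \<in> t2.\<Gamma>"
  shows "(\<integral>\<^sup>+(w, y1, y2). (\<integral>\<^sup>+(u1, u2). ennreal (c (w, u1, u2))
      \<partial>(team_actions U1 Y1 N1 Q1 g1 y1 \<Otimes>\<^sub>M team_actions U2 Y2 N2 Q2 g2 y2)) \<partial>\<mu>) = ennreal (pure_cost c g1 g2)"
    and "0 \<le> pure_cost c g1 g2" and "\<exists>C. \<forall>g1\<in>t1.\<Gamma>. \<forall>g2\<in>t2.\<Gamma>. pure_cost c g1 g2 \<le> C"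
proof -
  interpret \<mu>: prob_space \<mu> by (rule \<mu>)
  obtain C where C: "\<And>w u. w \<in> W \<Longrightarrow> u \<in> space actions \<Longrightarrow> 0 \<le> c (w, u) \<and> c (w, u) \<le> C"
    using c unfolding admissible_def by blast
  have Cx: "0 \<le> c (fst x, u)" "c (fst x, u) \<le> C" "\<bar>c (fst x, u)\<bar> \<le> C" if "x \<in> space \<mu>" "u \<in> space actions" for x u
    using C[of "fst x" u] that by (auto simp: space_\<mu>)
  have in0: "0 \<le> (\<integral>u. c (fst x, u) \<partial>acts g1 g2 x)" and inC: "\<bar>\<integral>u. c (fst x, u) \<partial>acts g1 g2 x\<bar> \<le> C"
    and inn: "(\<integral>\<^sup>+u. ennreal (c (fst x, u)) \<partial>acts g1 g2 x) = ennreal (\<integral>u. c (fst x, u) \<partial>acts g1 g2 x)"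
    if g: "g1 \<in> t1.\<Gamma>" "g2 \<in> t2.\<Gamma>" and x: "x \<in> space \<mu>" for x g1 g2
  proof -
    note K = kernelD[OF acts_measurable[OF g] x]
    interpret prob_space "acts g1 g2 x" by (rule K)
    show "0 \<le> (\<integral>u. c (fst x, u) \<partial>acts g1 g2 x)" by (intro integral_nonneg_AE AE_I2) (use Cx[OF x] K(3) in auto)
    have m: "(\<lambda>u. c (fst x, u)) \<in> borel_measurable (acts g1 g2 x)"
      using cost_section_measurable[OF x] by (simp add: measurable_cong_sets[OF K(2) refl])
    show "\<bar>\<integral>u. c (fst x, u) \<partial>acts g1 g2 x\<bar> \<le> C" by (rule abs_integral_le[OF m]) (use Cx[OF x] K(3) in auto)
    show "(\<integral>\<^sup>+u. ennreal (c (fst x, u)) \<partial>acts g1 g2 x) = ennreal (\<integral>u. c (fst x, u) \<partial>acts g1 g2 x)"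
    proof (rule nn_integral_eq_integral)
      show "integrable (acts g1 g2 x) (\<lambda>u. c (fst x, u))"
        by (rule integrable_const_bound[where B=C, OF AE_I2 m]) (use Cx[OF x] K(3) in auto)
    qed (rule AE_I2, use Cx[OF x] K(3) in auto)
  qed
  have om: "(\<lambda>x. \<integral>u. c (fst x, u) \<partial>acts g1 g2 x) \<in> borel_measurable \<mu>" if "g1 \<in> t1.\<Gamma>" "g2 \<in> t2.\<Gamma>" for g1 g2
    using kernel_integral_measurable2[OF acts_measurable[OF that] cost_measurable] by simp
  show "0 \<le> pure_cost c g1 g2" unfolding pure_cost_def by (intro integral_nonneg_AE AE_I2 in0 g)
  have "(\<integral>\<^sup>+(w, y1, y2). (\<integral>\<^sup>+(u1, u2). ennreal (c (w, u1, u2))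
      \<partial>(team_actions U1 Y1 N1 Q1 g1 y1 \<Otimes>\<^sub>M team_actions U2 Y2 N2 Q2 g2 y2)) \<partial>\<mu>)
    = (\<integral>\<^sup>+x. \<integral>\<^sup>+u. ennreal (c (fst x, u)) \<partial>acts g1 g2 x \<partial>\<mu>)"
    by (simp add: acts_def case_prod_unfold)
  also have "\<dots> = (\<integral>\<^sup>+x. ennreal (\<integral>u. c (fst x, u) \<partial>acts g1 g2 x) \<partial>\<mu>)"
    by (intro nn_integral_cong inn g)
  also have "\<dots> = ennreal (pure_cost c g1 g2)"
    unfolding pure_cost_def
  proof (rule nn_integral_eq_integral)
    show "integrable \<mu> (\<lambda>x. \<integral>u. c (fst x, u) \<partial>acts g1 g2 x)"
      by (rule \<mu>.integrable_const_bound[where B=C, OF AE_I2 om[OF g]]) (use inC[OF g] in auto)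
  qed (intro AE_I2 in0 g)
  finally show "(\<integral>\<^sup>+(w, y1, y2). (\<integral>\<^sup>+(u1, u2). ennreal (c (w, u1, u2))
      \<partial>(team_actions U1 Y1 N1 Q1 g1 y1 \<Otimes>\<^sub>M team_actions U2 Y2 N2 Q2 g2 y2)) \<partial>\<mu>) = ennreal (pure_cost c g1 g2)" .
  have "pure_cost c g1 g2 \<le> C" if "g1 \<in> t1.\<Gamma>" "g2 \<in> t2.\<Gamma>" for g1 g2
    using \<mu>.abs_integral_le[OF om[OF that] inC[OF that]] by (simp add: pure_cost_def)
  then show "\<exists>C. \<forall>g1\<in>t1.\<Gamma>. \<forall>g2\<in>t2.\<Gamma>. pure_cost c g1 g2 \<le> C" by blast
qed

section \<open>The cost as a function of coordinates\<close>

definition coord_cost where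
  "coord_cost z = pure_cost c (t1.policy_of (fst z)) (t2.policy_of (snd z))"

lemma continuous_coord_cost: "continuous_on (t1.coord ` t1.\<Gamma> \<times> t2.coord ` t2.\<Gamma>) coord_cost"
  unfolding continuous_on_sequentially
proof (intro allI ballI impI, elim conjE)
  fix z a assume a: "a \<in> t1.coord ` t1.\<Gamma> \<times> t2.coord ` t2.\<Gamma>" and z: "\<forall>n. z n \<in> t1.coord ` t1.\<Gamma> \<times> t2.coord ` t2.\<Gamma>" "z \<longlonglongrightarrow> a"
  have a': "fst a \<in> t1.coord ` t1.\<Gamma>" "snd a \<in> t2.coord ` t2.\<Gamma>" using a by (auto simp: mem_Times_iff)
  have z': "fst (z n) \<in> t1.coord ` t1.\<Gamma>" "snd (z n) \<in> t2.coord ` t2.\<Gamma>" for n using z(1)[rule_format, of n] by (auto simp: mem_Times_iff)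
  have "(\<lambda>n. pure_cost c (t1.policy_of (fst (z n))) (t2.policy_of (snd (z n)))) \<longlonglongrightarrow> pure_cost c (t1.policy_of (fst a)) (t2.policy_of (snd a))"
  proof (rule pure_cost_lim)
    show "(\<lambda>m. t1.coord (t1.policy_of (fst (z m))) i) \<longlonglongrightarrow> t1.coord (t1.policy_of (fst a)) i" for i
      unfolding t1.policy_of(2)[OF a'(1)] t1.policy_of(2)[OF z'(1)]
      using tendsto_fst[OF z(2)] unfolding tendsto_fun_iff by blast
    show "(\<lambda>m. t2.coord (t2.policy_of (snd (z m))) i) \<longlonglongrightarrow> t2.coord (t2.policy_of (snd a)) i" for i
      unfolding t2.policy_of(2)[OF a'(2)] t2.policy_of(2)[OF z'(2)]
      using tendsto_snd[OF z(2)] unfolding tendsto_fun_iff by blast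
  qed (intro t1.policy_of t2.policy_of a' z')+
  then show "(coord_cost \<circ> z) \<longlonglongrightarrow> coord_cost a" by (simp add: coord_cost_def o_def)
qed

text \<open>A constant sequence of policies converges in coordinates to every policy with the same
  coordinates, so continuity forces equal costs, even though each policy carries its own chosen
  kernels.\<close>

lemma pure_cost_coord:
  assumes g: "g1 \<in> t1.\<Gamma>" "g2 \<in> t2.\<Gamma>"
  shows "pure_cost c g1 g2 = coord_cost (t1.coord g1, t2.coord g2)"
proof -
  have i: "t1.coord g1 \<in> t1.coord ` t1.\<Gamma>" "t2.coord g2 \<in> t2.coord ` t2.\<Gamma>" using g by auto
  have "(\<lambda>_::nat. pure_cost c g1 g2) \<longlonglongrightarrow> pure_cost c (t1.policy_of (t1.coord g1)) (t2.policy_of (t2.coord g2))"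
    by (rule pure_cost_lim) (simp_all only: t1.policy_of[OF i(1)] t2.policy_of[OF i(2)] g tendsto_const)
  then show ?thesis by (simp add: LIMSEQ_const_iff coord_cost_def)
qed

lemma coord_cost_measurable:
  "(\<lambda>z. if z \<in> t1.coord ` t1.\<Gamma> \<times> t2.coord ` t2.\<Gamma> then coord_cost z else 0) \<in> borel_measurable (borel \<Otimes>\<^sub>M borel)"
proof -
  \<comment> \<open>Extension by 0 off a closed set gives a Borel function on the whole space, which
    can be composed with \<open>coord\<close> and \<open>\<theta>1\<close>, \<open>\<theta>2\<close>
    freely.\<close>
  have "closed (t1.coord ` t1.\<Gamma> \<times> t2.coord ` t2.\<Gamma>)" by (intro closed_Times t1.closed_coord t2.closed_coord)
  then have "(\<lambda>z. if z \<in> t1.coord ` t1.\<Gamma> \<times> t2.coord ` t2.\<Gamma> then coord_cost z else 0) \<in> borel_measurable borel"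
    by (intro borel_measurable_continuous_on_if continuous_coord_cost continuous_on_const) auto
  then show ?thesis by (simp only: borel_prod)
qed

end

end

section \<open>Costs of randomized policies\<close>

context team
begin

lemma nn_integral_mixed:
  assumes \<eta>: "\<eta> \<in> space (prob_algebra (borel_on {0..1}))"
    and \<theta>: "\<theta> \<in> borel_on {0..1} \<rightarrow>\<^sub>M borel" "\<And>t. \<theta> t \<in> coord ` \<Gamma>"
    and h: "(\<lambda>g. h (coord g)) \<in> borel_measurable (borel_of (team_top U Y N Q))"
  shows "(\<integral>\<^sup>+g. h (coord g) \<partial>mixed \<eta> \<theta>) = (\<integral>\<^sup>+z. h (\<theta> z) \<partial>\<eta>)"
proof -
  have \<eta>s: "sets \<eta> = sets (borel_on {0..1})" using \<eta> by (simp add: space_prob_algebra)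
  have m: "(\<lambda>z. policy_of (\<theta> z)) \<in> \<eta> \<rightarrow>\<^sub>M borel_of (team_top U Y N Q)"
    using policy_of_measurable[OF \<theta>] by (simp add: measurable_cong_sets[OF \<eta>s refl])
  show ?thesis
    unfolding mixed_def by (subst nn_integral_distr[OF m]) (use h in \<open>simp_all add: policy_of(2)[OF \<theta>(2)]\<close>)
qed

lemma L_teamD:
  assumes "P \<in> L_team U Y N Q"
  shows "prob_space P" "sets P = sets (borel_of (team_top U Y N Q))" "space P = \<Gamma>"
  using assms sets_eq_imp_space_eq[of P "borel_of (team_top U Y N Q)"]
  by (auto simp: L_team_def space_prob_algebra topspace_team_top)

end

context two_teams
begin

abbreviation "X1 \<equiv> t1.coord ` t1.\<Gamma>"
abbreviation "X2 \<equiv> t2.coord ` t2.\<Gamma>"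

context
  fixes c assumes c: "admissible c"
begin

definition cost_ext where
  "cost_ext z = ennreal (if z \<in> X1 \<times> X2 then coord_cost c z else 0)"

lemma cost_ext_measurable: "cost_ext \<in> borel_measurable (borel \<Otimes>\<^sub>M borel)"
  unfolding cost_ext_def[abs_def] using coord_cost_measurable[OF c] by (rule measurable_compose[OF _ measurable_ennreal])

lemma coord_cost_bounds:
  obtains C where "\<And>x1 x2. x1 \<in> X1 \<Longrightarrow> x2 \<in> X2 \<Longrightarrow> 0 \<le> coord_cost c (x1, x2) \<and> coord_cost c (x1, x2) \<le> C"
proof -
  obtain g1 g2 where "g1 \<in> t1.\<Gamma>" "g2 \<in> t2.\<Gamma>" using t1.\<Gamma>_nonempty t2.\<Gamma>_nonempty by blast
  from inner_cost(3)[OF c this] obtain C where C: "\<forall>g1\<in>t1.\<Gamma>. \<forall>g2\<in>t2.\<Gamma>. pure_cost c g1 g2 \<le> C" ..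
  show thesis
  proof (rule that[of C])
    fix x1 x2 assume "x1 \<in> X1" "x2 \<in> X2"
    then show "0 \<le> coord_cost c (x1, x2) \<and> coord_cost c (x1, x2) \<le> C"
      using C inner_cost(2)[OF c] by (auto simp: pure_cost_coord[OF c, symmetric])
  qed
qed

abbreviation "cost \<equiv> expected_cost U1 Y1 N1 Q1 U2 Y2 N2 Q2 \<mu> c"

text \<open>Both orders of integration are provided, so that in either team's comparison the
  deviation is integrated outermost and the opponent's equilibrium policy inside.\<close>

lemma expected_cost_iterated:
  assumes P: "P1 \<in> L_team U1 Y1 N1 Q1" "P2 \<in> L_team U2 Y2 N2 Q2"
  shows "cost P1 P2 = (\<integral>\<^sup>+g1. \<integral>\<^sup>+g2. cost_ext (t1.coord g1, t2.coord g2) \<partial>P2 \<partial>P1)"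
    and "cost P1 P2 = (\<integral>\<^sup>+g2. \<integral>\<^sup>+g1. cost_ext (t1.coord g1, t2.coord g2) \<partial>P1 \<partial>P2)"
proof -
  note p1 = t1.L_teamD[OF P(1)] and p2 = t2.L_teamD[OF P(2)]
  interpret P1: prob_space P1 by (rule p1)
  interpret P2: prob_space P2 by (rule p2)
  interpret PP: pair_prob_space P1 P2 ..
  have m1: "(\<lambda>z. t1.coord (fst z)) \<in> P1 \<Otimes>\<^sub>M P2 \<rightarrow>\<^sub>M borel"
    by (rule measurable_compose[OF measurable_fst]) (use t1.coord_measurable in \<open>simp add: measurable_cong_sets[OF p1(2) refl]\<close>)
  have m2: "(\<lambda>z. t2.coord (snd z)) \<in> P1 \<Otimes>\<^sub>M P2 \<rightarrow>\<^sub>M borel"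
    by (rule measurable_compose[OF measurable_snd]) (use t2.coord_measurable in \<open>simp add: measurable_cong_sets[OF p2(2) refl]\<close>)
  have m: "(\<lambda>z. cost_ext (t1.coord (fst z), t2.coord (snd z))) \<in> borel_measurable (P1 \<Otimes>\<^sub>M P2)"
    by (rule measurable_compose[OF measurable_Pair[OF m1 m2] cost_ext_measurable])
  have "cost P1 P2 = (\<integral>\<^sup>+z. cost_ext (t1.coord (fst z), t2.coord (snd z)) \<partial>(P1 \<Otimes>\<^sub>M P2))"
    unfolding expected_cost_def
  proof (rule nn_integral_cong)
    fix z assume "z \<in> space (P1 \<Otimes>\<^sub>M P2)"
    then have z: "fst z \<in> t1.\<Gamma>" "snd z \<in> t2.\<Gamma>" by (auto simp: space_pair_measure p1 p2)
    then have "cost_ext (t1.coord (fst z), t2.coord (snd z)) = ennreal (pure_cost c (fst z) (snd z))"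
      by (simp add: cost_ext_def pure_cost_coord[OF c])
    then show "(case z of (g1, g2) \<Rightarrow> (\<integral>\<^sup>+(w, y1, y2). (\<integral>\<^sup>+(u1, u2). ennreal (c (w, u1, u2))
        \<partial>(team_actions U1 Y1 N1 Q1 g1 y1 \<Otimes>\<^sub>M team_actions U2 Y2 N2 Q2 g2 y2)) \<partial>\<mu>)) = cost_ext (t1.coord (fst z), t2.coord (snd z))"
      using inner_cost(1)[OF c z] by (cases z) simp
  qed
  then show "cost P1 P2 = (\<integral>\<^sup>+g1. \<integral>\<^sup>+g2. cost_ext (t1.coord g1, t2.coord g2) \<partial>P2 \<partial>P1)"
    "cost P1 P2 = (\<integral>\<^sup>+g2. \<integral>\<^sup>+g1. cost_ext (t1.coord g1, t2.coord g2) \<partial>P1 \<partial>P2)"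
    using P2.nn_integral_fst[OF m] PP.nn_integral_snd[OF m]
    by simp_all
qed

text \<open>Both maps share one parameter, so that making one of them constant covers a pure policy
  of either team against a mixture of the other.\<close>

lemma coord_cost_integral:
  assumes b: "b \<in> space (prob_algebra (borel_on {0..1}))"
    and \<theta>1: "\<theta>1 \<in> borel_on {0..1} \<rightarrow>\<^sub>M borel" "\<And>t. \<theta>1 t \<in> X1" and \<theta>2: "\<theta>2 \<in> borel_on {0..1} \<rightarrow>\<^sub>M borel" "\<And>t. \<theta>2 t \<in> X2"
  shows "(\<integral>\<^sup>+t. cost_ext (\<theta>1 t, \<theta>2 t) \<partial>b) = ennreal (\<integral>t. coord_cost c (\<theta>1 t, \<theta>2 t) \<partial>b)"
proof -
  have bs: "sets b = sets (borel_on {0..1})" and bp: "prob_space b" using b by (auto simp: space_prob_algebra)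
  interpret prob_space b by (rule bp)
  obtain C where C: "\<And>x1 x2. x1 \<in> X1 \<Longrightarrow> x2 \<in> X2 \<Longrightarrow> 0 \<le> coord_cost c (x1, x2) \<and> coord_cost c (x1, x2) \<le> C"
    by (rule coord_cost_bounds) blast
  have "(\<lambda>t. (\<theta>1 t, \<theta>2 t)) \<in> b \<rightarrow>\<^sub>M borel \<Otimes>\<^sub>M borel"
    unfolding measurable_cong_sets[OF bs refl] by (rule measurable_Pair[OF \<theta>1(1) \<theta>2(1)])
  from measurable_compose[OF this coord_cost_measurable[OF c]]
  have m: "(\<lambda>t. coord_cost c (\<theta>1 t, \<theta>2 t)) \<in> borel_measurable b" using \<theta>1(2) \<theta>2(2) by simp
  have "(\<integral>\<^sup>+t. cost_ext (\<theta>1 t, \<theta>2 t) \<partial>b) = (\<integral>\<^sup>+t. ennreal (coord_cost c (\<theta>1 t, \<theta>2 t)) \<partial>b)"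
    using \<theta>1(2) \<theta>2(2) by (simp add: cost_ext_def)
  also have "\<dots> = ennreal (\<integral>t. coord_cost c (\<theta>1 t, \<theta>2 t) \<partial>b)"
  proof (rule nn_integral_eq_integral)
    show "integrable b (\<lambda>t. coord_cost c (\<theta>1 t, \<theta>2 t))"
      by (rule integrable_const_bound[where B=C, OF AE_I2 m]) (use C[OF \<theta>1(2) \<theta>2(2)] in auto)
  qed (use C[OF \<theta>1(2) \<theta>2(2)] in auto)
  finally show ?thesis .
qed

text \<open>The deviation \<open>P1\<close> stays arbitrary and only the opponent's mixture is
  evaluated. What remains is the average over \<open>P1\<close> of the costs of pure deviations,
  which the equilibrium inequality bounds pointwise.\<close>

lemma cost_mixed_right:
  assumes P1: "P1 \<in> L_team U1 Y1 N1 Q1" and b: "b \<in> space (prob_algebra (borel_on {0..1}))"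
    and \<theta>2: "\<theta>2 \<in> borel_on {0..1} \<rightarrow>\<^sub>M borel" "\<And>t. \<theta>2 t \<in> X2"
  shows "cost P1 (t2.mixed b \<theta>2) = (\<integral>\<^sup>+g1. ennreal (\<integral>t. coord_cost c (t1.coord g1, \<theta>2 t) \<partial>b) \<partial>P1)"
proof -
  have P2: "t2.mixed b \<theta>2 \<in> L_team U2 Y2 N2 Q2" using t2.mixed_L_CO[OF b \<theta>2] by (simp add: L_CO_def)
  show ?thesis
    unfolding expected_cost_iterated(1)[OF P1 P2]
  proof (rule nn_integral_cong)
    fix g1 assume "g1 \<in> space P1"
    then have x: "t1.coord g1 \<in> X1" using t1.L_teamD(3)[OF P1] by auto
    have "(\<lambda>g2. cost_ext (t1.coord g1, t2.coord g2)) \<in> borel_measurable (borel_of (team_top U2 Y2 N2 Q2))"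
      by (rule measurable_compose[OF measurable_Pair[OF measurable_const t2.coord_measurable] cost_ext_measurable]) simp
    from t2.nn_integral_mixed[OF b \<theta>2, of "\<lambda>x. cost_ext (t1.coord g1, x)", OF this]
    show "(\<integral>\<^sup>+g2. cost_ext (t1.coord g1, t2.coord g2) \<partial>t2.mixed b \<theta>2) = ennreal (\<integral>t. coord_cost c (t1.coord g1, \<theta>2 t) \<partial>b)"
      using coord_cost_integral[OF b _ _ \<theta>2, of "\<lambda>_. t1.coord g1"] x by simp
  qed
qed

lemma cost_mixed_left:
  assumes P2: "P2 \<in> L_team U2 Y2 N2 Q2" and a: "a \<in> space (prob_algebra (borel_on {0..1}))"
    and \<theta>1: "\<theta>1 \<in> borel_on {0..1} \<rightarrow>\<^sub>M borel" "\<And>t. \<theta>1 t \<in> X1"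
  shows "cost (t1.mixed a \<theta>1) P2 = (\<integral>\<^sup>+g2. ennreal (\<integral>t. coord_cost c (\<theta>1 t, t2.coord g2) \<partial>a) \<partial>P2)"
proof -
  have P1: "t1.mixed a \<theta>1 \<in> L_team U1 Y1 N1 Q1" using t1.mixed_L_CO[OF a \<theta>1] by (simp add: L_CO_def)
  show ?thesis
    unfolding expected_cost_iterated(2)[OF P1 P2]
  proof (rule nn_integral_cong)
    fix g2 assume "g2 \<in> space P2"
    then have x: "t2.coord g2 \<in> X2" using t2.L_teamD(3)[OF P2] by auto
    have "(\<lambda>g1. cost_ext (t1.coord g1, t2.coord g2)) \<in> borel_measurable (borel_of (team_top U1 Y1 N1 Q1))"
      by (rule measurable_compose[OF measurable_Pair[OF t1.coord_measurable measurable_const] cost_ext_measurable]) simp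
    from t1.nn_integral_mixed[OF a \<theta>1, of "\<lambda>x. cost_ext (x, t2.coord g2)", OF this]
    show "(\<integral>\<^sup>+g1. cost_ext (t1.coord g1, t2.coord g2) \<partial>t1.mixed a \<theta>1) = ennreal (\<integral>t. coord_cost c (\<theta>1 t, t2.coord g2) \<partial>a)"
      using coord_cost_integral[OF a \<theta>1, of "\<lambda>_. t2.coord g2"] x by simp
  qed
qed

lemma cost_mixed_mixed:
  assumes a: "a \<in> space (prob_algebra (borel_on {0..1}))" and b: "b \<in> space (prob_algebra (borel_on {0..1}))"
    and \<theta>1: "\<theta>1 \<in> borel_on {0..1} \<rightarrow>\<^sub>M borel" "\<And>t. \<theta>1 t \<in> X1" and \<theta>2: "\<theta>2 \<in> borel_on {0..1} \<rightarrow>\<^sub>M borel" "\<And>t. \<theta>2 t \<in> X2"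
  shows "cost (t1.mixed a \<theta>1) (t2.mixed b \<theta>2) = ennreal (\<integral>s. \<integral>t. coord_cost c (\<theta>1 s, \<theta>2 t) \<partial>b \<partial>a)"
proof -
  have P1: "t1.mixed a \<theta>1 \<in> L_team U1 Y1 N1 Q1" using t1.mixed_L_CO[OF a \<theta>1] by (simp add: L_CO_def)
  have as: "sets a = sets (borel_on {0..1})" and ap: "prob_space a" using a by (auto simp: space_prob_algebra)
  have bs: "sets b = sets (borel_on {0..1})" and bp: "prob_space b" using b by (auto simp: space_prob_algebra)
  interpret a: prob_space a by (rule ap)
  interpret b: prob_space b by (rule bp)
  obtain C where C: "\<And>x1 x2. x1 \<in> X1 \<Longrightarrow> x2 \<in> X2 \<Longrightarrow> 0 \<le> coord_cost c (x1, x2) \<and> coord_cost c (x1, x2) \<le> C"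
    by (rule coord_cost_bounds) blast
  \<comment> \<open>The extension by 0 makes \<open>F\<close> Borel on the whole function space, as
    the change of variables through \<open>mixed\<close> requires.\<close>
  let ?H = "\<lambda>z. if z \<in> X1 \<times> X2 then coord_cost c z else 0"
  define F where "F x = (\<integral>t. ?H (x, \<theta>2 t) \<partial>b)" for x
  have \<theta>2b: "\<theta>2 \<in> b \<rightarrow>\<^sub>M borel" unfolding measurable_cong_sets[OF bs refl] by (rule \<theta>2)
  have \<theta>1a: "\<theta>1 \<in> a \<rightarrow>\<^sub>M borel" unfolding measurable_cong_sets[OF as refl] by (rule \<theta>1)
  have Fm: "F \<in> borel_measurable borel"
    unfolding F_def[abs_def]
  proof (rule b.borel_measurable_lebesgue_integral)
    have "(\<lambda>z. (fst z, \<theta>2 (snd z))) \<in> borel \<Otimes>\<^sub>M b \<rightarrow>\<^sub>M borel \<Otimes>\<^sub>M borel"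
      by (rule measurable_Pair[OF measurable_fst measurable_compose[OF measurable_snd \<theta>2b]])
    from measurable_compose[OF this coord_cost_measurable[OF c]]
    show "(\<lambda>(x, t). ?H (x, \<theta>2 t)) \<in> borel_measurable (borel \<Otimes>\<^sub>M b)" by (simp add: case_prod_unfold)
  qed
  have FX: "F x = (\<integral>t. coord_cost c (x, \<theta>2 t) \<partial>b)" if "x \<in> X1" for x
    unfolding F_def using that \<theta>2(2) by simp
  have F0: "0 \<le> F x" "F x \<le> C" if "x \<in> X1" for x
  proof -
    show "0 \<le> F x" unfolding FX[OF that] by (intro integral_nonneg_AE AE_I2) (use C[OF that \<theta>2(2)] in auto)
    have "(\<lambda>t. ?H (x, \<theta>2 t)) \<in> borel_measurable b"
      by (rule measurable_compose[OF measurable_Pair[OF measurable_const \<theta>2b] coord_cost_measurable[OF c]]) simp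
    then have "\<bar>F x\<bar> \<le> C" unfolding F_def by (rule b.abs_integral_le) (use that C[OF that \<theta>2(2)] \<theta>2(2) in auto)
    then show "F x \<le> C" by simp
  qed
  have "cost (t1.mixed a \<theta>1) (t2.mixed b \<theta>2) = (\<integral>\<^sup>+g1. ennreal (F (t1.coord g1)) \<partial>t1.mixed a \<theta>1)"
    unfolding cost_mixed_right[OF P1 b \<theta>2] using t1.L_teamD(3)[OF P1] by (intro nn_integral_cong) (simp add: FX)
  also have "\<dots> = (\<integral>\<^sup>+s. ennreal (F (\<theta>1 s)) \<partial>a)"
    by (rule t1.nn_integral_mixed[OF a \<theta>1, of "\<lambda>x. ennreal (F x)"])
      (rule measurable_compose[OF measurable_compose[OF t1.coord_measurable Fm] measurable_ennreal])
  also have "\<dots> = ennreal (\<integral>s. F (\<theta>1 s) \<partial>a)"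
  proof (rule nn_integral_eq_integral)
    show "integrable a (\<lambda>s. F (\<theta>1 s))"
      by (rule a.integrable_const_bound[where B=C, OF AE_I2 measurable_compose[OF \<theta>1a Fm]]) (use F0[OF \<theta>1(2)] in auto)
  qed (use F0[OF \<theta>1(2)] in auto)
  finally show ?thesis by (simp add: FX[OF \<theta>1(2)])
qed

end

text \<open>The equilibrium on the cube is carried over by \<open>mixed\<close>. Its inequality
  bounds a constant by the cost of every pure deviation, hence by the average of these costs under
  any measure in \<open>L_team\<close>.\<close>

lemma nash_equilibrium:
  assumes c: "admissible c1" "admissible c2"
  shows "\<exists>P1 \<in> L_CO U1 Y1 N1 Q1. \<exists>P2 \<in> L_CO U2 Y2 N2 Q2.
           (\<forall>P1' \<in> L_team U1 Y1 N1 Q1.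
              expected_cost U1 Y1 N1 Q1 U2 Y2 N2 Q2 \<mu> c1 P1 P2 \<le>
              expected_cost U1 Y1 N1 Q1 U2 Y2 N2 Q2 \<mu> c1 P1' P2) \<and>
           (\<forall>P2' \<in> L_team U2 Y2 N2 Q2.
              expected_cost U1 Y1 N1 Q1 U2 Y2 N2 Q2 \<mu> c2 P1 P2 \<le>
              expected_cost U1 Y1 N1 Q1 U2 Y2 N2 Q2 \<mu> c2 P1 P2')"
proof -
  have ne: "X1 \<noteq> {}" "X2 \<noteq> {}" using t1.\<Gamma>_nonempty t2.\<Gamma>_nonempty by auto
  have r1: "x i \<in> {0..1}" if "x \<in> X1" for x i using that by (elim imageE) (simp only: t1.coord_01)
  have r2: "x i \<in> {0..1}" if "x \<in> X2" for x i using that by (elim imageE) (simp only: t2.coord_01)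
  have const_le: "ennreal v \<le> (\<integral>\<^sup>+x. ennreal (f x) \<partial>P)" if "prob_space P" "\<And>x. x \<in> space P \<Longrightarrow> v \<le> f x"
    for v and f :: "'z \<Rightarrow> real" and P :: "'z measure"
  proof -
    interpret prob_space P by fact
    have "ennreal v = (\<integral>\<^sup>+x. ennreal v \<partial>P)" by (simp add: emeasure_space_1)
    also have "\<dots> \<le> (\<integral>\<^sup>+x. ennreal (f x) \<partial>P)" by (intro nn_integral_mono ennreal_leI that(2))
    finally show ?thesis .
  qed
  show ?thesis
  proof (rule nash_equilibrium_cube[of X1 X2 "coord_cost c1" "coord_cost c2"])
    show "closed X1" "closed X2" by (rule t1.closed_coord, rule t2.closed_coord)
    show "X1 \<noteq> {}" "X2 \<noteq> {}" by (rule ne)+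
    show "x i \<in> {0..1}" if "x \<in> X1" for x i by (rule r1[OF that])
    show "x i \<in> {0..1}" if "x \<in> X2" for x i by (rule r2[OF that])
    show "continuous_on (X1 \<times> X2) (coord_cost c1)" "continuous_on (X1 \<times> X2) (coord_cost c2)"
      by (intro continuous_coord_cost c)+
    fix a b \<theta>1 \<theta>2
    assume a: "a \<in> space (prob_algebra (borel_on {0..1::real}))" and b: "b \<in> space (prob_algebra (borel_on {0..1::real}))"
      and \<theta>1m: "\<theta>1 \<in> borel_on {0..1} \<rightarrow>\<^sub>M borel" and \<theta>2m: "\<theta>2 \<in> borel_on {0..1} \<rightarrow>\<^sub>M borel"
      and \<theta>1X: "\<And>t. \<theta>1 t \<in> X1" and \<theta>2X: "\<And>t. \<theta>2 t \<in> X2"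
      and ne1: "\<And>x. x \<in> X1 \<Longrightarrow> (\<integral>s. \<integral>t. coord_cost c1 (\<theta>1 s, \<theta>2 t) \<partial>b \<partial>a) \<le> (\<integral>t. coord_cost c1 (x, \<theta>2 t) \<partial>b)"
      and ne2: "\<And>x. x \<in> X2 \<Longrightarrow> (\<integral>s. \<integral>t. coord_cost c2 (\<theta>1 s, \<theta>2 t) \<partial>b \<partial>a) \<le> (\<integral>s. coord_cost c2 (\<theta>1 s, x) \<partial>a)"
    note \<theta>1 = \<theta>1m \<theta>1X and \<theta>2 = \<theta>2m \<theta>2X
    show ?thesis
    proof (intro bexI[of _ "t1.mixed a \<theta>1"] bexI[of _ "t2.mixed b \<theta>2"] conjI ballI)
      show "t1.mixed a \<theta>1 \<in> L_CO U1 Y1 N1 Q1" by (rule t1.mixed_L_CO[OF a \<theta>1])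
      show "t2.mixed b \<theta>2 \<in> L_CO U2 Y2 N2 Q2" by (rule t2.mixed_L_CO[OF b \<theta>2])
      fix P1' assume P1': "P1' \<in> L_team U1 Y1 N1 Q1"
      show "expected_cost U1 Y1 N1 Q1 U2 Y2 N2 Q2 \<mu> c1 (t1.mixed a \<theta>1) (t2.mixed b \<theta>2) \<le>
          expected_cost U1 Y1 N1 Q1 U2 Y2 N2 Q2 \<mu> c1 P1' (t2.mixed b \<theta>2)"
        unfolding cost_mixed_mixed[OF c(1) a b \<theta>1 \<theta>2] cost_mixed_right[OF c(1) P1' b \<theta>2]
        using t1.L_teamD[OF P1'] by (intro const_le ne1) auto
    next
      fix P2' assume P2': "P2' \<in> L_team U2 Y2 N2 Q2"
      show "expected_cost U1 Y1 N1 Q1 U2 Y2 N2 Q2 \<mu> c2 (t1.mixed a \<theta>1) (t2.mixed b \<theta>2) \<le>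
          expected_cost U1 Y1 N1 Q1 U2 Y2 N2 Q2 \<mu> c2 (t1.mixed a \<theta>1) P2'"
        unfolding cost_mixed_mixed[OF c(2) a b \<theta>1 \<theta>2] cost_mixed_left[OF c(2) P2' a \<theta>1]
        using t2.L_teamD[OF P2'] by (intro const_le ne2) auto
    qed
  qed
qed

end

section \<open>Reduction of the stated game to its density form\<close>

text \<open>Costs are assumed continuous for products of subspace topologies, while the compactness
  arguments live in the full function space. A sequence of joint actions that converges in the
  latter converges in the former, which is what sequential continuity uses.\<close>

lemma continuous_on_actions:
  fixes U1 :: "'u1::euclidean_space set" and U2 :: "'u2::euclidean_space set"
  assumes "continuous_map (prod_topology (product_topology (\<lambda>k. top_of_set U1) {..<N1}) (product_topology (\<lambda>k. top_of_set U2) {..<N2}))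
    euclideanreal h"
  shows "continuous_on (space (borel_vec N1 U1 \<Otimes>\<^sub>M borel_vec N2 U2)) h"
  unfolding continuous_on_sequentially
proof (intro allI ballI impI, elim conjE)
  let ?S = "space (borel_vec N1 U1 \<Otimes>\<^sub>M borel_vec N2 U2)"
  fix s a assume a: "a \<in> ?S" and s: "\<forall>n. s n \<in> ?S" "s \<longlonglongrightarrow> a"
  have PE: "fst z \<in> (\<Pi>\<^sub>E k\<in>{..<N1}. U1)" "snd z \<in> (\<Pi>\<^sub>E k\<in>{..<N2}. U2)" if "z \<in> ?S" for z
    using that by (auto simp: space_pair_measure space_PiM)
  have lim: "limitin (product_topology (\<lambda>k. top_of_set U) {..<N}) x l sequentially"
    if "\<And>n. x n \<in> (\<Pi>\<^sub>E k\<in>{..<N}. U)" "l \<in> (\<Pi>\<^sub>E k\<in>{..<N}. U)" "x \<longlonglongrightarrow> l"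
    for N :: nat and U :: "'z::topological_space set" and x l
    using that unfolding limitin_componentwise limitin_subtopology limitin_canonical_iff tendsto_fun_iff
    by (auto simp: PiE_iff intro!: always_eventually)
  have "limitin (prod_topology (product_topology (\<lambda>k. top_of_set U1) {..<N1}) (product_topology (\<lambda>k. top_of_set U2) {..<N2})) s a sequentially"
    unfolding limitin_pairwise o_def
    by (intro conjI lim PE a s(1)[rule_format] tendsto_fst[OF s(2)] tendsto_snd[OF s(2)])
  from continuous_map_limit[OF assms this] show "(h \<circ> s) \<longlonglongrightarrow> h a" by (simp add: limitin_canonical_iff)
qed

text \<open>What remains is to derive from the conditional law of the observations the joint density
  that \<open>two_teams\<close> takes as its starting point.\<close>

theorem theorem1:
  fixes P :: "'o measure"
    and W :: "'w::polish_space set"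
    and Y1 :: "'y1::euclidean_space set" and Y2 :: "'y2::euclidean_space set"
    and U1 :: "'u1::euclidean_space set" and U2 :: "'u2::euclidean_space set"
    and N1 N2 :: nat
    and w :: "'o \<Rightarrow> 'w"
    and y1 :: "nat \<Rightarrow> 'o \<Rightarrow> 'y1" and y2 :: "nat \<Rightarrow> 'o \<Rightarrow> 'y2"
    and c1 c2 :: "'w \<times> (nat \<Rightarrow> 'u1) \<times> (nat \<Rightarrow> 'u2) \<Rightarrow> real"
    and \<kappa> :: "'w \<Rightarrow> ((nat \<Rightarrow> 'y1) \<times> (nat \<Rightarrow> 'y2)) measure"
    and Q1 :: "nat \<Rightarrow> 'y1 measure" and Q2 :: "nat \<Rightarrow> 'y2 measure"
    and f1 :: "nat \<Rightarrow> 'y1 \<times> 'w \<times> (nat \<Rightarrow> 'y1) \<times> (nat \<Rightarrow> 'y2) \<Rightarrow> real"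
    and f2 :: "nat \<Rightarrow> 'y2 \<times> 'w \<times> (nat \<Rightarrow> 'y2) \<times> (nat \<Rightarrow> 'y1) \<Rightarrow> real"
    and \<mu> :: "('w \<times> (nat \<Rightarrow> 'y1) \<times> (nat \<Rightarrow> 'y2)) measure"
  assumes spaces: "W \<in> sets borel" "Y1 \<in> sets borel" "Y2 \<in> sets borel" "U1 \<noteq> {}" "U2 \<noteq> {}"
    and exogenous: "prob_space P" "w \<in> P \<rightarrow>\<^sub>M borel_on W"
      "\<And>k. k < N1 \<Longrightarrow> y1 k \<in> P \<rightarrow>\<^sub>M borel_on Y1"
      "\<And>k. k < N2 \<Longrightarrow> y2 k \<in> P \<rightarrow>\<^sub>M borel_on Y2"
    and law: "\<mu> = distr P (borel_on W \<Otimes>\<^sub>M borel_vec N1 Y1 \<Otimes>\<^sub>M borel_vec N2 Y2)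
                (\<lambda>\<omega>. (w \<omega>, obs_vec N1 y1 \<omega>, obs_vec N2 y2 \<omega>))"
    and costs:
      "c1 \<in> borel_measurable (borel_on W \<Otimes>\<^sub>M borel_vec N1 U1 \<Otimes>\<^sub>M borel_vec N2 U2)"
      "c2 \<in> borel_measurable (borel_on W \<Otimes>\<^sub>M borel_vec N1 U1 \<Otimes>\<^sub>M borel_vec N2 U2)"
      "\<And>x. x \<in> W \<times> ({..<N1} \<rightarrow>\<^sub>E U1) \<times> ({..<N2} \<rightarrow>\<^sub>E U2) \<Longrightarrow> 0 \<le> c1 x \<and> 0 \<le> c2 x"
    and cond: "is_cond_distr P (borel_on W) w (borel_vec N1 Y1 \<Otimes>\<^sub>M borel_vec N2 Y2)
                 (\<lambda>\<omega>. (obs_vec N1 y1 \<omega>, obs_vec N2 y2 \<omega>)) \<kappa>"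
    and reference:
      "\<And>k. k < N1 \<Longrightarrow> Q1 k \<in> space (prob_algebra (borel_on Y1))"
      "\<And>k. k < N2 \<Longrightarrow> Q2 k \<in> space (prob_algebra (borel_on Y2))"
    and f1:
      "\<And>k. k < N1 \<Longrightarrow> f1 k \<in> borel_measurable
         (borel_on Y1 \<Otimes>\<^sub>M borel_on W \<Otimes>\<^sub>M (\<Pi>\<^sub>M j\<in>{..<N1} - {k}. borel_on Y1) \<Otimes>\<^sub>M borel_vec N2 Y2)"
      "\<And>k. k < N1 \<Longrightarrow> \<exists>C. \<forall>x \<in> Y1 \<times> W \<times> ({..<N1} - {k} \<rightarrow>\<^sub>E Y1) \<times> ({..<N2} \<rightarrow>\<^sub>E Y2).
         0 \<le> f1 k x \<and> f1 k x \<le> C"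
    and f2:
      "\<And>k. k < N2 \<Longrightarrow> f2 k \<in> borel_measurable
         (borel_on Y2 \<Otimes>\<^sub>M borel_on W \<Otimes>\<^sub>M (\<Pi>\<^sub>M j\<in>{..<N2} - {k}. borel_on Y2) \<Otimes>\<^sub>M borel_vec N1 Y1)"
      "\<And>k. k < N2 \<Longrightarrow> \<exists>C. \<forall>x \<in> Y2 \<times> W \<times> ({..<N2} - {k} \<rightarrow>\<^sub>E Y2) \<times> ({..<N1} \<rightarrow>\<^sub>E Y1).
         0 \<le> f2 k x \<and> f2 k x \<le> C"
    and abs_cont:
      "AE w0 in distr P (borel_on W) w. \<forall>B1 B2.
         (\<forall>k<N1. B1 k \<in> sets (borel_on Y1)) \<longrightarrow> (\<forall>k<N2. B2 k \<in> sets (borel_on Y2)) \<longrightarrow>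
         emeasure (\<kappa> w0) ((\<Pi>\<^sub>E k\<in>{..<N1}. B1 k) \<times> (\<Pi>\<^sub>E k\<in>{..<N2}. B2 k)) =
         (\<integral>\<^sup>+x \<in> (\<Pi>\<^sub>E k\<in>{..<N1}. B1 k) \<times> (\<Pi>\<^sub>E k\<in>{..<N2}. B2 k).
            (case x of (z1, z2) \<Rightarrow> ennreal
               ((\<Prod>k<N1. f1 k (z1 k, w0, restrict z1 ({..<N1} - {k}), z2)) *
                (\<Prod>k<N2. f2 k (z2 k, w0, restrict z2 ({..<N2} - {k}), z1))))
          \<partial>((\<Pi>\<^sub>M k\<in>{..<N1}. Q1 k) \<Otimes>\<^sub>M (\<Pi>\<^sub>M k\<in>{..<N2}. Q2 k)))"
    and compact: "compact U1" "compact U2"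
    and cont:
      "\<And>w0 c. w0 \<in> W \<Longrightarrow> c \<in> {c1, c2} \<Longrightarrow> continuous_map
         (prod_topology (product_topology (\<lambda>k. top_of_set U1) {..<N1})
                        (product_topology (\<lambda>k. top_of_set U2) {..<N2}))
         euclideanreal (\<lambda>u. c (w0, u))"
    and bounded_cost:
      "\<exists>C. \<forall>x \<in> W \<times> ({..<N1} \<rightarrow>\<^sub>E U1) \<times> ({..<N2} \<rightarrow>\<^sub>E U2). c1 x \<le> C \<and> c2 x \<le> C"
  shows "\<exists>P1 \<in> L_CO U1 Y1 N1 Q1. \<exists>P2 \<in> L_CO U2 Y2 N2 Q2.
           (\<forall>P1' \<in> L_team U1 Y1 N1 Q1.
              expected_cost U1 Y1 N1 Q1 U2 Y2 N2 Q2 \<mu> c1 P1 P2 \<le>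
              expected_cost U1 Y1 N1 Q1 U2 Y2 N2 Q2 \<mu> c1 P1' P2) \<and>
           (\<forall>P2' \<in> L_team U2 Y2 N2 Q2.
              expected_cost U1 Y1 N1 Q1 U2 Y2 N2 Q2 \<mu> c2 P1 P2 \<le>
              expected_cost U1 Y1 N1 Q1 U2 Y2 N2 Q2 \<mu> c2 P1 P2')"
proof -
  let ?MZ = "borel_vec N1 Y1 \<Otimes>\<^sub>M borel_vec N2 Y2"
  let ?G = "{PiE {..<N1} B1 \<times> PiE {..<N2} B2 | B1 B2. (\<forall>i\<in>{..<N1}. B1 i \<in> sets (Q1 i)) \<and> (\<forall>i\<in>{..<N2}. B2 i \<in> sets (Q2 i))}"
  let ?R = "PiM {..<N1} Q1 \<Otimes>\<^sub>M PiM {..<N2} Q2"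
  define L where "L = distr P (borel_on W) w"
  \<comment> \<open>The product of all factors at a joint observation; it becomes the density of
    \<open>\<mu>\<close> with respect to the law of the state times the reference measures.\<close>
  define D where "D = (\<lambda>(w0, z1, z2). (\<Prod>k<N1. f1 k (z1 k, w0, restrict z1 ({..<N1} - {k}), z2)) *
                (\<Prod>k<N2. f2 k (z2 k, w0, restrict z2 ({..<N2} - {k}), z1)))"
  interpret P: prob_space P by (rule exogenous)
  interpret t1: team U1 Y1 N1 Q1 by unfold_locales (use compact spaces reference in auto)
  interpret t2: team U2 Y2 N2 Q2 by unfold_locales (use compact spaces reference in auto)
  have Lp: "prob_space L" unfolding L_def by (rule P.prob_space_distr) (rule exogenous)
  have Ls: "sets L = sets (borel_on W)" by (simp add: L_def)
  have Rs: "sets ?R = sets ?MZ" by (intro sets_pair_measure_cong t1.sets_PiM_Q t2.sets_PiM_Q)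
  have Rp: "prob_space ?R" by (intro prob_space_pair t1.prob_space_PiM_Q t2.prob_space_PiM_Q)
  have LR: "sets (L \<Otimes>\<^sub>M ?R) = sets (borel_on W \<Otimes>\<^sub>M ?MZ)" by (intro sets_pair_measure_cong Ls Rs)
  have spLR: "space (L \<Otimes>\<^sub>M ?R) = W \<times> ({..<N1} \<rightarrow>\<^sub>E Y1) \<times> ({..<N2} \<rightarrow>\<^sub>E Y2)"
    using sets_eq_imp_space_eq[OF LR] by (simp add: space_pair_measure space_PiM)
  have obs1: "obs_vec N1 y1 \<in> P \<rightarrow>\<^sub>M borel_vec N1 Y1"
    unfolding obs_vec_def[abs_def] by (rule measurable_restrict) (use exogenous in auto)
  have obs2: "obs_vec N2 y2 \<in> P \<rightarrow>\<^sub>M borel_vec N2 Y2"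
    unfolding obs_vec_def[abs_def] by (rule measurable_restrict) (use exogenous in auto)
  have zm: "(\<lambda>\<omega>. (w \<omega>, obs_vec N1 y1 \<omega>, obs_vec N2 y2 \<omega>)) \<in> P \<rightarrow>\<^sub>M borel_on W \<Otimes>\<^sub>M ?MZ"
    by (intro measurable_Pair exogenous obs1 obs2)
  have \<mu>p: "prob_space \<mu>" unfolding law by (rule P.prob_space_distr[OF zm])
  have \<mu>s: "sets \<mu> = sets (borel_on W \<Otimes>\<^sub>M ?MZ)" by (simp add: law)
  have \<kappa>: "\<kappa> \<in> borel_on W \<rightarrow>\<^sub>M prob_algebra ?MZ" using cond by (simp add: is_cond_distr_def)
  have z1: "(\<lambda>x. fst (snd x)) \<in> borel_on W \<Otimes>\<^sub>M ?MZ \<rightarrow>\<^sub>M borel_vec N1 Y1"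
    by (rule measurable_compose[OF measurable_snd measurable_fst])
  have z2: "(\<lambda>x. snd (snd x)) \<in> borel_on W \<Otimes>\<^sub>M ?MZ \<rightarrow>\<^sub>M borel_vec N2 Y2"
    by (rule measurable_compose[OF measurable_snd measurable_snd])
  have f1m: "(\<lambda>x. f1 k (fst (snd x) k, fst x, restrict (fst (snd x)) ({..<N1} - {k}), snd (snd x))) \<in> borel_measurable (borel_on W \<Otimes>\<^sub>M ?MZ)"
    if k: "k < N1" for k
  proof -
    have c: "(\<lambda>z. z k) \<in> borel_vec N1 Y1 \<rightarrow>\<^sub>M borel_on Y1" using k by (intro measurable_component_singleton) simp
    have r: "(\<lambda>z. restrict z ({..<N1} - {k})) \<in> borel_vec N1 Y1 \<rightarrow>\<^sub>M (\<Pi>\<^sub>M j\<in>{..<N1} - {k}. borel_on Y1)"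
      by (rule measurable_restrict_subset) auto
    show ?thesis
      by (rule measurable_compose[OF _ f1(1)[OF k]])
        (rule measurable_Pair[OF measurable_compose[OF z1 c] measurable_Pair[OF measurable_fst measurable_Pair[OF measurable_compose[OF z1 r] z2]]])
  qed
  have f2m: "(\<lambda>x. f2 k (snd (snd x) k, fst x, restrict (snd (snd x)) ({..<N2} - {k}), fst (snd x))) \<in> borel_measurable (borel_on W \<Otimes>\<^sub>M ?MZ)"
    if k: "k < N2" for k
  proof -
    have c: "(\<lambda>z. z k) \<in> borel_vec N2 Y2 \<rightarrow>\<^sub>M borel_on Y2" using k by (intro measurable_component_singleton) simp
    have r: "(\<lambda>z. restrict z ({..<N2} - {k})) \<in> borel_vec N2 Y2 \<rightarrow>\<^sub>M (\<Pi>\<^sub>M j\<in>{..<N2} - {k}. borel_on Y2)"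
      by (rule measurable_restrict_subset) auto
    show ?thesis
      by (rule measurable_compose[OF _ f2(1)[OF k]])
        (rule measurable_Pair[OF measurable_compose[OF z2 c] measurable_Pair[OF measurable_fst measurable_Pair[OF measurable_compose[OF z2 r] z1]]])
  qed
  have Dm: "D \<in> borel_measurable (L \<Otimes>\<^sub>M ?R)"
    unfolding measurable_cong_sets[OF LR refl] D_def case_prod_unfold
    by (intro borel_measurable_times borel_measurable_prod f1m f2m) auto
  have D0: "0 \<le> D x" if "x \<in> space (L \<Otimes>\<^sub>M ?R)" for x
  proof -
    obtain w0 z1 z2 where x: "x = (w0, z1, z2)" by (metis prod.exhaust)
    have z: "w0 \<in> W" "z1 \<in> {..<N1} \<rightarrow>\<^sub>E Y1" "z2 \<in> {..<N2} \<rightarrow>\<^sub>E Y2" using that by (auto simp: spLR x)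
    have "0 \<le> f1 k (z1 k, w0, restrict z1 ({..<N1} - {k}), z2)" if "k < N1" for k
    proof -
      have "(z1 k, w0, restrict z1 ({..<N1} - {k}), z2) \<in> Y1 \<times> W \<times> ({..<N1} - {k} \<rightarrow>\<^sub>E Y1) \<times> ({..<N2} \<rightarrow>\<^sub>E Y2)"
        using z that by (auto simp: PiE_iff)
      then show ?thesis using f1(2)[OF that] by blast
    qed
    moreover have "0 \<le> f2 k (z2 k, w0, restrict z2 ({..<N2} - {k}), z1)" if "k < N2" for k
    proof -
      have "(z2 k, w0, restrict z2 ({..<N2} - {k}), z1) \<in> Y2 \<times> W \<times> ({..<N2} - {k} \<rightarrow>\<^sub>E Y2) \<times> ({..<N1} \<rightarrow>\<^sub>E Y1)"
        using z that by (auto simp: PiE_iff)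
      then show ?thesis using f2(2)[OF that] by blast
    qed
    ultimately show ?thesis unfolding D_def x by (auto intro!: mult_nonneg_nonneg prod_nonneg)
  qed
  have \<mu>D: "\<mu> = density (L \<Otimes>\<^sub>M ?R) (\<lambda>x. ennreal (D x))"
  proof (rule joint_law_density[OF Lp Rp])
    show "finite_measure \<mu>" using \<mu>p by (simp add: prob_space_def)
    show "sets \<mu> = sets (L \<Otimes>\<^sub>M ?R)" by (simp only: \<mu>s LR)
    show "sets (\<kappa> w0) = sets ?R" "prob_space (\<kappa> w0)" if "w0 \<in> space L" for w0
      using kernelD[OF \<kappa>, of w0] that Rs sets_eq_imp_space_eq[OF Ls] by auto
    show "(\<lambda>x. ennreal (D x)) \<in> borel_measurable (L \<Otimes>\<^sub>M ?R)" by (rule measurable_compose[OF Dm measurable_ennreal])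
    \<comment> \<open>The defining property of the conditional distribution, read as a
      disintegration of \<open>\<mu>\<close> over the law of the state.\<close>
    show "emeasure \<mu> (A \<times> B) = (\<integral>\<^sup>+w0\<in>A. emeasure (\<kappa> w0) B \<partial>L)" if "A \<in> sets L" "B \<in> sets ?R" for A B
    proof -
      have A: "A \<in> sets (borel_on W)" and B: "B \<in> sets ?MZ" using that Ls Rs by auto
      have "emeasure \<mu> (A \<times> B) = emeasure P ((\<lambda>\<omega>. (w \<omega>, obs_vec N1 y1 \<omega>, obs_vec N2 y2 \<omega>)) -` (A \<times> B) \<inter> space P)"
        unfolding law by (rule emeasure_distr[OF zm pair_measureI[OF A B]])
      also have "(\<lambda>\<omega>. (w \<omega>, obs_vec N1 y1 \<omega>, obs_vec N2 y2 \<omega>)) -` (A \<times> B) \<inter> space P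
          = {\<omega> \<in> space P. w \<omega> \<in> A \<and> (obs_vec N1 y1 \<omega>, obs_vec N2 y2 \<omega>) \<in> B}" by auto
      also have "emeasure P \<dots> = (\<integral>\<^sup>+w0\<in>A. emeasure (\<kappa> w0) B \<partial>L)"
        using cond A B unfolding is_cond_distr_def L_def by blast
      finally show ?thesis .
    qed
    note G = pair_PiM_generator[of "{..<N1}" "{..<N2}" Q1 Q2, OF finite_lessThan finite_lessThan]
    show "Int_stable ?G" "?G \<subseteq> Pow (space ?R)" "sets ?R = sigma_sets (space ?R) ?G" "space ?R \<in> ?G" by (rule G)+
    show "AE w0 in L. \<forall>B\<in>?G.
        emeasure (\<kappa> w0) B = (\<integral>\<^sup>+z\<in>B. ennreal (D (w0, z)) \<partial>?R)"
      using abs_cont unfolding L_def[symmetric]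
    proof eventually_elim
      case (elim w0)
      show ?case
      proof
        fix B assume "B \<in> ?G"
        then obtain B1 B2 where B: "B = PiE {..<N1} B1 \<times> PiE {..<N2} B2"
          and B12: "\<forall>i\<in>{..<N1}. B1 i \<in> sets (Q1 i)" "\<forall>i\<in>{..<N2}. B2 i \<in> sets (Q2 i)" by (elim CollectE exE conjE)
        have s: "\<forall>k<N1. B1 k \<in> sets (borel_on Y1)" "\<forall>k<N2. B2 k \<in> sets (borel_on Y2)"
          using B12 t1.Qk(2) t2.Qk(2) by auto
        show "emeasure (\<kappa> w0) B = (\<integral>\<^sup>+z\<in>B. ennreal (D (w0, z)) \<partial>?R)"
          using elim[rule_format, OF s[rule_format]] unfolding B by (simp add: D_def case_prod_unfold)
      qed
    qed
  qed
  interpret two_teams U1 Y1 N1 Q1 U2 Y2 N2 Q2 W L D \<mu>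
    by (intro two_teams.intro two_teams_axioms.intro t1.team_axioms t2.team_axioms Lp Ls Dm D0 \<mu>p \<mu>D)
  obtain C where C: "\<forall>x \<in> W \<times> ({..<N1} \<rightarrow>\<^sub>E U1) \<times> ({..<N2} \<rightarrow>\<^sub>E U2). c1 x \<le> C \<and> c2 x \<le> C"
    using bounded_cost ..
  have sp: "space actions = ({..<N1} \<rightarrow>\<^sub>E U1) \<times> ({..<N2} \<rightarrow>\<^sub>E U2)" by (simp add: space_pair_measure space_PiM)
  have "admissible c1" "admissible c2"
    unfolding admissible_def
  proof (safe intro!: exI[of _ C] costs continuous_on_actions cont)
    fix w0 u1 u2 assume "w0 \<in> W" "(u1, u2) \<in> space actions"
    then have x: "(w0, u1, u2) \<in> W \<times> ({..<N1} \<rightarrow>\<^sub>E U1) \<times> ({..<N2} \<rightarrow>\<^sub>E U2)" by (simp add: sp)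
    show "0 \<le> c1 (w0, u1, u2)" "0 \<le> c2 (w0, u1, u2)" "c1 (w0, u1, u2) \<le> C" "c2 (w0, u1, u2) \<le> C"
      using costs(3)[OF x] C[rule_format, OF x] by auto
  qed
  then show ?thesis by (rule nash_equilibrium)
qed

end
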